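(* Let $k$ be a field of characteristic zero and let $A$ be an associative unital $k$-algebra. The graded algebra $\overline T(T(A))$ (with the concatenation product $|$), equipped with the coproduct $\Delta:\overline T(T(A))\to \overline T(T(A))\otimes\overline T(T(A))$ given on words $a_1\cdots a_n\in T(A)$ by $$\Delta(a_1\cdots a_n)=\sum_{S\subseteq[n]} a_S\otimes a_{J_1}|\cdots|a_{J_r}=\sum_{S\subseteq[n]} a_S\otimes a_{J^S_{[n]}}$$ and extended multiplicatively to all of $\overline T(T(A))$ by $\Delta(w_1|\cdots|w_m)=\Delta(w_1)\cdots\Delta(w_m)$, with $\Delta(\mathbf 1)=\mathbf 1\otimes\mathbf 1$, is a connected graded non-commutative and non-cocommutative Hopf algebra.
   Context: $T(A):=\bigoplus_{n>0}A^{\otimes n}$ is the nonunital tensor algebra over $A$ and $\overline T(A):=\bigoplus_{n\ge 0}A^{\otimes n}$ the full tensor algebra; elements of $T(A)$ are linear combinations of words $a_1\cdots a_n$ (tensors $a_1\otimes\cdots\otimes a_n$, $a_i\in A$), and the degree of such a word is $n$; $T_n(A):=A^{\otimes n}$. $\overline T(T(A)):=\bigoplus_{n\ge0}T(A)^{\otimes n}$, with elements of $T(A)^{\otimes n}$ written with bars, $w_1|\cdots|w_n$ ($w_i\in T(A)$), and product the bar-concatenation $(w_1|\cdots|w_n)\,|\,(w'_1|\cdots|w'_m)=w_1|\cdots|w_n|w'_1|\cdots|w'_m$; its unit is $\mathbf 1\in T(A)^{\otimes 0}=k$. It is graded by total degree: $\overline T(T(A))_n=\bigoplus_{n_1+\cdots+n_r=n}T_{n_1}(A)\otimes\cdots\otimes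 T_{n_r}(A)$. The tensor square carries the usual componentwise product. $T(A)$ is viewed inside $\overline T(T(A))$ as the component $T(A)^{\otimes1}$, and $\overline T(A)=k\oplus T(A)$ as $T(A)^{\otimes 0}\oplus T(A)^{\otimes 1}$; thus on $T(A)$ the map $\Delta$ takes values in $\overline T(A)\otimes\overline T(T(A))$. Notation for the coproduct: $[n]=\{1,\dots,n\}$. For sets of integers $S\subseteq U$ (with their natural order), a connected component of $S$ relative to $U$ is a maximal sequence $s_1<\cdots<s_p$ of elements of $S$ such that there are no $1\le i<p$ and $u\in U$ with $s_i<u<s_{i+1}$ (i.e. a maximal run of elements of $S$ that are consecutive in $U$). For a word $a_1\cdots a_n$ and $S=\{s_1<\cdots<s_p\}\subseteq[n]$, put $a_S:=a_{s_1}\cdots a_{s_p}\in T(A)$, and $a_\emptyset:=\mathbf 1$. If $J_1,\dots,J_r$ are the connected components of $[n]-S$ relative to $[n]$, listed in increasing order, put $a_{J^S_{[n]}}:=a_{J_1}|\cdots|a_{J_r}\in\overline T(T(A))$, equal to $\mathbf 1$ when $S=[n]$. The counit is the augmentation, equal to the identity on $T(A)^{\otimes0}=k$ and $0$ on $T(A)^{\otimes n}$, $n\ge1$. *)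

theory Defs
  imports Complex_Main "HOL-Library.Function_Algebras"
begin

section \<open>Vector spaces with a carrier\<close>

record ('k, 'v) vspace =
  vecs :: "'v set"
  scl :: "'k \<Rightarrow> 'v \<Rightarrow> 'v"

definition vector_space_on :: "('k::field, 'v::ab_group_add) vspace \<Rightarrow> bool" where
  "vector_space_on V \<longleftrightarrow> vector_space (scl V) \<and> module.subspace (scl V) (vecs V)"

definition linear_on ::
  "('k::field, 'v::ab_group_add) vspace \<Rightarrow> ('k, 'w::ab_group_add) vspace \<Rightarrow> ('v \<Rightarrow> 'w) \<Rightarrow> bool" where
  "linear_on V W f \<longleftrightarrow>
     (\<forall>x\<in>vecs V. f x \<in> vecs W) \<and>
     (\<forall>x\<in>vecs V. \<forall>y\<in>vecs V. f (x + y) = f x + f y) \<and>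
     (\<forall>c. \<forall>x\<in>vecs V. f (scl V c x) = scl W c (f x))"

definition ground :: "('k::field, 'k) vspace" where
  "ground = \<lparr>vecs = UNIV, scl = (*)\<rparr>"

definition fscale :: "'k::field \<Rightarrow> ('x \<Rightarrow> 'k) \<Rightarrow> ('x \<Rightarrow> 'k)" where
  "fscale c f = (\<lambda>x. c * f x)"

definition fspan :: "('x \<Rightarrow> 'k::field) set \<Rightarrow> ('k, 'x \<Rightarrow> 'k) vspace" where
  "fspan X = \<lparr>vecs = module.span fscale X, scl = fscale\<rparr>"


section \<open>Tensor products and tensor algebras\<close>

text \<open>
  A tensor is represented by its evaluation functional on multilinear forms: \<open>v \<otimes> w\<close> is
  the map sending a bilinear form \<open>b\<close> to \<open>b (v, w)\<close>, and \<open>V \<otimes> W\<close> is the span of these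
  functionals.  Over a field this is a tensor product; see \<open>tensor_space_universal\<close> and
  \<open>full_tensor_universal\<close> below.  Functionals are set to \<open>0\<close> on arguments that are not
  multilinear forms, so that equal tensors are equal functions.
\<close>

definition evaluation :: "('i \<Rightarrow> 'k::field) set \<Rightarrow> 'i \<Rightarrow> ('i \<Rightarrow> 'k) \<Rightarrow> 'k" where
  "evaluation M i = (\<lambda>f. if f \<in> M then f i else 0)"

text \<open>
  \<open>lift h\<close> is the linear extension of \<open>h\<close> from pure tensors to all tensors, for
  multilinear \<open>h\<close> whose values are themselves functionals.
\<close>

definition lift :: "('i \<Rightarrow> 'x \<Rightarrow> 'k) \<Rightarrow> (('i \<Rightarrow> 'k) \<Rightarrow> 'k) \<Rightarrow> ('x \<Rightarrow> 'k)" where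
  "lift h t = (\<lambda>x. t (\<lambda>i. h i x))"

subsection \<open>The tensor product of two spaces\<close>

definition bilinear_forms ::
  "('k::field, 'v::ab_group_add) vspace \<Rightarrow> ('k, 'w::ab_group_add) vspace \<Rightarrow> ('v \<times> 'w \<Rightarrow> 'k) set" where
  "bilinear_forms V W =
     {b. (\<forall>v\<in>vecs V. linear_on W ground (\<lambda>w. b (v, w))) \<and>
         (\<forall>w\<in>vecs W. linear_on V ground (\<lambda>v. b (v, w)))}"

definition tensor ::
  "('k::field, 'v::ab_group_add) vspace \<Rightarrow> ('k, 'w::ab_group_add) vspace \<Rightarrow> 'v \<Rightarrow> 'w
     \<Rightarrow> ('v \<times> 'w \<Rightarrow> 'k) \<Rightarrow> 'k" where
  "tensor V W v w = evaluation (bilinear_forms V W) (v, w)"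

definition tensor_space ::
  "('k::field, 'v::ab_group_add) vspace \<Rightarrow> ('k, 'w::ab_group_add) vspace
     \<Rightarrow> ('k, ('v \<times> 'w \<Rightarrow> 'k) \<Rightarrow> 'k) vspace" where
  "tensor_space V W = fspan {tensor V W v w | v w. v \<in> vecs V \<and> w \<in> vecs W}"

text \<open>\<open>tensor_map V W f g\<close> is \<open>f \<otimes> g\<close>, where \<open>V\<close> and \<open>W\<close> are the codomains of \<open>f\<close> and \<open>g\<close>.\<close>

definition tensor_map ::
  "('k::field, 'v::ab_group_add) vspace \<Rightarrow> ('k, 'w::ab_group_add) vspace
     \<Rightarrow> ('a \<Rightarrow> 'v) \<Rightarrow> ('b \<Rightarrow> 'w) \<Rightarrow> (('a \<times> 'b \<Rightarrow> 'k) \<Rightarrow> 'k) \<Rightarrow> ('v \<times> 'w \<Rightarrow> 'k) \<Rightarrow> 'k" where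
  "tensor_map V W f g = lift (\<lambda>(x, y). tensor V W (f x) (g y))"

definition tensor_swap ::
  "('k::field, 'v::ab_group_add) vspace \<Rightarrow> ('k, 'w::ab_group_add) vspace
     \<Rightarrow> (('v \<times> 'w \<Rightarrow> 'k) \<Rightarrow> 'k) \<Rightarrow> ('w \<times> 'v \<Rightarrow> 'k) \<Rightarrow> 'k" where
  "tensor_swap V W = lift (\<lambda>(x, y). tensor W V y x)"

text \<open>The associativity isomorphism \<open>(U \<otimes> V) \<otimes> W \<rightarrow> U \<otimes> (V \<otimes> W)\<close>.\<close>

definition tensor_assoc ::
  "('k::field, 'u::ab_group_add) vspace \<Rightarrow> ('k, 'v::ab_group_add) vspace
     \<Rightarrow> ('k, 'w::ab_group_add) vspace
     \<Rightarrow> (((('u \<times> 'v \<Rightarrow> 'k) \<Rightarrow> 'k) \<times> 'w \<Rightarrow> 'k) \<Rightarrow> 'k)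
     \<Rightarrow> ('u \<times> (('v \<times> 'w \<Rightarrow> 'k) \<Rightarrow> 'k) \<Rightarrow> 'k) \<Rightarrow> 'k" where
  "tensor_assoc U V W =
     lift (\<lambda>(t, z). lift (\<lambda>(x, y). tensor U (tensor_space V W) x (tensor V W y z)) t)"

subsection \<open>Tensor algebras\<close>

text \<open>
  A member of \<open>multilinear_forms V\<close> is a family of multilinear forms, one on \<open>V\<^sup>n\<close> for each
  \<open>n\<close>: the list argument carries the arity.  Hence \<open>tens V [v\<^sub>1, \<dots>, v\<^sub>n]\<close>, the tensor
  \<open>v\<^sub>1 \<otimes> \<dots> \<otimes> v\<^sub>n\<close>, lies in the summand of degree \<open>n\<close> of a direct sum.
\<close>

definition multilinear_forms :: "('k::field, 'v::ab_group_add) vspace \<Rightarrow> ('v list \<Rightarrow> 'k) set" where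
  "multilinear_forms V =
     {f. \<forall>xs\<in>lists (vecs V). \<forall>ys\<in>lists (vecs V). linear_on V ground (\<lambda>v. f (xs @ v # ys))}"

definition tens :: "('k::field, 'v::ab_group_add) vspace \<Rightarrow> 'v list \<Rightarrow> ('v list \<Rightarrow> 'k) \<Rightarrow> 'k" where
  "tens V xs = evaluation (multilinear_forms V) xs"

definition tensor_power ::
  "('k::field, 'v::ab_group_add) vspace \<Rightarrow> nat \<Rightarrow> ('k, ('v list \<Rightarrow> 'k) \<Rightarrow> 'k) vspace" where
  "tensor_power V n = fspan {tens V xs | xs. xs \<in> lists (vecs V) \<and> length xs = n}"

definition nonunital_tensor ::
  "('k::field, 'v::ab_group_add) vspace \<Rightarrow> ('k, ('v list \<Rightarrow> 'k) \<Rightarrow> 'k) vspace" where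
  "nonunital_tensor V = fspan {tens V xs | xs. xs \<in> lists (vecs V) \<and> 0 < length xs}"

definition full_tensor ::
  "('k::field, 'v::ab_group_add) vspace \<Rightarrow> ('k, ('v list \<Rightarrow> 'k) \<Rightarrow> 'k) vspace" where
  "full_tensor V = fspan {tens V xs | xs. xs \<in> lists (vecs V)}"

definition concat_mult ::
  "('k::field, 'v::ab_group_add) vspace
     \<Rightarrow> (((('v list \<Rightarrow> 'k) \<Rightarrow> 'k) \<times> (('v list \<Rightarrow> 'k) \<Rightarrow> 'k) \<Rightarrow> 'k) \<Rightarrow> 'k)
     \<Rightarrow> ('v list \<Rightarrow> 'k) \<Rightarrow> 'k" where
  "concat_mult V = lift (\<lambda>(x, y). lift (\<lambda>xs. lift (\<lambda>ys. tens V (xs @ ys)) y) x)"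

definition augmentation :: "(('v list \<Rightarrow> 'k::field) \<Rightarrow> 'k) \<Rightarrow> 'k" where
  "augmentation t = t (\<lambda>xs. if xs = [] then 1 else 0)"


subsection \<open>Universal properties\<close>

interpretation fscale: vector_space fscale
  by unfold_locales (auto simp: fscale_def fun_eq_iff algebra_simps)

lemma fscale_apply [simp]: "fscale c f x = c * f x"
  by (simp add: fscale_def)

lemma vecs_fspan [simp]: "vecs (fspan X) = fscale.span X"
  and scl_fspan [simp]: "scl (fspan X) = fscale"
  by (simp_all add: fspan_def)

lemma vecs_ground [simp]: "vecs ground = UNIV"
  and scl_ground [simp]: "scl ground = (*)"
  by (simp_all add: ground_def)

lemma vector_space_on_fspan: "vector_space_on (fspan X)"
  by (simp add: vector_space_on_def fscale.vector_space_axioms)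

lemma tensor_space_eq:
  "tensor_space V W = fspan (evaluation (bilinear_forms V W) ` (vecs V \<times> vecs W))"
  unfolding tensor_space_def tensor_def by (rule arg_cong[where f = fspan]) auto

lemma full_tensor_eq: "full_tensor V = fspan (evaluation (multilinear_forms V) ` lists (vecs V))"
  unfolding full_tensor_def tens_def by (rule arg_cong[where f = fspan]) auto

lemma linear_on_fspan_unique:
  assumes "linear_on (fspan X) U f" "linear_on (fspan X) U g"
    and "vector_space_on U" and "\<And>x. x \<in> X \<Longrightarrow> f x = g x" and x: "x \<in> vecs (fspan X)"
  shows "f x = g x"
proof -
  interpret U: vector_space "scl U" using assms(3) by (simp add: vector_space_on_def)
  have f: "f 0 = 0" using assms(1) fscale.span_zero[of X]
    unfolding linear_on_def by (metis fscale.scale_zero_left U.scale_zero_left vecs_fspan scl_fspan)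
  have g: "g 0 = 0" using assms(2) fscale.span_zero[of X]
    unfolding linear_on_def by (metis fscale.scale_zero_left U.scale_zero_left vecs_fspan scl_fspan)
  have "x \<in> fscale.span X \<and> f x = g x"
    using x[unfolded vecs_fspan]
  proof (induction rule: fscale.span_induct_alt)
    case base
    show "0 \<in> fscale.span X \<and> f 0 = g 0" using f g by (simp add: fscale.span_zero)
  next
    case (step c a y)
    have a: "a \<in> fscale.span X" "fscale c a \<in> fscale.span X"
      using step by (auto intro: fscale.span_base fscale.span_scale)
    moreover have "y \<in> fscale.span X \<and> f y = g y" by (rule step)
    ultimately show "fscale c a + y \<in> fscale.span X \<and> f (fscale c a + y) = g (fscale c a + y)"
      using step(1) assms(1,2,4) by (simp add: linear_on_def fscale.span_add)
  qed
  then show ?thesis by simp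
qed

lemma evaluation_universal:
  fixes U :: "('k::field, 'u::ab_group_add) vspace"
  assumes U: "vector_space_on U" and h: "\<And>i. i \<in> I \<Longrightarrow> h i \<in> vecs U"
    and forms: "\<And>p. linear_on U ground p \<Longrightarrow> (\<lambda>i. p (h i)) \<in> M"
  shows "\<exists>\<phi>. linear_on (fspan (evaluation M ` I)) U \<phi> \<and> (\<forall>i\<in>I. \<phi> (evaluation M i) = h i)"
proof -
  let ?E = "evaluation M ` I"
  interpret U: vector_space "scl U" using U by (simp add: vector_space_on_def)
  interpret P: vector_space_pair fscale "scl U" ..
  obtain B where B: "B \<subseteq> ?E" "fscale.independent B" "?E \<subseteq> fscale.span B"
    using fscale.maximal_independent_subset by metis
  then have "\<exists>r. \<forall>b\<in>B. r b \<in> I \<and> evaluation M (r b) = b"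
    by (intro bchoice) auto
  then obtain r where r: "\<And>b. b \<in> B \<Longrightarrow> r b \<in> I \<and> evaluation M (r b) = b" by blast
  define \<phi> where "\<phi> = P.construct B (\<lambda>b. h (r b))"
  interpret phi: Vector_Spaces.linear fscale "scl U" \<phi>
    unfolding \<phi>_def by (rule P.linear_construct[OF B(2)])
  have phiB: "\<phi> b = h (r b)" if "b \<in> B" for b
    unfolding \<phi>_def by (rule P.construct_basis[OF B(2) that])
  define C where "C = U.extend_basis {}"
  have C: "U.independent C" "U.span C = UNIV"
    by (simp_all add: C_def U.independent_extend_basis U.independent_empty)
  have key: "\<phi> (evaluation M i) = h i" if i: "i \<in> I" for i
  proof -
    have "U.representation C (\<phi> (evaluation M i)) c = U.representation C (h i) c" for c
    proof -
      let ?p = "\<lambda>u. U.representation C u c"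
      interpret rep: Vector_Spaces.linear "scl U" "(*)" ?p
        using U.linear_representation[OF C] .
      have "linear_on U ground ?p"
        by (simp add: linear_on_def rep.add rep.scale)
      then have pM: "(\<lambda>i. ?p (h i)) \<in> M" by (rule forms)
      have "t (\<lambda>i. ?p (h i)) = ?p (\<phi> t)" if "t \<in> fscale.span B" for t
        using that
      proof (induction rule: fscale.span_induct_alt)
        case base
        show "0 (\<lambda>i. ?p (h i)) = ?p (\<phi> 0)" by (simp add: phi.zero rep.zero)
      next
        case (step a b y)
        have "b (\<lambda>i. ?p (h i)) = evaluation M (r b) (\<lambda>i. ?p (h i))"
          using r[OF step(1)] by simp
        also have "\<dots> = ?p (h (r b))" using pM by (simp add: evaluation_def)
        finally have "b (\<lambda>i. ?p (h i)) = ?p (h (r b))" .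
        moreover have "y (\<lambda>i. ?p (h i)) = ?p (\<phi> y)" by (rule step)
        ultimately show "(fscale a b + y) (\<lambda>i. ?p (h i)) = ?p (\<phi> (fscale a b + y))"
          using step(1) by (simp add: phi.add phi.scale rep.add rep.scale phiB)
      qed
      moreover have "evaluation M i \<in> fscale.span B" using B(3) i by blast
      ultimately have "evaluation M i (\<lambda>i. ?p (h i)) = ?p (\<phi> (evaluation M i))" by blast
      then show ?thesis using pM by (simp add: evaluation_def)
    qed
    then have eq: "U.representation C (\<phi> (evaluation M i)) = U.representation C (h i)" by blast
    have sp: "u \<in> U.span C" for u by (simp add: C(2))
    show ?thesis
      using U.sum_nonzero_representation_eq[OF C(1) sp, of "\<phi> (evaluation M i)"]
        U.sum_nonzero_representation_eq[OF C(1) sp, of "h i"]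
      unfolding eq by (rule trans[OF sym])
  qed
  have "fscale.span ?E \<subseteq> {t. \<phi> t \<in> vecs U}"
    using U key h
    by (intro fscale.span_minimal fscale.subspaceI)
       (auto simp: phi.add phi.scale phi.zero vector_space_on_def
          intro: U.subspace_0 U.subspace_add U.subspace_scale)
  then have "linear_on (fspan ?E) U \<phi>"
    by (auto simp: linear_on_def phi.add phi.scale)
  with key show ?thesis by blast
qed

lemma linear_on_ground_comp:
  "linear_on V U h \<Longrightarrow> linear_on U ground p \<Longrightarrow> linear_on V ground (\<lambda>v. p (h v))"
  by (simp add: linear_on_def)

theorem tensor_space_universal:
  fixes U :: "('k::field, 'u::ab_group_add) vspace"
  assumes U: "vector_space_on U"
    and hW: "\<And>v. v \<in> vecs V \<Longrightarrow> linear_on W U (\<lambda>w. h v w)"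
    and hV: "\<And>w. w \<in> vecs W \<Longrightarrow> linear_on V U (\<lambda>v. h v w)"
  shows "\<exists>\<phi>. linear_on (tensor_space V W) U \<phi> \<and>
     (\<forall>v\<in>vecs V. \<forall>w\<in>vecs W. \<phi> (tensor V W v w) = h v w) \<and>
     (\<forall>\<psi>. linear_on (tensor_space V W) U \<psi> \<and>
        (\<forall>v\<in>vecs V. \<forall>w\<in>vecs W. \<psi> (tensor V W v w) = h v w) \<longrightarrow>
        (\<forall>t\<in>vecs (tensor_space V W). \<psi> t = \<phi> t))"
proof -
  let ?M = "bilinear_forms V W" and ?I = "vecs V \<times> vecs W"
  have M: "(\<lambda>i. p (case_prod h i)) \<in> ?M" if "linear_on U ground p" for p
    using linear_on_ground_comp[OF hW that] linear_on_ground_comp[OF hV that]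
    by (simp add: bilinear_forms_def)
  have hU: "case_prod h i \<in> vecs U" if "i \<in> ?I" for i
    using that hW by (auto simp: linear_on_def)
  obtain \<phi> where phi: "linear_on (tensor_space V W) U \<phi>"
    "\<forall>i\<in>?I. \<phi> (evaluation ?M i) = case_prod h i"
    unfolding tensor_space_eq
    using evaluation_universal[where h = "case_prod h" and I = ?I and M = ?M, OF U]
      hU M by metis
  show ?thesis
  proof (intro exI[of _ \<phi>] conjI ballI allI impI)
    show vw: "\<phi> (tensor V W v w) = h v w" if "v \<in> vecs V" "w \<in> vecs W" for v w
      using bspec[OF phi(2), of "(v, w)"] that by (simp add: tensor_def)
    fix \<psi> t
    assume psi: "linear_on (tensor_space V W) U \<psi> \<and>
        (\<forall>v\<in>vecs V. \<forall>w\<in>vecs W. \<psi> (tensor V W v w) = h v w)"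
      and t: "t \<in> vecs (tensor_space V W)"
    show "\<psi> t = \<phi> t"
    proof (rule linear_on_fspan_unique[where f = \<psi> and g = \<phi> and x = t])
      show "linear_on (fspan {tensor V W v w |v w. v \<in> vecs V \<and> w \<in> vecs W}) U \<psi>"
        using psi by (simp only: tensor_space_def)
      show "linear_on (fspan {tensor V W v w |v w. v \<in> vecs V \<and> w \<in> vecs W}) U \<phi>"
        using phi(1) by (simp only: tensor_space_def)
      show "t \<in> vecs (fspan {tensor V W v w |v w. v \<in> vecs V \<and> w \<in> vecs W})"
        using t by (simp only: tensor_space_def)
      fix x assume "x \<in> {tensor V W v w |v w. v \<in> vecs V \<and> w \<in> vecs W}"
      then obtain v w where "x = tensor V W v w" "v \<in> vecs V" "w \<in> vecs W"
        by (elim CollectE exE conjE)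
      then show "\<psi> x = \<phi> x" using psi vw by simp
    qed (rule U)
  qed (rule phi(1))
qed

theorem full_tensor_universal:
  fixes U :: "('k::field, 'u::ab_group_add) vspace"
  assumes U: "vector_space_on U"
    and h: "\<And>xs ys. xs \<in> lists (vecs V) \<Longrightarrow> ys \<in> lists (vecs V) \<Longrightarrow>
               linear_on V U (\<lambda>v. h (xs @ v # ys))"
    and h0: "h [] \<in> vecs U"
  shows "\<exists>\<phi>. linear_on (full_tensor V) U \<phi> \<and> (\<forall>xs\<in>lists (vecs V). \<phi> (tens V xs) = h xs) \<and>
     (\<forall>\<psi>. linear_on (full_tensor V) U \<psi> \<and> (\<forall>xs\<in>lists (vecs V). \<psi> (tens V xs) = h xs) \<longrightarrow>
        (\<forall>t\<in>vecs (full_tensor V). \<psi> t = \<phi> t))"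
proof -
  let ?M = "multilinear_forms V" and ?I = "lists (vecs V)"
  have M: "(\<lambda>i. p (h i)) \<in> ?M" if "linear_on U ground p" for p
    unfolding multilinear_forms_def
  proof (intro CollectI ballI)
    fix xs ys assume "xs \<in> ?I" "ys \<in> ?I"
    then show "linear_on V ground (\<lambda>v. p (h (xs @ v # ys)))"
      by (intro linear_on_ground_comp[OF h that])
  qed
  have hU: "h xs \<in> vecs U" if "xs \<in> ?I" for xs
    using that h[of "[]" "tl xs"] h0 by (cases xs) (auto simp: linear_on_def)
  obtain \<phi> where phi: "linear_on (full_tensor V) U \<phi>"
    "\<forall>i\<in>?I. \<phi> (evaluation ?M i) = h i"
    unfolding full_tensor_eq
    using evaluation_universal[where h = h and I = ?I and M = ?M, OF U] hU M by metis
  show ?thesis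
  proof (intro exI[of _ \<phi>] conjI ballI allI impI)
    show xs: "\<phi> (tens V xs) = h xs" if "xs \<in> ?I" for xs
      using bspec[OF phi(2) that] by (simp add: tens_def)
    fix \<psi> t
    assume psi: "linear_on (full_tensor V) U \<psi> \<and> (\<forall>xs\<in>?I. \<psi> (tens V xs) = h xs)"
      and t: "t \<in> vecs (full_tensor V)"
    show "\<psi> t = \<phi> t"
    proof (rule linear_on_fspan_unique[where f = \<psi> and g = \<phi> and x = t])
      show "linear_on (fspan {tens V xs |xs. xs \<in> ?I}) U \<psi>"
        using psi by (simp only: full_tensor_def)
      show "linear_on (fspan {tens V xs |xs. xs \<in> ?I}) U \<phi>"
        using phi(1) by (simp only: full_tensor_def)
      show "t \<in> vecs (fspan {tens V xs |xs. xs \<in> ?I})"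
        using t by (simp only: full_tensor_def)
      fix x assume "x \<in> {tens V xs |xs. xs \<in> ?I}"
      then obtain xs where x: "x = tens V xs" "xs \<in> ?I"
        by (elim CollectE exE conjE)
      then show "\<psi> x = \<phi> x" using bspec[OF conjunct2[OF psi] x(2)] xs[OF x(2)] by simp
    qed (rule U)
  qed (rule phi(1))
qed

subsection \<open>Linear extensions\<close>

lemma lift_evaluation: "(\<lambda>i. h i x) \<in> M \<Longrightarrow> lift h (evaluation M i) x = h i x"
  by (simp add: lift_def evaluation_def)

lemma lift_zero: "lift h 0 = 0"
  and lift_add: "lift h (s + t) = lift h s + lift h t"
  and lift_fscale: "lift h (fscale c t) = fscale c (lift h t)"
  by (auto simp: lift_def fun_eq_iff)

lemma lift_linear_on:
  assumes h: "\<And>i. i \<in> I \<Longrightarrow> h i \<in> vecs (fspan Y)" and M: "\<And>x. (\<lambda>i. h i x) \<in> M"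
  shows "linear_on (fspan (evaluation M ` I)) (fspan Y) (lift h)"
    and "lift h (evaluation M i) = h i"
proof -
  show e: "lift h (evaluation M i) = h i" for i
    by (auto simp: fun_eq_iff lift_evaluation M)
  have "fscale.span (evaluation M ` I) \<subseteq> {t. lift h t \<in> fscale.span Y}"
    using h e
    by (intro fscale.span_minimal fscale.subspaceI)
       (auto simp: lift_add lift_fscale lift_zero fscale.span_zero
          intro: fscale.span_add fscale.span_scale)
  then show "linear_on (fspan (evaluation M ` I)) (fspan Y) (lift h)"
    by (auto simp: linear_on_def lift_add lift_fscale)
qed

lemma linear_on_fspan_eval:
  "linear_on V (fspan Y) h \<Longrightarrow> linear_on V ground (\<lambda>v. h v x)"
  by (simp add: linear_on_def)

lemma tensor_lift:
  assumes "\<And>v. v \<in> vecs V \<Longrightarrow> linear_on W (fspan Y) (\<lambda>w. h v w)"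
    and "\<And>w. w \<in> vecs W \<Longrightarrow> linear_on V (fspan Y) (\<lambda>v. h v w)"
  shows "linear_on (tensor_space V W) (fspan Y) (lift (\<lambda>(v, w). h v w))"
    and "lift (\<lambda>(v, w). h v w) (tensor V W v w) = h v w"
proof -
  have 1: "(\<lambda>i. (case i of (v, w) \<Rightarrow> h v w) x) \<in> bilinear_forms V W" for x
    using linear_on_fspan_eval[OF assms(1)] linear_on_fspan_eval[OF assms(2)]
    by (simp add: bilinear_forms_def)
  have 2: "(case i of (v, w) \<Rightarrow> h v w) \<in> vecs (fspan Y)" if "i \<in> vecs V \<times> vecs W" for i
    using that assms by (auto simp: linear_on_def)
  show "linear_on (tensor_space V W) (fspan Y) (lift (\<lambda>(v, w). h v w))"
    unfolding tensor_space_eq by (rule lift_linear_on[OF 2 1])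
  show "lift (\<lambda>(v, w). h v w) (tensor V W v w) = h v w"
    unfolding tensor_def by (subst lift_linear_on(2)[OF 2 1]) auto
qed

lemma tens_lift:
  assumes "\<And>xs ys. xs \<in> lists (vecs V) \<Longrightarrow> ys \<in> lists (vecs V) \<Longrightarrow>
             linear_on V (fspan Y) (\<lambda>v. h (xs @ v # ys))"
    and "h [] \<in> vecs (fspan Y)"
  shows "linear_on (full_tensor V) (fspan Y) (lift h)"
    and "lift h (tens V xs) = h xs"
proof -
  have 1: "(\<lambda>i. h i x) \<in> multilinear_forms V" for x
    using linear_on_fspan_eval[OF assms(1)] by (simp add: multilinear_forms_def)
  have 2: "h xs \<in> vecs (fspan Y)" if "xs \<in> lists (vecs V)" for xs
    using that assms(1)[of "[]" "tl xs"] assms(2) by (cases xs) (auto simp: linear_on_def)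
  show "linear_on (full_tensor V) (fspan Y) (lift h)"
    unfolding full_tensor_eq by (rule lift_linear_on[OF 2 1])
  show "lift h (tens V xs) = h xs"
    unfolding tens_def by (subst lift_linear_on(2)[OF 2 1]) auto
qed

lemma tensor_linear:
  shows "v \<in> vecs V \<Longrightarrow> linear_on W (tensor_space V W) (\<lambda>w. tensor V W v w)"
    and "w \<in> vecs W \<Longrightarrow> linear_on V (tensor_space V W) (\<lambda>v. tensor V W v w)"
proof -
  have *: "tensor V W v w \<in> vecs (tensor_space V W)" if "v \<in> vecs V" "w \<in> vecs W" for v w
    using that by (auto simp: tensor_space_def intro!: fscale.span_base)
  have s: "scl (tensor_space V W) = fscale" by (simp add: tensor_space_def)
  show "linear_on W (tensor_space V W) (\<lambda>w. tensor V W v w)" if "v \<in> vecs V"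
    using that *
    by (auto simp: linear_on_def s tensor_def evaluation_def fun_eq_iff bilinear_forms_def)
  show "linear_on V (tensor_space V W) (\<lambda>v. tensor V W v w)" if "w \<in> vecs W"
    using that *
    by (auto simp: linear_on_def s tensor_def evaluation_def fun_eq_iff bilinear_forms_def)
qed

lemma tens_linear:
  assumes "xs \<in> lists (vecs V)" "ys \<in> lists (vecs V)"
  shows "linear_on V (full_tensor V) (\<lambda>v. tens V (xs @ v # ys))"
  using assms unfolding full_tensor_def linear_on_def vecs_fspan
proof (intro conjI ballI allI)
  fix x assume x: "x \<in> vecs V"
  then show "tens V (xs @ x # ys) \<in> fscale.span {tens V xs |xs. xs \<in> lists (vecs V)}"
    using assms by (intro fscale.span_base CollectI exI[of _ "xs @ x # ys"]) auto
qed (auto simp: tens_def evaluation_def fun_eq_iff multilinear_forms_def linear_on_def)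

definition form_space :: "('i \<Rightarrow> 'k::field) set \<Rightarrow> 'i set \<Rightarrow> bool" where
  "form_space M I \<longleftrightarrow> fscale.subspace M \<and> (\<forall>f\<in>M. \<forall>g. (\<forall>i\<in>I. f i = g i) \<longrightarrow> g \<in> M)"

lemma form_space_bilinear:
  assumes "vector_space_on V" "vector_space_on W"
  shows "form_space (bilinear_forms V W) (vecs V \<times> vecs W)"
  using assms
  by (auto simp: form_space_def bilinear_forms_def linear_on_def fscale.subspace_def
      vector_space_on_def module.subspace_def vector_space_def module_def algebra_simps
      module_iff_vector_space)

lemma form_space_multilinear:
  assumes "vector_space_on V"
  shows "form_space (multilinear_forms V) (lists (vecs V))"
proof -
  have m: "module (scl V)"
    using assms by (simp add: vector_space_on_def module_iff_vector_space)
  then have "x + y \<in> vecs V" "scl V c x \<in> vecs V" if "x \<in> vecs V" "y \<in> vecs V" for x y c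
    using assms that by (auto simp: vector_space_on_def module.subspace_def[OF m])
  note V = this
  have "fscale.subspace (multilinear_forms V)"
    by (auto simp: multilinear_forms_def linear_on_def fscale.subspace_def algebra_simps)
  moreover have "g \<in> multilinear_forms V"
    if f: "f \<in> multilinear_forms V" and eq: "\<forall>i\<in>lists (vecs V). f i = g i" for f g
  proof -
    have "f (xs @ v # ys) = g (xs @ v # ys)"
      if "xs \<in> lists (vecs V)" "ys \<in> lists (vecs V)" "v \<in> vecs V" for xs ys v
      using eq that by simp
    then show ?thesis
      using f V by (simp add: multilinear_forms_def linear_on_def del: in_lists_conv_set)
  qed
  ultimately show ?thesis by (auto simp: form_space_def)
qed

lemma evaluation_span_linear:
  assumes "s \<in> fscale.span (evaluation M ` I)" "form_space M I" "f \<in> M" "g \<in> M"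
  shows "s (\<lambda>i. f i + g i) = s f + s g" "s (\<lambda>i. c * f i) = c * s f"
    and "(\<And>i. i \<in> I \<Longrightarrow> f i = g i) \<Longrightarrow> s f = s g"
proof -
  have M: "(\<lambda>i. f i + g i) \<in> M" "(\<lambda>i. c * f i) \<in> M"
    using assms fscale.subspace_add[of M f g] fscale.subspace_scale[of M f c]
    by (simp_all add: form_space_def plus_fun_def fscale_def)
  show "s (\<lambda>i. f i + g i) = s f + s g" "s (\<lambda>i. c * f i) = c * s f"
    using assms(1)
    by (induction rule: fscale.span_induct_alt)
       (use M assms(3,4) in \<open>auto simp: evaluation_def algebra_simps\<close>)
  show "s f = s g" if "\<And>i. i \<in> I \<Longrightarrow> f i = g i"
    using assms(1)
    by (induction rule: fscale.span_induct_alt)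
       (use that assms(3,4) in \<open>auto simp: evaluation_def algebra_simps\<close>)
qed

lemma bilinear_lift:
  fixes k :: "'i \<Rightarrow> 'j \<Rightarrow> 'x \<Rightarrow> 'k::field"
  assumes M: "form_space M I" and N: "form_space N J"
    and kY: "\<And>i j. i \<in> I \<Longrightarrow> j \<in> J \<Longrightarrow> k i j \<in> vecs (fspan Y)"
    and kN: "\<And>i z. i \<in> I \<Longrightarrow> (\<lambda>j. k i j z) \<in> N"
    and kM: "\<And>j z. j \<in> J \<Longrightarrow> (\<lambda>i. k i j z) \<in> M"
  defines "B \<equiv> \<lambda>x y. lift (\<lambda>i. lift (k i) y) x"
    and "X \<equiv> fspan (evaluation M ` I)" and "Z \<equiv> fspan (evaluation N ` J)"
  shows "x \<in> vecs X \<Longrightarrow> linear_on Z (fspan Y) (B x)"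
    and "y \<in> vecs Z \<Longrightarrow> linear_on X (fspan Y) (\<lambda>x. B x y)"
    and "i \<in> I \<Longrightarrow> j \<in> J \<Longrightarrow> B (evaluation M i) (evaluation N j) = k i j"
proof -
  have e: "lift (k i) (evaluation N j) = k i j" if "i \<in> I" for i j
    using kN[OF that] by (auto simp: fun_eq_iff lift_evaluation)
  have Msub: "fscale.subspace M" using M by (simp add: form_space_def)
  have inM: "(\<lambda>i. lift (k i) y z) \<in> M" if "y \<in> vecs Z" for y z
    using that unfolding Z_def vecs_fspan
  proof (induction rule: fscale.span_induct_alt)
    case base
    show ?case using fscale.subspace_0[OF Msub] by (simp add: lift_def zero_fun_def)
  next
    case (step c a y)
    then obtain j where j: "j \<in> J" "a = evaluation N j" by blast
    have a: "(\<lambda>i. lift (k i) a z) \<in> M"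
      using M kM[OF j(1), of z] e unfolding form_space_def j(2) by auto
    have "(\<lambda>i. lift (k i) (fscale c a + y) z) =
        fscale c (\<lambda>i. lift (k i) a z) + (\<lambda>i. lift (k i) y z)"
      by (simp add: fun_eq_iff lift_add lift_fscale)
    also have "\<dots> \<in> M"
      by (intro fscale.subspace_add[OF Msub] fscale.subspace_scale[OF Msub] a step.IH)
    finally show ?case .
  qed
  have inY: "lift (k i) y \<in> fscale.span Y" if "i \<in> I" "y \<in> vecs Z" for i y
  proof -
    have "fscale.span (evaluation N ` J) \<subseteq> {t. lift (k i) t \<in> fscale.span Y}"
      using kY that(1) e
      by (intro fscale.span_minimal fscale.subspaceI)
         (auto simp: lift_add lift_fscale lift_zero fscale.span_zero
            intro: fscale.span_add fscale.span_scale)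
    with that show ?thesis by (auto simp: Z_def)
  qed
  have eM: "B (evaluation M i) y = lift (k i) y" if "y \<in> vecs Z" for i y
    using inM[OF that] by (auto simp: B_def fun_eq_iff lift_evaluation)
  show 2: "linear_on X (fspan Y) (\<lambda>x. B x y)" if "y \<in> vecs Z" for y
  proof -
    have "fscale.span (evaluation M ` I) \<subseteq> {t. B t y \<in> fscale.span Y}"
      using inY[OF _ that] eM[OF that]
      by (intro fscale.span_minimal fscale.subspaceI)
         (auto simp: B_def lift_add lift_fscale lift_zero fscale.span_zero
            intro: fscale.span_add fscale.span_scale)
    then show ?thesis
      by (auto simp: linear_on_def X_def B_def lift_add lift_fscale)
  qed
  show "linear_on Z (fspan Y) (B x)" if x: "x \<in> vecs X" for x
    unfolding linear_on_def
  proof (intro conjI ballI allI)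
    fix y assume "y \<in> vecs Z"
    then show "B x y \<in> vecs (fspan Y)" using 2 x by (auto simp: linear_on_def)
  next
    fix y y' assume y: "y \<in> vecs Z" "y' \<in> vecs Z"
    show "B x (y + y') = B x y + B x y'"
      using evaluation_span_linear(1)[OF x[unfolded X_def vecs_fspan] M inM[OF y(1)] inM[OF y(2)]]
      by (auto simp: B_def lift_def[of _ x] lift_add fun_eq_iff)
  next
    fix c y assume y: "y \<in> vecs Z"
    show "B x (scl Z c y) = scl (fspan Y) c (B x y)"
      using evaluation_span_linear(2)[OF x[unfolded X_def vecs_fspan] M inM[OF y] inM[OF y]]
      by (auto simp: B_def Z_def lift_def[of _ x] lift_fscale fun_eq_iff)
  qed
  show "B (evaluation M i) (evaluation N j) = k i j" if "i \<in> I" "j \<in> J" for i j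
    using eM[of "evaluation N j" i] e that by (simp add: Z_def fscale.span_base)
qed


section \<open>Hopf algebras\<close>

locale unital_algebra =
  fixes H :: "('k::field, 'h::ab_group_add) vspace"
    and mult :: "(('h \<times> 'h \<Rightarrow> 'k) \<Rightarrow> 'k) \<Rightarrow> 'h"
    and unit :: 'h
  assumes space: "vector_space_on H"
    and mult_linear: "linear_on (tensor_space H H) H mult"
    and unit_in: "unit \<in> vecs H"
    and mult_assoc: "\<lbrakk>x \<in> vecs H; y \<in> vecs H; z \<in> vecs H\<rbrakk> \<Longrightarrow>
          mult (tensor H H (mult (tensor H H x y)) z) = mult (tensor H H x (mult (tensor H H y z)))"
    and unit_left: "x \<in> vecs H \<Longrightarrow> mult (tensor H H unit x) = x"
    and unit_right: "x \<in> vecs H \<Longrightarrow> mult (tensor H H x unit) = x"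

text \<open>The counit axiom is stated in \<open>k \<otimes> H\<close> and \<open>H \<otimes> k\<close>, with \<open>x\<close> identified with
  \<open>1 \<otimes> x\<close> and \<open>x \<otimes> 1\<close>.\<close>

locale counital_coalgebra =
  fixes H :: "('k::field, 'h::ab_group_add) vspace"
    and comult :: "'h \<Rightarrow> ('h \<times> 'h \<Rightarrow> 'k) \<Rightarrow> 'k"
    and counit :: "'h \<Rightarrow> 'k"
  assumes space: "vector_space_on H"
    and comult_linear: "linear_on H (tensor_space H H) comult"
    and counit_linear: "linear_on H ground counit"
    and coassoc: "x \<in> vecs H \<Longrightarrow>
          tensor_assoc H H H (tensor_map (tensor_space H H) H comult id (comult x)) =
          tensor_map H (tensor_space H H) id comult (comult x)"
    and counit_left: "x \<in> vecs H \<Longrightarrow>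
          tensor_map ground H counit id (comult x) = tensor ground H 1 x"
    and counit_right: "x \<in> vecs H \<Longrightarrow>
          tensor_map H ground id counit (comult x) = tensor H ground x 1"

text \<open>The componentwise product \<open>(x \<otimes> y)(x' \<otimes> y') = xx' \<otimes> yy'\<close> on \<open>H \<otimes> H\<close>.\<close>

definition tensor_square_mult ::
  "('k::field, 'h::ab_group_add) vspace \<Rightarrow> ((('h \<times> 'h \<Rightarrow> 'k) \<Rightarrow> 'k) \<Rightarrow> 'h)
     \<Rightarrow> (('h \<times> 'h \<Rightarrow> 'k) \<Rightarrow> 'k) \<Rightarrow> (('h \<times> 'h \<Rightarrow> 'k) \<Rightarrow> 'k) \<Rightarrow> ('h \<times> 'h \<Rightarrow> 'k) \<Rightarrow> 'k" where
  "tensor_square_mult H m s t =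
     lift (\<lambda>(x, y). lift (\<lambda>(x', y'). tensor H H (m (tensor H H x x')) (m (tensor H H y y'))) t) s"

locale bialgebra = unital_algebra H mult unit + counital_coalgebra H comult counit
  for H :: "('k::field, 'h::ab_group_add) vspace"
    and mult unit comult counit +
  assumes comult_mult: "\<lbrakk>x \<in> vecs H; y \<in> vecs H\<rbrakk> \<Longrightarrow>
          comult (mult (tensor H H x y)) = tensor_square_mult H mult (comult x) (comult y)"
    and comult_unit: "comult unit = tensor H H unit unit"
    and counit_mult: "\<lbrakk>x \<in> vecs H; y \<in> vecs H\<rbrakk> \<Longrightarrow>
          counit (mult (tensor H H x y)) = counit x * counit y"
    and counit_unit: "counit unit = 1"

locale hopf_algebra = bialgebra H mult unit comult counit
  for H :: "('k::field, 'h::ab_group_add) vspace"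
    and mult unit comult counit +
  fixes antipode :: "'h \<Rightarrow> 'h"
  assumes antipode_linear: "linear_on H H antipode"
    and antipode_left: "x \<in> vecs H \<Longrightarrow>
          mult (tensor_map H H antipode id (comult x)) = scl H (counit x) unit"
    and antipode_right: "x \<in> vecs H \<Longrightarrow>
          mult (tensor_map H H id antipode (comult x)) = scl H (counit x) unit"

definition direct_sum_decomposition ::
  "('k::field, 'h::ab_group_add) vspace \<Rightarrow> (nat \<Rightarrow> 'h set) \<Rightarrow> bool" where
  "direct_sum_decomposition H G \<longleftrightarrow>
     (\<forall>n. module.subspace (scl H) (G n)) \<and>
     vecs H = module.span (scl H) (\<Union>n. G n) \<and>
     (\<forall>N f. (\<forall>n\<le>N. f n \<in> G n) \<and> (\<Sum>n\<le>N. f n) = 0 \<longrightarrow> (\<forall>n\<le>N. f n = 0))"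

locale connected_graded_hopf_algebra = hopf_algebra H mult unit comult counit antipode
  for H :: "('k::field, 'h::ab_group_add) vspace"
    and mult unit comult counit antipode +
  fixes G :: "nat \<Rightarrow> 'h set"
  assumes grading: "direct_sum_decomposition H G"
    and unit_degree: "unit \<in> G 0"
    and mult_degree: "\<lbrakk>x \<in> G p; y \<in> G q\<rbrakk> \<Longrightarrow> mult (tensor H H x y) \<in> G (p + q)"
    and comult_degree: "x \<in> G n \<Longrightarrow>
          comult x \<in> vecs (fspan {tensor H H y z | y z p q. p + q = n \<and> y \<in> G p \<and> z \<in> G q})"
    and counit_degree: "\<lbrakk>x \<in> G n; n \<noteq> 0\<rbrakk> \<Longrightarrow> counit x = 0"
    and antipode_degree: "x \<in> G n \<Longrightarrow> antipode x \<in> G n"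
    and connected: "G 0 = {scl H c unit | c. True}"

definition commutative_product ::
  "('k::field, 'h::ab_group_add) vspace \<Rightarrow> ((('h \<times> 'h \<Rightarrow> 'k) \<Rightarrow> 'k) \<Rightarrow> 'h) \<Rightarrow> bool" where
  "commutative_product H m \<longleftrightarrow>
     (\<forall>x\<in>vecs H. \<forall>y\<in>vecs H. m (tensor H H x y) = m (tensor H H y x))"

definition cocommutative_coproduct ::
  "('k::field, 'h::ab_group_add) vspace \<Rightarrow> ('h \<Rightarrow> ('h \<times> 'h \<Rightarrow> 'k) \<Rightarrow> 'k) \<Rightarrow> bool" where
  "cocommutative_coproduct H D \<longleftrightarrow> (\<forall>x\<in>vecs H. tensor_swap H H (D x) = D x)"


section \<open>The Hopf algebra of words of words\<close>

text \<open>The class \<open>ring_1\<close> contains \<open>0 \<noteq> 1\<close>.  For the zero algebra the tensor construction below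
  collapses to \<open>k\<close>, which is commutative and cocommutative.\<close>

locale associative_unital_algebra = vector_space scale
  for scale :: "'k::field \<Rightarrow> 'a::ring_1 \<Rightarrow> 'a" +
  assumes scale_mult_left: "scale c x * y = scale c (x * y)"
    and scale_mult_right: "x * scale c y = scale c (x * y)"

definition whole :: "('k \<Rightarrow> 'a \<Rightarrow> 'a) \<Rightarrow> ('k, 'a) vspace" where
  "whole scale = \<lparr>vecs = UNIV, scl = scale\<rparr>"

type_synonym ('k, 'a) words = "('a list \<Rightarrow> 'k) \<Rightarrow> 'k"
type_synonym ('k, 'a) bars = "(('k, 'a) words list \<Rightarrow> 'k) \<Rightarrow> 'k"
type_synonym ('k, 'a) bars2 = "(('k, 'a) bars \<times> ('k, 'a) bars \<Rightarrow> 'k) \<Rightarrow> 'k"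

context
  fixes scale :: "'k::field \<Rightarrow> 'a::ring_1 \<Rightarrow> 'a"
begin

definition TA :: "('k, ('k, 'a) words) vspace" where
  "TA = nonunital_tensor (whole scale)"

definition TTA :: "('k, ('k, 'a) bars) vspace" where
  "TTA = full_tensor TA"

definition word :: "'a list \<Rightarrow> ('k, 'a) words" where
  "word as = tens (whole scale) as"

definition bar :: "('k, 'a) words list \<Rightarrow> ('k, 'a) bars" where
  "bar ws = tens TA ws"

definition bar_mult :: "('k, 'a) bars2 \<Rightarrow> ('k, 'a) bars" where
  "bar_mult = concat_mult TA"

text \<open>The span of all \<open>w\<^sub>1|\<dots>|w\<^sub>r\<close> with \<open>w\<^sub>i\<close> homogeneous of degree \<open>n\<^sub>i > 0\<close> and
  \<open>n\<^sub>1 + \<dots> + n\<^sub>r = n\<close>.\<close>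

definition TTA_degree :: "nat \<Rightarrow> ('k, 'a) bars set" where
  "TTA_degree n = vecs (fspan {bar ws | ws ds.
     list_all2 (\<lambda>w d. 0 < d \<and> w \<in> vecs (tensor_power (whole scale) d)) ws ds \<and> sum_list ds = n})"

end

text \<open>Connected components are strictly increasing lists; since the components of \<open>S\<close> are
  disjoint runs, \<open>components U S\<close> lists them in increasing order.  The definite description is
  justified by \<open>components_properties\<close>.\<close>

definition gapless_in :: "nat set \<Rightarrow> nat set \<Rightarrow> nat list \<Rightarrow> bool" where
  "gapless_in U S is \<longleftrightarrow> is \<noteq> [] \<and> set is \<subseteq> S \<and> sorted_wrt (<) is \<and>
     successively (\<lambda>s t. \<not> (\<exists>u\<in>U. s < u \<and> u < t)) is"

definition connected_component_in :: "nat set \<Rightarrow> nat set \<Rightarrow> nat list \<Rightarrow> bool" where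
  "connected_component_in U S is \<longleftrightarrow> gapless_in U S is \<and>
     (\<forall>js. gapless_in U S js \<and> set is \<subseteq> set js \<longrightarrow> js = is)"

definition components :: "nat set \<Rightarrow> nat set \<Rightarrow> nat list list" where
  "components U S = (THE Js. set Js = Collect (connected_component_in U S) \<and>
     sorted_wrt (\<lambda>I J. \<forall>i\<in>set I. \<forall>j\<in>set J. i < j) Js)"

text \<open>Letters of a word are numbered from 1.\<close>

definition subword :: "'a list \<Rightarrow> nat list \<Rightarrow> 'a list" where
  "subword as is = map (\<lambda>i. as ! (i - 1)) is"

context
  fixes scale :: "'k::field \<Rightarrow> 'a::ring_1 \<Rightarrow> 'a"
begin

definition left_part :: "'a list \<Rightarrow> nat set \<Rightarrow> ('k, 'a) bars" where
  "left_part as S =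
     (if S = {} then bar scale []
      else bar scale [word scale (subword as (sorted_list_of_set S))])"

definition right_part :: "'a list \<Rightarrow> nat set \<Rightarrow> ('k, 'a) bars" where
  "right_part as S =
     bar scale (map (\<lambda>J. word scale (subword as J))
       (components {1..length as} ({1..length as} - S)))"

definition coproduct_on_words :: "('k, 'a) words \<Rightarrow> ('k, 'a) bars2" where
  "coproduct_on_words = lift (\<lambda>as. \<Sum>S\<in>Pow {1..length as}.
     tensor (TTA scale) (TTA scale) (left_part as S) (right_part as S))"

definition coproduct :: "('k, 'a) bars \<Rightarrow> ('k, 'a) bars2" where
  "coproduct = lift (\<lambda>ws.
     foldr (tensor_square_mult (TTA scale) (bar_mult scale)) (map coproduct_on_words ws)
       (tensor (TTA scale) (TTA scale) (bar scale []) (bar scale [])))"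

end

subsection \<open>The formulas determining product and coproduct\<close>

lemma vector_space_on_tensor_space: "vector_space_on (tensor_space V W)"
  and vector_space_on_full_tensor: "vector_space_on (full_tensor V)"
  and vector_space_on_nonunital_tensor: "vector_space_on (nonunital_tensor V)"
  by (simp_all add: tensor_space_def full_tensor_def nonunital_tensor_def vector_space_on_fspan)

lemma tens_in_full: "xs \<in> lists (vecs V) \<Longrightarrow> tens V xs \<in> vecs (full_tensor V)"
  by (auto simp: full_tensor_def intro!: fscale.span_base)

lemma linear_on_comp: "linear_on U V f \<Longrightarrow> linear_on V W g \<Longrightarrow> linear_on U W (\<lambda>x. g (f x))"
  by (simp add: linear_on_def)

lemma concat_mult_properties:
  assumes V: "vector_space_on V"
  shows "linear_on (tensor_space (full_tensor V) (full_tensor V)) (full_tensor V) (concat_mult V)"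
    and "\<lbrakk>xs \<in> lists (vecs V); ys \<in> lists (vecs V)\<rbrakk> \<Longrightarrow>
      concat_mult V (tensor (full_tensor V) (full_tensor V) (tens V xs) (tens V ys)) = tens V (xs @ ys)"
proof -
  let ?M = "multilinear_forms V" and ?I = "lists (vecs V)"
  let ?Y = "evaluation ?M ` ?I"
  have F: "form_space ?M ?I" by (rule form_space_multilinear[OF V])
  have mul: "linear_on V ground (\<lambda>v. tens V (xs @ v # ys) z)"
    if "xs \<in> ?I" "ys \<in> ?I" for xs ys z
    using tens_linear[OF that] unfolding full_tensor_eq by (rule linear_on_fspan_eval)
  have k1: "tens V (xs @ ys) \<in> vecs (fspan ?Y)" if "xs \<in> ?I" "ys \<in> ?I" for xs ys
    using tens_in_full[of "xs @ ys" V] that by (simp add: full_tensor_eq)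
  have k2: "(\<lambda>ys. tens V (xs @ ys) z) \<in> ?M" if xs: "xs \<in> ?I" for xs z
    unfolding multilinear_forms_def
  proof (intro CollectI ballI)
    fix us vs assume "us \<in> ?I" "vs \<in> ?I"
    then show "linear_on V ground (\<lambda>v. tens V (xs @ us @ v # vs) z)"
      using mul[of "xs @ us" vs z] xs by simp
  qed
  have k3: "(\<lambda>xs. tens V (xs @ ys) z) \<in> ?M" if ys: "ys \<in> ?I" for ys z
    unfolding multilinear_forms_def
  proof (intro CollectI ballI)
    fix us vs assume "us \<in> ?I" "vs \<in> ?I"
    then show "linear_on V ground (\<lambda>v. tens V ((us @ v # vs) @ ys) z)"
      using mul[of us "vs @ ys" z] ys by simp
  qed
  let ?k = "\<lambda>xs ys. tens V (xs @ ys)"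
  define m where "m = (\<lambda>x y. lift (\<lambda>xs. lift (?k xs) y) x)"
  have cm: "concat_mult V = lift (\<lambda>(x, y). m x y)"
    by (simp add: concat_mult_def m_def)
  have B1: "linear_on (full_tensor V) (fspan ?Y) (\<lambda>y. m x y)" if x: "x \<in> vecs (full_tensor V)" for x
    unfolding m_def full_tensor_eq
    by (rule bilinear_lift(1)[where k = ?k, OF F F])
      (assumption | rule k1 k2 k3 x[unfolded full_tensor_eq])+
  have B2: "linear_on (full_tensor V) (fspan ?Y) (\<lambda>x. m x y)" if y: "y \<in> vecs (full_tensor V)" for y
    unfolding m_def full_tensor_eq
    by (rule bilinear_lift(2)[where k = ?k, OF F F])
      (assumption | rule k1 k2 k3 y[unfolded full_tensor_eq])+
  have B3: "m (tens V xs) (tens V ys) = tens V (xs @ ys)" if "xs \<in> ?I" "ys \<in> ?I" for xs ys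
    unfolding m_def tens_def[of V xs] tens_def[of V ys]
    by (rule bilinear_lift(3)[where k = ?k, OF F F])
      (assumption | rule k1 k2 k3 that)+
  show "linear_on (tensor_space (full_tensor V) (full_tensor V)) (full_tensor V) (concat_mult V)"
    using tensor_lift(1)[OF B1 B2] unfolding cm full_tensor_eq[symmetric] .
  show "concat_mult V (tensor (full_tensor V) (full_tensor V) (tens V xs) (tens V ys)) = tens V (xs @ ys)"
    if "xs \<in> ?I" "ys \<in> ?I"
  proof -
    have "lift (\<lambda>(x, y). m x y) (tensor (full_tensor V) (full_tensor V) (tens V xs) (tens V ys)) =
        m (tens V xs) (tens V ys)"
      by (rule tensor_lift(2)[OF B1 B2])
    then show ?thesis unfolding cm using B3[OF that] by (rule trans)
  qed
qed

lemma tensor_square_mult_properties: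
  assumes H: "vector_space_on H" and m: "linear_on (tensor_space H H) H m"
  shows "s \<in> vecs (tensor_space H H) \<Longrightarrow>
      linear_on (tensor_space H H) (tensor_space H H) (tensor_square_mult H m s)"
    and "t \<in> vecs (tensor_space H H) \<Longrightarrow>
      linear_on (tensor_space H H) (tensor_space H H) (\<lambda>s. tensor_square_mult H m s t)"
    and "\<lbrakk>x \<in> vecs H; y \<in> vecs H; x' \<in> vecs H; y' \<in> vecs H\<rbrakk> \<Longrightarrow>
      tensor_square_mult H m (tensor H H x y) (tensor H H x' y') =
      tensor H H (m (tensor H H x x')) (m (tensor H H y y'))"
proof -
  let ?M = "bilinear_forms H H" and ?I = "vecs H \<times> vecs H"
  let ?Y = "evaluation ?M ` ?I"
  define k where "k = (\<lambda>(x, y) (x', y'). tensor H H (m (tensor H H x x')) (m (tensor H H y y')))"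
  have tsm: "tensor_square_mult H m s t = lift (\<lambda>i. lift (k i) t) s" for s t
    unfolding tensor_square_mult_def k_def by (rule arg_cong2[where f = lift]) auto
  have F: "form_space ?M ?I" by (rule form_space_bilinear[OF H H])
  have mr: "linear_on H H (\<lambda>x'. m (tensor H H x x'))" if "x \<in> vecs H" for x
    by (rule linear_on_comp[OF tensor_linear(1)[OF that] m])
  have ml: "linear_on H H (\<lambda>x. m (tensor H H x x'))" if "x' \<in> vecs H" for x'
    by (rule linear_on_comp[OF tensor_linear(2)[OF that] m])
  have min: "m (tensor H H x x') \<in> vecs H" if "x \<in> vecs H" "x' \<in> vecs H" for x x'
    using mr[OF that(1)] that(2) by (simp add: linear_on_def)
  have k1: "k i j \<in> vecs (fspan ?Y)" if "i \<in> ?I" "j \<in> ?I" for i j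
  proof -
    have "k i j \<in> ?Y"
      using that min by (auto simp: k_def tensor_def)
    then show ?thesis by (simp add: fscale.span_base)
  qed
  have g: "linear_on H ground (\<lambda>v. tensor H H (p v) w z)"
    if "linear_on H H p" "w \<in> vecs H" for p w z
    using linear_on_fspan_eval[of H _ "\<lambda>v. tensor H H (p v) w" z]
      linear_on_comp[OF that(1) tensor_linear(2)[OF that(2), of H]]
    unfolding tensor_space_eq by blast
  have g': "linear_on H ground (\<lambda>v. tensor H H w (p v) z)"
    if "linear_on H H p" "w \<in> vecs H" for p w z
    using linear_on_fspan_eval[of H _ "\<lambda>v. tensor H H w (p v)" z]
      linear_on_comp[OF that(1) tensor_linear(1)[OF that(2), of H]]
    unfolding tensor_space_eq by blast
  have k2: "(\<lambda>j. k i j z) \<in> ?M" if "i \<in> ?I" for i z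
    using that mr min unfolding bilinear_forms_def k_def
    by (auto intro!: g g' mr min)
  have k3: "(\<lambda>i. k i j z) \<in> ?M" if "j \<in> ?I" for j z
    using that unfolding bilinear_forms_def k_def
    by (auto intro!: g g' ml min)
  note rules = k1 k2 k3
  show "linear_on (tensor_space H H) (tensor_space H H) (tensor_square_mult H m s)"
    if s: "s \<in> vecs (tensor_space H H)"
    unfolding tsm tensor_space_eq
    by (rule bilinear_lift(1)[where k = k, OF F F])
      (assumption | rule rules s[unfolded tensor_space_eq])+
  show "linear_on (tensor_space H H) (tensor_space H H) (\<lambda>s. tensor_square_mult H m s t)"
    if t: "t \<in> vecs (tensor_space H H)"
    unfolding tsm tensor_space_eq
    by (rule bilinear_lift(2)[where k = k, OF F F])
      (assumption | rule rules t[unfolded tensor_space_eq])+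
  show "tensor_square_mult H m (tensor H H x y) (tensor H H x' y') =
      tensor H H (m (tensor H H x x')) (m (tensor H H y y'))"
    if "x \<in> vecs H" "y \<in> vecs H" "x' \<in> vecs H" "y' \<in> vecs H"
  proof -
    have "lift (\<lambda>i. lift (k i) (evaluation ?M (x', y'))) (evaluation ?M (x, y)) = k (x, y) (x', y')"
      by (rule bilinear_lift(3)[where k = k, OF F F])
        (assumption | rule rules SigmaI that)+
    then show ?thesis unfolding tsm tensor_def[of H H x y] tensor_def[of H H x' y'] by (simp add: k_def)
  qed
qed

lemma gapless_in_iff:
  "gapless_in U S is \<longleftrightarrow> is \<noteq> [] \<and> set is \<subseteq> S \<and> sorted_wrt (<) is \<and>
     (\<forall>s\<in>set is. \<forall>t\<in>set is. \<forall>u\<in>U. s < u \<and> u < t \<longrightarrow> u \<in> set is)"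
proof -
  have "successively (\<lambda>s t. \<not> (\<exists>u\<in>U. s < u \<and> u < t)) is \<longleftrightarrow>
     (\<forall>s\<in>set is. \<forall>t\<in>set is. \<forall>u\<in>U. s < u \<and> u < t \<longrightarrow> u \<in> set is)"
    if "sorted_wrt (<) is"
    using that
  proof (induction "is" rule: induct_list012)
    case (3 x y zs)
    let ?conv = "\<lambda>is. \<forall>s\<in>set is. \<forall>t\<in>set is. \<forall>u\<in>U. s < u \<and> u < t \<longrightarrow> u \<in> set is"
    have sorted: "sorted_wrt (<) (y # zs)" "\<forall>z\<in>set (y # zs). x < z" "\<forall>z\<in>set zs. y < z"
      using 3(3) by auto
    note IH = 3(2)[OF sorted(1)]
    have "?conv (x # y # zs) \<longleftrightarrow> \<not> (\<exists>u\<in>U. x < u \<and> u < y) \<and> ?conv (y # zs)" (is "?l \<longleftrightarrow> ?r")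
    proof
      assume l: ?l
      have "\<not> (x < u \<and> u < y)" if "u \<in> U" for u
      proof
        assume u: "x < u \<and> u < y"
        then have "u \<in> set (x # y # zs)" using l that by simp
        then show False using u sorted(3) by auto
      qed
      moreover have "u \<in> set (y # zs)"
        if "s \<in> set (y # zs)" "t \<in> set (y # zs)" "u \<in> U" "s < u" "u < t" for s t u
      proof -
        have "u \<in> set (x # y # zs)" 
          using l[THEN bspec, THEN bspec, THEN bspec, of s t u] that by simp
        moreover have "x < u" using bspec[OF sorted(2) that(1)] that(4) by simp
        ultimately show ?thesis by auto
      qed
      ultimately show ?r by blast
    next
      assume r: ?r
      have "u \<in> set (x # y # zs)"
        if st: "s \<in> set (x # y # zs)" "t \<in> set (x # y # zs)" "u \<in> U" "s < u" "u < t" for s t u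
      proof -
        have "x \<le> s" using st(1) sorted(2) by (auto intro: less_imp_le)
        then have xu: "x < u" "t \<noteq> x" using st by auto
        then have t: "t \<in> set (y # zs)" using st(2) by auto
        show ?thesis
        proof (cases "u \<le> y")
          case True
          then show ?thesis using conjunct1[OF r] st(3) xu(1) by (cases "u = y") auto
        next
          case False
          then have "u \<in> set (y # zs)"
            using conjunct2[OF r, THEN bspec, THEN bspec, THEN bspec, of y t u] t st(3,5) by simp
          then show ?thesis by simp
        qed
      qed
      then show ?l by blast
    qed
    then show ?case using IH by (simp only: successively.simps)
  qed simp_all
  note key = this
  show ?thesis
  proof (cases "sorted_wrt (<) is")
    case True
    show ?thesis unfolding gapless_in_def key[OF True] ..
  next
    case False
    then show ?thesis unfolding gapless_in_def by simp
  qed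
qed

definition run_of :: "nat set \<Rightarrow> nat set \<Rightarrow> nat \<Rightarrow> nat set" where
  "run_of U S s = {t\<in>S. \<forall>u\<in>U. s \<le> u \<and> u \<le> t \<or> t \<le> u \<and> u \<le> s \<longrightarrow> u \<in> S}"

lemma components_properties:
  assumes U: "finite U" and SU: "S \<subseteq> U"
  shows "set (components U S) = Collect (connected_component_in U S)"
    and "sorted_wrt (\<lambda>I J. \<forall>i\<in>set I. \<forall>j\<in>set J. i < j) (components U S)"
    and "\<Union> (set ` set (components U S)) = S"
proof -
  let ?R = "\<lambda>I J. \<forall>i\<in>set I. \<forall>j\<in>set J. (i::nat) < j"
  let ?C = "run_of U S" and ?g = "\<lambda>s. sorted_list_of_set (run_of U S s)"
  have S: "finite S" using U SU by (rule finite_subset[rotated])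
  have fin: "finite (?C s)" for s using S by (simp add: run_of_def)
  have self: "s \<in> ?C s" if "s \<in> S" for s
    using that by (auto simp: run_of_def dest: le_antisym)
  have run_eq: "?C t = ?C s" if "t \<in> ?C s" "s \<in> S" for s t
  proof -
    have *: "?C b \<subseteq> ?C a" if "b \<in> ?C a" for a b
    proof
      fix r assume r: "r \<in> ?C b"
      have "u \<in> S" if "u \<in> U" "a \<le> u \<and> u \<le> r \<or> r \<le> u \<and> u \<le> a" for u
      proof -
        have "a \<le> u \<and> u \<le> b \<or> b \<le> u \<and> u \<le> a \<or> b \<le> u \<and> u \<le> r \<or> r \<le> u \<and> u \<le> b"
          using that(2) by linarith
        then show ?thesis
          using r \<open>b \<in> ?C a\<close> \<open>u \<in> U\<close> unfolding run_of_def by blast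
      qed
      then show "r \<in> ?C a" using r by (auto simp: run_of_def)
    qed
    have "s \<in> ?C t" using that by (auto simp: run_of_def)
    then show ?thesis using *[of t s] *[of s t] that by blast
  qed
  have sep: "i < j" if "s \<in> S" "t \<in> S" "s < t" "t \<notin> ?C s" "i \<in> ?C s" "j \<in> ?C t" for s t i j
  proof -
    have "\<exists>u\<in>U. (s \<le> u \<and> u \<le> t \<or> t \<le> u \<and> u \<le> s) \<and> u \<notin> S"
      using that(2,4) by (auto simp: run_of_def)
    then obtain u where u: "u \<in> U" "s \<le> u" "u \<le> t" "u \<notin> S"
      using \<open>s < t\<close> by auto
    have "i < u" "u < j"
      using u that(5,6) unfolding run_of_def by (auto simp: not_le[symmetric])
    then show ?thesis by simp
  qed
  have gap_sub: "set is \<subseteq> ?C s" if g: "gapless_in U S is" and s: "s \<in> set is" for "is" s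
  proof
    fix t assume t: "t \<in> set is"
    have sub: "set is \<subseteq> S" using g by (simp add: gapless_in_def)
    have conv: "c \<in> set is" if "a \<in> set is" "b \<in> set is" "c \<in> U" "a < c" "c < b" for a b c
      using g[unfolded gapless_in_iff, THEN conjunct2, THEN conjunct2, THEN conjunct2,
          THEN bspec, THEN bspec, THEN bspec, OF that(1-3)] that(4,5) by simp
    have "u \<in> S" if u: "u \<in> U" "s \<le> u \<and> u \<le> t \<or> t \<le> u \<and> u \<le> s" for u
    proof -
      have "u = s \<or> u = t \<or> s < u \<and> u < t \<or> t < u \<and> u < s" using u(2) by linarith
      then have "u \<in> set is" using conv[OF s t u(1)] conv[OF t s u(1)] s t by blast
      then show ?thesis using sub by (rule rev_subsetD)
    qed
    moreover have "t \<in> S" using sub t by (rule subsetD)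
    ultimately show "t \<in> ?C s" by (simp add: run_of_def)
  qed
  have gap_run: "gapless_in U S (?g s)" if s: "s \<in> S" for s
  proof -
    have conv: "u \<in> ?C s" if ab: "a \<in> ?C s" "b \<in> ?C s" "u \<in> U" "a < u" "u < b" for a b u
    proof -
      have C: "v \<in> S" if "x \<in> ?C s" "v \<in> U" "s \<le> v \<and> v \<le> x \<or> x \<le> v \<and> v \<le> s" for v x
      proof -
        have "\<forall>u\<in>U. s \<le> u \<and> u \<le> x \<or> x \<le> u \<and> u \<le> s \<longrightarrow> u \<in> S"
          using that(1) by (simp add: run_of_def)
        then show ?thesis using that(2,3) by blast
      qed
      have "v \<in> S" if v: "v \<in> U" "s \<le> v \<and> v \<le> u \<or> u \<le> v \<and> v \<le> s" for v
      proof -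
        have "v = s \<or> s \<le> v \<and> v \<le> b \<or> a \<le> v \<and> v \<le> s" using v(2) ab(4,5) by linarith
        then show ?thesis using C[OF ab(1) v(1)] C[OF ab(2) v(1)] s by blast
      qed
      moreover have "u \<in> S"
        using calculation[OF ab(3)] by linarith
      ultimately show ?thesis by (simp add: run_of_def)
    qed
    have "?C s \<subseteq> S" by (auto simp: run_of_def)
    moreover have "?g s \<noteq> []" using self[OF s] fin[of s] by auto
    moreover have "sorted_wrt (<) (?g s)" by (rule strict_sorted_list_of_set)
    ultimately show ?thesis
      unfolding gapless_in_iff set_sorted_list_of_set[OF fin]
      using conv by (intro conjI ballI impI) (assumption | (elim conjE, assumption))+
  qed
  have comp_iff: "connected_component_in U S is \<longleftrightarrow> (\<exists>s\<in>S. is = ?g s)" for "is"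
  proof
    assume c: "connected_component_in U S is"
    then have g: "gapless_in U S is"
      and max: "\<forall>js. gapless_in U S js \<and> set is \<subseteq> set js \<longrightarrow> js = is"
      unfolding connected_component_in_def by blast+
    have s: "hd is \<in> set is" using g by (simp add: gapless_in_def)
    moreover have "set is \<subseteq> S" using g by (simp add: gapless_in_def)
    ultimately have sS: "hd is \<in> S" by blast
    have "set is \<subseteq> set (?g (hd is))"
      using gap_sub[OF g s] unfolding set_sorted_list_of_set[OF fin] .
    then have "?g (hd is) = is" using max gap_run[OF sS] by blast
    then show "\<exists>s\<in>S. is = ?g s" by (intro bexI[OF _ sS]) (rule sym)
  next
    assume "\<exists>s\<in>S. is = ?g s"
    then obtain s where s: "s \<in> S" "is = ?g s" by blast
    have "js = ?g s" if js: "gapless_in U S js" "set (?g s) \<subseteq> set js" for js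
    proof -
      have sub: "?C s \<subseteq> set js" using js(2) unfolding set_sorted_list_of_set[OF fin] .
      then have "s \<in> set js" using self[OF s(1)] by blast
      then have "set js \<subseteq> ?C s" by (rule gap_sub[OF js(1)])
      with sub have eq: "set js = set (?g s)" unfolding set_sorted_list_of_set[OF fin] by blast
      show ?thesis
      proof (rule strict_sorted_equal)
        show "sorted_wrt (<) js" using js(1) by (simp add: gapless_in_def)
        show "sorted_wrt (<) (?g s)" by (rule strict_sorted_list_of_set)
      qed (rule eq)
    qed
    then show "connected_component_in U S is"
      unfolding connected_component_in_def s(2) using gap_run[OF s(1)] by blast
  qed
  have coll: "Collect (connected_component_in U S) = ?g ` S"
    unfolding image_def using comp_iff by (intro Collect_cong) simp
  let ?P = "\<lambda>Js. set Js = Collect (connected_component_in U S) \<and> sorted_wrt ?R Js"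
  let ?m = "{s\<in>S. \<forall>t\<in>?C s. s \<le> t}"
  define Js where "Js = map ?g (sorted_list_of_set ?m)"
  have "finite ?m" by (rule finite_subset[OF _ S]) blast
  then have set_m: "set (sorted_list_of_set ?m) = ?m" by (rule set_sorted_list_of_set)
  have set_Js: "set Js = ?g ` ?m" unfolding Js_def set_map set_m ..
  have ex: "?P Js"
  proof
    have "?g s \<in> set Js" if s: "s \<in> S" for s
    proof -
      let ?n = "Min (?C s)"
      have "?C s \<noteq> {}" using self[OF s] by blast
      then have n: "?n \<in> ?C s" by (rule Min_in[OF fin])
      have eq: "?C ?n = ?C s" by (rule run_eq[OF n s])
      have "?C s \<subseteq> S" unfolding run_of_def by blast
      then have "?n \<in> S" using n by (rule subsetD)
      moreover have "\<forall>t\<in>?C ?n. ?n \<le> t" unfolding eq using Min_le[OF fin] by blast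
      ultimately have "?n \<in> ?m" by blast
      then have "?g ?n \<in> set Js" unfolding set_Js by (rule imageI)
      then show ?thesis unfolding eq .
    qed
    then have "?g ` S \<subseteq> set Js" by (rule image_subsetI)
    moreover have "set Js \<subseteq> ?g ` S" unfolding set_Js by (rule image_mono) blast
    ultimately have "set Js = ?g ` S" by (rule equalityI[rotated])
    then show "set Js = Collect (connected_component_in U S)" unfolding coll .
    have lt: "?R (?g s) (?g t)" if st: "s \<in> ?m" "t \<in> ?m" "s < t" for s t
    proof -
      have sS: "s \<in> S" and tS: "t \<in> S" using st by blast+
      have "t \<notin> ?C s"
      proof
        assume "t \<in> ?C s"
        then have "s \<in> ?C t" using run_eq[OF _ sS] self[OF sS] by blast
        then have "t \<le> s" using st(2) by blast
        then show False using st(3) by simp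
      qed
      then show ?thesis
        unfolding set_sorted_list_of_set[OF fin] by (intro ballI sep[OF sS tS st(3)])
    qed
    show "sorted_wrt ?R Js"
      unfolding Js_def sorted_wrt_map
      by (rule sorted_wrt_mono_rel[OF _ strict_sorted_list_of_set]) (rule lt, simp_all only: set_m)
  qed
  have Ks: "map ?g (map hd Ks) = Ks \<and> sorted_wrt (<) (map hd Ks)" if K: "?P Ks" for Ks
  proof
    have comp: "K \<noteq> [] \<and> ?g (hd K) = K" if "K \<in> set Ks" for K
    proof -
      have "connected_component_in U S K" using that K by blast
      then obtain s where s: "s \<in> S" "K = ?g s" using comp_iff by blast
      have ne: "K \<noteq> []" using gap_run[OF s(1)] s(2) by (simp add: gapless_in_def)
      then have "hd K \<in> set K" by (rule hd_in_set)
      then have "hd K \<in> ?C s" unfolding s(2) set_sorted_list_of_set[OF fin] .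
      then have "?C (hd K) = ?C s" using s(1) by (rule run_eq)
      then show ?thesis using ne s(2) by simp
    qed
    show "map ?g (map hd Ks) = Ks"
      unfolding map_map by (rule map_idI) (simp add: comp)
    have "hd x < hd y" if "x \<in> set Ks" "y \<in> set Ks" "?R x y" for x y
    proof -
      have "hd x \<in> set x" "hd y \<in> set y"
        using comp[OF that(1)] comp[OF that(2)] by simp_all
      then show ?thesis using that(3) by blast
    qed
    then show "sorted_wrt (<) (map hd Ks)"
      unfolding sorted_wrt_map by (rule sorted_wrt_mono_rel[OF _ conjunct2[OF K]])
  qed
  have uniq: "Ks = Js'" if K: "?P Ks" and J: "?P Js'" for Ks Js'
  proof -
    have "set (map hd Ks) = set (map hd Js')" using K J by simp
    then have "map hd Ks = map hd Js'"
      by (rule strict_sorted_equal[OF conjunct2[OF Ks[OF J]] conjunct2[OF Ks[OF K]]])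
    then have "map ?g (map hd Ks) = map ?g (map hd Js')" by (rule arg_cong)
    then show ?thesis unfolding conjunct1[OF Ks[OF K]] conjunct1[OF Ks[OF J]] .
  qed
  have P: "?P (components U S)"
    unfolding components_def by (rule theI[of ?P, OF ex uniq[OF _ ex]])
  then show "set (components U S) = Collect (connected_component_in U S)"
    and "sorted_wrt ?R (components U S)" by blast+
  have "\<Union> (set ` set (components U S)) = (\<Union>s\<in>S. ?C s)"
    unfolding conjunct1[OF P] coll by (simp only: set_sorted_list_of_set[OF fin] image_image)
  also have "\<dots> = S"
  proof
    show "(\<Union>s\<in>S. ?C s) \<subseteq> S" by (auto simp: run_of_def)
    show "S \<subseteq> (\<Union>s\<in>S. ?C s)" using self by blast
  qed
  finally show "\<Union> (set ` set (components U S)) = S" .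
qed

lemma linear_on_in: "linear_on V W f \<Longrightarrow> v \<in> vecs V \<Longrightarrow> f v \<in> vecs W"
  by (simp add: linear_on_def)

lemma linear_on_sum:
  assumes W: "vector_space_on W" and f: "\<And>i. i \<in> I \<Longrightarrow> linear_on V W (f i)"
  shows "linear_on V W (\<lambda>v. \<Sum>i\<in>I. f i v)"
proof -
  interpret W: vector_space "scl W" using W by (simp add: vector_space_on_def)
  have sub: "W.subspace (vecs W)" using W by (simp add: vector_space_on_def)
  show ?thesis
    unfolding linear_on_def
  proof (intro conjI ballI allI)
    fix x assume "x \<in> vecs V"
    then show "(\<Sum>i\<in>I. f i x) \<in> vecs W"
      by (intro W.subspace_sum[OF sub] linear_on_in[OF f])
  next
    fix x y assume "x \<in> vecs V" "y \<in> vecs V"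
    then have "(\<Sum>i\<in>I. f i (x + y)) = (\<Sum>i\<in>I. f i x + f i y)"
      using f by (intro sum.cong refl) (simp add: linear_on_def)
    then show "(\<Sum>i\<in>I. f i (x + y)) = (\<Sum>i\<in>I. f i x) + (\<Sum>i\<in>I. f i y)"
      by (simp only: sum.distrib)
  next
    fix c x assume "x \<in> vecs V"
    then have "(\<Sum>i\<in>I. f i (scl V c x)) = (\<Sum>i\<in>I. scl W c (f i x))"
      using f by (intro sum.cong refl) (simp add: linear_on_def)
    then show "(\<Sum>i\<in>I. f i (scl V c x)) = scl W c (\<Sum>i\<in>I. f i x)"
      by (simp only: W.scale_sum_right)
  qed
qed

lemma nonunital_tens_linear:
  assumes "xs \<in> lists (vecs V)" "ys \<in> lists (vecs V)"
  shows "linear_on V (nonunital_tensor V) (\<lambda>v. tens V (xs @ v # ys))"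
proof -
  have "tens V (xs @ v # ys) \<in> vecs (nonunital_tensor V)" if "v \<in> vecs V" for v
    unfolding nonunital_tensor_def vecs_fspan
    by (rule fscale.span_base, rule CollectI, rule exI[of _ "xs @ v # ys"]) (use that assms in simp)
  with tens_linear[OF assms] show ?thesis
    by (simp add: linear_on_def nonunital_tensor_def full_tensor_def)
qed

lemma linear_on_nonunital: "linear_on (full_tensor V) W f \<Longrightarrow> linear_on (nonunital_tensor V) W f"
proof -
  have "vecs (nonunital_tensor V) \<subseteq> vecs (full_tensor V)"
    unfolding nonunital_tensor_def full_tensor_def vecs_fspan by (rule fscale.span_mono) blast
  moreover have "scl (nonunital_tensor V) = scl (full_tensor V)"
    by (simp add: nonunital_tensor_def full_tensor_def)
  ultimately show "linear_on (full_tensor V) W f \<Longrightarrow> linear_on (nonunital_tensor V) W f"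
    unfolding linear_on_def by (simp add: subset_iff)
qed

lemma concat_mult_unit_right:
  assumes V: "vector_space_on V" and x: "x \<in> vecs (full_tensor V)"
  shows "concat_mult V (tensor (full_tensor V) (full_tensor V) x (tens V [])) = x"
proof -
  let ?H = "full_tensor V"
  have e: "tens V [] \<in> vecs ?H" by (rule tens_in_full) simp
  show ?thesis
  proof (rule linear_on_fspan_unique[where g = "\<lambda>x. x" and x = x])
    show "linear_on (fspan {tens V xs |xs. xs \<in> lists (vecs V)}) ?H
        (\<lambda>x. concat_mult V (tensor ?H ?H x (tens V [])))"
      using linear_on_comp[OF tensor_linear(2)[OF e] concat_mult_properties(1)[OF V]]
      by (simp only: full_tensor_def)
    show "linear_on (fspan {tens V xs |xs. xs \<in> lists (vecs V)}) ?H (\<lambda>x. x)"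
      by (simp add: linear_on_def full_tensor_def)
    show "x \<in> vecs (fspan {tens V xs |xs. xs \<in> lists (vecs V)})"
      using x by (simp only: full_tensor_def)
    fix y assume "y \<in> {tens V xs |xs. xs \<in> lists (vecs V)}"
    then obtain xs where "y = tens V xs" "xs \<in> lists (vecs V)" by blast
    then show "concat_mult V (tensor ?H ?H y (tens V [])) = y"
      using concat_mult_properties(2)[OF V, of xs "[]"] by simp
  qed (rule vector_space_on_full_tensor)
qed

context
  fixes scale :: "'k::field \<Rightarrow> 'a::ring_1 \<Rightarrow> 'a"
begin

private abbreviation (input) H where "H \<equiv> TTA scale"
private abbreviation (input) HH where "HH \<equiv> tensor_space H H"
private abbreviation (input) times_HH where "times_HH \<equiv> tensor_square_mult H (bar_mult scale)"

lemma vecs_whole [simp]: "vecs (whole scale) = UNIV"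
  by (simp add: whole_def)

lemma vector_space_on_TA: "vector_space_on (TA scale)"
  and vector_space_on_TTA: "vector_space_on H"
  by (simp_all add: TA_def TTA_def vector_space_on_nonunital_tensor vector_space_on_full_tensor)

lemma word_linear: "linear_on (whole scale) (TA scale) (\<lambda>v. word scale (xs @ v # ys))"
  unfolding TA_def word_def by (rule nonunital_tens_linear) simp_all

lemma word_in: "as \<noteq> [] \<Longrightarrow> word scale as \<in> vecs (TA scale)"
  using linear_on_in[OF word_linear[of "[]" "tl as"], of "hd as"] by simp

lemma bar_in: "ws \<in> lists (vecs (TA scale)) \<Longrightarrow> bar scale ws \<in> vecs H"
  unfolding TTA_def bar_def by (rule tens_in_full)

lemma bar_linear:
  "xs \<in> lists (vecs (TA scale)) \<Longrightarrow> ys \<in> lists (vecs (TA scale)) \<Longrightarrow>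
     linear_on (TA scale) H (\<lambda>w. bar scale (xs @ w # ys))"
  unfolding TTA_def bar_def by (rule tens_linear)

lemma bar_mult_linear: "linear_on HH H (bar_mult scale)"
  unfolding TTA_def bar_mult_def by (rule concat_mult_properties(1)[OF vector_space_on_TA])

theorem bar_mult_bar:
  "ws \<in> lists (vecs (TA scale)) \<Longrightarrow> ws' \<in> lists (vecs (TA scale)) \<Longrightarrow>
     bar_mult scale (tensor H H (bar scale ws) (bar scale ws')) = bar scale (ws @ ws')"
  unfolding TTA_def bar_mult_def bar_def
  by (rule concat_mult_properties(2)[OF vector_space_on_TA])

lemma subword_const:
  assumes "Suc (length xs) \<notin> set is" "0 \<notin> set is"
  shows "subword (xs @ v # ys) is = subword (xs @ w # ys) is"
  unfolding subword_def
proof (rule map_cong[OF refl])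
  fix i assume "i \<in> set is"
  then have "i \<noteq> Suc (length xs)" "i \<noteq> 0" using assms by metis+
  then have "i - 1 \<noteq> length xs" by simp
  moreover have "(xs @ v # ys) ! j = (xs @ w # ys) ! j" if "j \<noteq> length xs" for j
    using that by (auto simp: nth_append nth_Cons')
  ultimately show "(xs @ v # ys) ! (i - 1) = (xs @ w # ys) ! (i - 1)" by blast
qed

lemma subword_split:
  assumes "Suc (length xs) \<notin> set is" "Suc (length xs) \<notin> set js" "0 \<notin> set is" "0 \<notin> set js"
  shows "subword (xs @ v # ys) (is @ Suc (length xs) # js) =
     subword (xs @ w # ys) is @ v # subword (xs @ w # ys) js"
proof -
  have "subword (xs @ v # ys) (is @ Suc (length xs) # js) =
      subword (xs @ v # ys) is @ v # subword (xs @ v # ys) js"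
    by (simp add: subword_def)
  then show ?thesis
    unfolding subword_const[OF assms(1,3), of v ys w] subword_const[OF assms(2,4), of v ys w] .
qed

lemma left_part_in:
  assumes "finite S"
  shows "left_part scale as S \<in> vecs H"
proof (cases "S = {}")
  case False
  then have "subword as (sorted_list_of_set S) \<noteq> []" using assms by (simp add: subword_def)
  then show ?thesis using False by (simp add: left_part_def bar_in word_in)
qed (simp add: left_part_def bar_in)

lemma right_words_in:
  assumes "Js' \<subseteq> set (components {1..n} ({1..n} - S))" "set Js \<subseteq> Js'"
  shows "map (\<lambda>J. word scale (subword as J)) Js \<in> lists (vecs (TA scale))"
proof -
  have "word scale (subword as J) \<in> vecs (TA scale)" if "J \<in> set Js" for J
  proof (rule word_in)
    have "J \<in> set (components {1..n} ({1..n} - S))" using that assms by blast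
    then have "J \<noteq> []"
      unfolding components_properties(1)[OF finite_atLeastAtMost Diff_subset]
      by (simp add: connected_component_in_def gapless_in_def)
    then show "subword as J \<noteq> []" by (simp add: subword_def)
  qed
  then show ?thesis by auto
qed

lemma right_part_in: "right_part scale as S \<in> vecs H"
  unfolding right_part_def by (rule bar_in, rule right_words_in[OF subset_refl subset_refl])

lemma left_part_linear:
  assumes S: "finite S" "0 \<notin> S" "Suc (length xs) \<in> S"
  shows "linear_on (whole scale) H (\<lambda>v. left_part scale (xs @ v # ys) S)"
proof -
  let ?p = "Suc (length xs)"
  have "?p \<in> set (sorted_list_of_set S)" using S by simp
  then obtain s1 s2 where s: "sorted_list_of_set S = s1 @ ?p # s2" by (meson split_list)
  have "distinct (s1 @ ?p # s2)" unfolding s[symmetric] by (rule distinct_sorted_list_of_set)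
  then have n: "?p \<notin> set s1" "?p \<notin> set s2" by simp_all
  have "0 \<notin> set (s1 @ ?p # s2)" unfolding s[symmetric] using S by simp
  then have z: "0 \<notin> set s1" "0 \<notin> set s2" by simp_all
  have S_ne: "S \<noteq> {}" using S(3) by blast
  have eq: "left_part scale (xs @ v # ys) S =
      bar scale ([] @ word scale (subword (xs @ 0 # ys) s1 @ v # subword (xs @ 0 # ys) s2) # [])" for v
    using S_ne by (simp add: left_part_def s subword_split[OF n z, of v ys 0])
  show ?thesis
    unfolding eq by (rule linear_on_comp[OF word_linear bar_linear]) simp_all
qed

lemma right_part_linear:
  assumes "Suc (length xs) \<in> {1..length xs + Suc (length ys)} - S"
  shows "linear_on (whole scale) H (\<lambda>v. right_part scale (xs @ v # ys) S)"
proof -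
  let ?p = "Suc (length xs)" and ?n = "length xs + Suc (length ys)"
  let ?C = "components {1..?n} ({1..?n} - S)"
  note C = components_properties[OF finite_atLeastAtMost Diff_subset, of 1 ?n S]
  have "?p \<in> \<Union> (set ` set ?C)" unfolding C(3) using assms .
  then obtain J where J: "J \<in> set ?C" "?p \<in> set J" by blast
  obtain C1 C2 where Cs: "?C = C1 @ J # C2" using split_list[OF J(1)] by blast
  obtain j1 j2 where js: "J = j1 @ ?p # j2" using split_list[OF J(2)] by blast
  have gap: "sorted_wrt (<) K" if "K \<in> set ?C" for K
    using that unfolding C(1) by (simp add: connected_component_in_def gapless_in_def)
  have zero: "0 \<notin> set K" if "K \<in> set ?C" for K
  proof -
    have "set K \<subseteq> \<Union> (set ` set ?C)" using that by blast
    then show ?thesis unfolding C(3) by auto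
  qed
  have n: "?p \<notin> set j1" "?p \<notin> set j2" using gap[OF J(1)] unfolding js by (auto simp: sorted_wrt_append)
  have z: "0 \<notin> set j1" "0 \<notin> set j2" using zero[OF J(1)] unfolding js by simp_all
  have other: "?p \<notin> set K" if "K \<in> set C1 \<union> set C2" for K
  proof
    assume p: "?p \<in> set K"
    have "sorted_wrt (\<lambda>I J. \<forall>i\<in>set I. \<forall>j\<in>set J. i < j) (C1 @ J # C2)"
      using C(2) unfolding Cs .
    then have "(\<forall>i\<in>set K. \<forall>j\<in>set J. i < j) \<or> (\<forall>i\<in>set J. \<forall>j\<in>set K. i < j)"
      using that by (auto simp: sorted_wrt_append)
    then show False using p J(2) by blast
  qed
  define W where "W = map (\<lambda>K. word scale (subword (xs @ 0 # ys) K))"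
  have W: "map (\<lambda>K. word scale (subword (xs @ v # ys) K)) Cs' = W Cs'"
    if "set Cs' \<subseteq> set C1 \<union> set C2" for v Cs'
    unfolding W_def
  proof (rule map_cong[OF refl])
    fix K assume "K \<in> set Cs'"
    then have K: "K \<in> set C1 \<union> set C2" using that by blast
    then have "K \<in> set ?C" unfolding Cs by auto
    then show "word scale (subword (xs @ v # ys) K) = word scale (subword (xs @ 0 # ys) K)"
      by (intro arg_cong[of _ _ "word scale"] subword_const other[OF K] zero)
  qed
  have WL: "W C1 \<in> lists (vecs (TA scale))" "W C2 \<in> lists (vecs (TA scale))"
    unfolding W_def
    using right_words_in[OF subset_refl, of C1 ?n S "xs @ 0 # ys"]
      right_words_in[OF subset_refl, of C2 ?n S "xs @ 0 # ys"]
    unfolding Cs set_append list.set by blast+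
  have eq: "right_part scale (xs @ v # ys) S =
      bar scale (W C1 @ word scale (subword (xs @ 0 # ys) j1 @ v # subword (xs @ 0 # ys) j2) # W C2)" for v
  proof -
    have len: "length (xs @ v # ys) = ?n" by simp
    show ?thesis
      unfolding right_part_def len Cs map_append list.map
        W[OF Un_upper1] W[OF Un_upper2] js subword_split[OF n z, of v ys 0] ..
  qed
  show ?thesis
    unfolding eq by (rule linear_on_comp[OF word_linear bar_linear[OF WL]])
qed

lemma coproduct_summand_linear:
  assumes S: "S \<subseteq> {1..length xs + Suc (length ys)}"
  shows "linear_on (whole scale) HH
     (\<lambda>v. tensor H H (left_part scale (xs @ v # ys) S) (right_part scale (xs @ v # ys) S))"
proof -
  let ?p = "Suc (length xs)" and ?n = "length xs + Suc (length ys)"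
  have fin: "finite S" using S by (rule finite_subset) simp
  have zero: "0 \<notin> S"
  proof
    assume "0 \<in> S"
    then have "0 \<in> {1..?n}" using S by (rule rev_subsetD)
    then show False by simp
  qed
  show ?thesis
  proof (cases "?p \<in> S")
    case True
    define R where "R = right_part scale (xs @ 0 # ys) S"
    have "right_part scale (xs @ v # ys) S = R" for v
    proof -
      have "subword (xs @ v # ys) K = subword (xs @ 0 # ys) K"
        if "K \<in> set (components {1..?n} ({1..?n} - S))" for K
      proof (rule subword_const)
        have "set K \<subseteq> \<Union> (set ` set (components {1..?n} ({1..?n} - S)))" using that by blast
        then have K: "set K \<subseteq> {1..?n} - S"
          unfolding components_properties(3)[OF finite_atLeastAtMost Diff_subset] .
        show "?p \<notin> set K" using K True by blast
        have "0 \<notin> {1..?n}" by simp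
        then show "0 \<notin> set K" using K by blast
      qed
      then have "map (\<lambda>K. word scale (subword (xs @ v # ys) K)) (components {1..?n} ({1..?n} - S)) =
          map (\<lambda>K. word scale (subword (xs @ 0 # ys) K)) (components {1..?n} ({1..?n} - S))"
        by (intro map_cong[OF refl] arg_cong[of _ _ "word scale"])
      then show ?thesis
        unfolding R_def right_part_def
        by (simp only: length_append list.size add_0_right add_Suc_right)
    qed
    note eq = this
    have "R \<in> vecs H" unfolding R_def by (rule right_part_in)
    then show ?thesis
      unfolding eq
      by (rule linear_on_comp[OF left_part_linear[OF fin zero True] tensor_linear(2)])
  next
    case False
    define L where "L = left_part scale (xs @ 0 # ys) S"
    have eq: "left_part scale (xs @ v # ys) S = L" for v
    proof -
      have "?p \<notin> set (sorted_list_of_set S)" "0 \<notin> set (sorted_list_of_set S)"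
        unfolding set_sorted_list_of_set[OF fin] by (fact False, fact zero)
      then have "subword (xs @ v # ys) (sorted_list_of_set S) = subword (xs @ 0 # ys) (sorted_list_of_set S)"
        by (rule subword_const)
      then show ?thesis unfolding L_def left_part_def by (simp only:)
    qed
    have "L \<in> vecs H" unfolding L_def by (rule left_part_in[OF fin])
    moreover have "?p \<in> {1..?n} - S" using False by simp
    ultimately show ?thesis
      unfolding eq by (intro linear_on_comp[OF right_part_linear tensor_linear(1)])
  qed
qed

text \<open>The coproduct is well defined: it satisfies the formula on words and is multiplicative.\<close>

theorem coproduct_on_words_word:
  "coproduct_on_words scale (word scale as) =
     (\<Sum>S\<in>Pow {1..length as}. tensor H H (left_part scale as S) (right_part scale as S))"
  and coproduct_on_words_linear: "linear_on (TA scale) HH (coproduct_on_words scale)"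
proof -
  let ?h = "\<lambda>as. \<Sum>S\<in>Pow {1..length as}. tensor H H (left_part scale as S) (right_part scale as S)"
  have lin: "linear_on (whole scale) HH (\<lambda>v. ?h (xs @ v # ys))" for xs ys
  proof -
    have "linear_on (whole scale) HH (\<lambda>v. \<Sum>S\<in>Pow {1..length xs + Suc (length ys)}.
        tensor H H (left_part scale (xs @ v # ys) S) (right_part scale (xs @ v # ys) S))"
      by (rule linear_on_sum[OF vector_space_on_tensor_space coproduct_summand_linear]) (rule PowD)
    then show ?thesis by (simp only: length_append list.size add_0_right add_Suc_right)
  qed
  have h0: "?h [] \<in> vecs HH"
    using linear_on_in[OF tensor_linear(1)[OF left_part_in] right_part_in] by simp
  note t = tens_lift[where h = ?h and V = "whole scale", folded tensor_space_eq,
      OF lin[unfolded tensor_space_eq] h0[unfolded tensor_space_eq]]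
  show "coproduct_on_words scale (word scale as) = ?h as"
    unfolding coproduct_on_words_def word_def by (rule t(2))
  show "linear_on (TA scale) HH (coproduct_on_words scale)"
    unfolding TA_def coproduct_on_words_def tensor_space_eq
    by (rule linear_on_nonunital, rule t(1))
qed

lemmas times_HH_linear =
  tensor_square_mult_properties(1,2)[OF vector_space_on_TTA bar_mult_linear]

private definition unit_HH where "unit_HH = tensor H H (bar scale []) (bar scale [])"

lemma unit_HH_in: "unit_HH \<in> vecs HH"
  unfolding unit_HH_def
  by (rule linear_on_in[OF tensor_linear(1)]) (simp_all add: bar_in)

lemma times_HH_unit_right:
  assumes t: "t \<in> vecs HH"
  shows "times_HH t unit_HH = t"
proof (rule linear_on_fspan_unique[where g = "\<lambda>t. t" and x = t])
  let ?X = "{tensor H H v w |v w. v \<in> vecs H \<and> w \<in> vecs H}"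
  show "linear_on (fspan ?X) HH (\<lambda>t. times_HH t unit_HH)"
    using times_HH_linear(2)[OF unit_HH_in] by (simp only: tensor_space_def)
  show "linear_on (fspan ?X) HH (\<lambda>t. t)"
    by (simp add: linear_on_def tensor_space_def)
  show "t \<in> vecs (fspan ?X)" using t by (simp only: tensor_space_def)
  fix s assume "s \<in> ?X"
  then obtain v w where s: "s = tensor H H v w" and v: "v \<in> vecs H" and w: "w \<in> vecs H" by blast
  have e: "bar scale [] \<in> vecs H" by (simp add: bar_in)
  have u: "bar_mult scale (tensor H H x (bar scale [])) = x" if "x \<in> vecs H" for x
    using that unfolding TTA_def bar_mult_def bar_def
    by (rule concat_mult_unit_right[OF vector_space_on_TA])
  show "times_HH s unit_HH = s"
    unfolding s unit_HH_def
      tensor_square_mult_properties(3)[OF vector_space_on_TTA bar_mult_linear v w e e] u[OF v] u[OF w] ..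
qed (rule vector_space_on_tensor_space)

theorem coproduct_bar:
  assumes ws: "ws \<in> lists (vecs (TA scale))"
  shows "coproduct scale (bar scale ws) = foldr times_HH (map (coproduct_on_words scale) ws) unit_HH"
    and coproduct_linear: "linear_on H HH (coproduct scale)"
proof -
  let ?D = "coproduct_on_words scale"
  let ?h = "\<lambda>ws. foldr times_HH (map ?D ws) unit_HH"
  have mem: "?h ws \<in> vecs HH" if "ws \<in> lists (vecs (TA scale))" for ws
    using that
  proof (induction ws)
    case (Cons w ws)
    then show ?case
      using linear_on_in[OF times_HH_linear(1)[OF linear_on_in[OF coproduct_on_words_linear]]] by simp
  qed (simp add: unit_HH_in del: vecs_fspan)
  have lin: "linear_on (TA scale) HH (\<lambda>w. ?h (xs @ w # ys))"
    if "xs \<in> lists (vecs (TA scale))" "ys \<in> lists (vecs (TA scale))" for xs ys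
    using that(1)
  proof (induction xs)
    case Nil
    show ?case
      using linear_on_comp[OF coproduct_on_words_linear times_HH_linear(2)[OF mem[OF that(2)]]] by simp
  next
    case (Cons x xs)
    show ?case
      using linear_on_comp[OF Cons.IH
          times_HH_linear(1)[OF linear_on_in[OF coproduct_on_words_linear Cons.hyps(1)]]] by simp
  qed
  note t = tens_lift[where h = ?h and V = "TA scale", folded tensor_space_eq,
      OF lin[unfolded tensor_space_eq] mem[OF lists.Nil, unfolded tensor_space_eq]]
  have c: "coproduct scale = lift ?h"
    unfolding coproduct_def unit_HH_def ..
  show "coproduct scale (bar scale ws) = ?h ws"
    unfolding c bar_def by (rule t(2))
  show "linear_on H HH (coproduct scale)"
  proof -
    have "linear_on (full_tensor (TA scale)) HH (lift ?h)"
      unfolding tensor_space_eq by (rule t(1))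
    then show ?thesis unfolding c TTA_def[symmetric] .
  qed
qed

corollary coproduct_word:
  assumes "as \<noteq> []"
  shows "coproduct scale (bar scale [word scale as]) =
     (\<Sum>S\<in>Pow {1..length as}. tensor H H (left_part scale as S) (right_part scale as S))"
  using coproduct_bar(1)[of "[word scale as]"] word_in[OF assms]
    times_HH_unit_right[OF linear_on_in[OF coproduct_on_words_linear word_in[OF assms]]]
  by (simp add: coproduct_on_words_word)

end

end

theory Submission
  imports Defs
begin

text \<open>Write a bar product $w_1|\cdots|w_r$ of words in \<open>TTA scale\<close> as a \<^emph>\<open>barred word\<close>: a list of letters and
  bars whose maximal runs of letters are the words $w_i$.  Several bars in a row, or bars at the
  ends, are allowed and mean nothing; \<open>element\<close> sends a barred word to the tensor that it
  denotes, and the product of two elements joins the barred words by a bar.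

  On barred words the coproduct works letter by letter.  Each letter goes either to the left or to
  the right.  The left factor is the barred word with the letters going to the right erased; the
  right factor is the barred word with every letter going to the left replaced by a bar.  These new
  bars cut the remaining letters exactly into the connected components of the complement, so for a
  single word this is the formula that defines the coproduct.  Since old bars are kept on both sides,
  the description is compatible with joining by bars, and it holds for all barred words
  (\<open>coproduct_element\<close>).

  Coassociativity then holds term by term.  Both iterated coproducts sum over the ways to assign each
  letter to one of three factors, and in both cases a letter is kept in its own factor, is erased from
  the factors before it and has become a bar in the factors after it (\<open>split_sum_assoc\<close>).  The counit
  laws hold because only the assignments that send all letters to one side survive.  Elements of
  barred words span \<open>TTA scale\<close> (\<open>TTA_eq_span_elements\<close>), and all maps
  involved are linear, so it is enough to verify each identity on them.

  The degree of a barred word is its number of letters, and the coproduct distributes the letters over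
  the two factors.  So the convolution powers of the identity minus (unit after counit) vanish on
  degree $n$ from the $(n+1)$st on, each factor consuming at least one letter, and their alternating
  sum is an antipode (\<open>antipode_convolution\<close>).  The sum of the degrees is direct because
  multiplying degree $n$ by $2^n$ is a well-defined endomorphism, whose eigenvalues are distinct in
  characteristic zero.

  A linear functional on $A$ with value 1 at 1 yields linear forms on \<open>TTA scale\<close> that
  recognise the list of word lengths of a barred word in the letter 1.  They separate $1|11$ from
  $11|1$.  The coproduct of the word $111$ contains $1 \otimes 1|1$, while the left factors
  of the coproduct of a single word never contain a bar; so the flip does not fix it.\<close>

section \<open>Barred words\<close>

text \<open>A barred word over letters of type \<open>'a\<close> is an \<open>'a option list\<close>, where \<open>None\<close> is a bar.
  Between two neighbouring bars there may be an empty word, which \<open>blocks\<close> discards.\<close>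

fun split_at_bars :: "'a option list \<Rightarrow> 'a list list" where
  "split_at_bars [] = [[]]"
| "split_at_bars (None # xs) = [] # split_at_bars xs"
| "split_at_bars (Some a # xs) = (a # hd (split_at_bars xs)) # tl (split_at_bars xs)"

definition blocks :: "'a option list \<Rightarrow> 'a list list" where
  "blocks xs = filter (\<lambda>as. as \<noteq> []) (split_at_bars xs)"

definition letters :: "'a option list \<Rightarrow> nat" where
  "letters xs = length (filter (\<lambda>x. x \<noteq> None) xs)"

lemma letters_simps [simp]:
  "letters [] = 0" "letters (None # xs) = letters xs" "letters (Some a # xs) = Suc (letters xs)"
  "letters (xs @ ys) = letters xs + letters ys"
  by (simp_all add: letters_def)

lemma barred_word_induct [case_names Nil bar letter]:
  assumes "P []" "\<And>xs. P xs \<Longrightarrow> P (None # xs)" "\<And>a xs. P xs \<Longrightarrow> P (Some a # xs)"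
  shows "P xs"
  by (induction xs rule: split_at_bars.induct) (rule assms; assumption)+

lemma split_at_bars_ne [simp]: "split_at_bars xs \<noteq> []"
  by (induction xs rule: barred_word_induct) simp_all

lemma split_at_bars_append: "split_at_bars (xs @ None # ys) = split_at_bars xs @ split_at_bars ys"
  by (induction xs rule: barred_word_induct) simp_all

lemma split_at_bars_word: "split_at_bars (map Some as) = [as]"
  by (induction as) simp_all

lemma blocks_append: "blocks (xs @ None # ys) = blocks xs @ blocks ys"
  by (simp add: blocks_def split_at_bars_append)

lemma blocks_word: "blocks (map Some as) = (if as = [] then [] else [as])"
  by (simp add: blocks_def split_at_bars_word)

lemma blocks_simps [simp]: "blocks [] = []" "blocks (None # xs) = blocks xs"
  by (simp_all add: blocks_def)

lemma split_at_bars_map: "split_at_bars (map (map_option f) xs) = map (map f) (split_at_bars xs)"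
  by (induction xs rule: barred_word_induct) (simp_all add: hd_map map_tl)

lemma blocks_map: "blocks (map (map_option f) xs) = map (map f) (blocks xs)"
  by (simp add: blocks_def split_at_bars_map filter_map comp_def)

lemma block_ne: "as \<in> set (blocks xs) \<Longrightarrow> as \<noteq> []"
  by (simp add: blocks_def)

lemma sum_list_split_at_bars: "sum_list (map length (split_at_bars xs)) = letters xs"
proof (induction xs rule: barred_word_induct)
  case (letter a xs)
  then show ?case by (cases "split_at_bars xs") simp_all
qed simp_all

lemma sum_list_blocks: "sum_list (map length (blocks xs)) = letters xs"
  unfolding blocks_def sum_list_split_at_bars[symmetric]
  by (rule sum_list_map_filter) simp

lemma map_Some_the: "None \<notin> set xs \<Longrightarrow> map Some (map the xs) = xs"
  by (induction xs) auto

text \<open>Peeling off everything up to the first bar is the induction step for statements about barred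
  words that are known for single words.\<close>

lemma barred_word_cases:
  obtains (word) as where "xs = map Some as"
    | (bar) as ys where "xs = map Some as @ None # ys" "length ys < length xs"
proof (cases "None \<in> set xs")
  case True
  then obtain ps ys where xs: "xs = ps @ None # ys" "None \<notin> set ps" by (meson split_list_first)
  from xs(1) have "xs = map Some (map the ps) @ None # ys" unfolding map_Some_the[OF xs(2)] .
  then show ?thesis by (rule bar) (simp add: xs(1))
next
  case False
  then show ?thesis by (rule word[OF map_Some_the[symmetric]])
qed

section \<open>Splitting barred words\<close>

text \<open>The sum over all ways to send each letter to the left or to the right, where a letter sent to
  the left leaves a bar on the right.  Taking the sum itself as the recursive notion, with an arbitrary
  summand, avoids any explicit indexing set and makes induction on the barred word immediate.\<close>

fun split_sum :: "'a option list \<Rightarrow> ('a option list \<Rightarrow> 'a option list \<Rightarrow> 'b) \<Rightarrow> 'b::comm_monoid_add" where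
  "split_sum [] F = F [] []"
| "split_sum (None # xs) F = split_sum xs (\<lambda>l r. F (None # l) (None # r))"
| "split_sum (Some a # xs) F =
     split_sum xs (\<lambda>l r. F (Some a # l) (None # r)) + split_sum xs (\<lambda>l r. F l (Some a # r))"

text \<open>Every letter goes to exactly one side, so the summand only matters on pairs that share out the
  letters.\<close>

lemma split_sum_cong:
  assumes "\<And>l r. letters l + letters r = letters xs \<Longrightarrow> F l r = G l r"
  shows "split_sum xs F = split_sum xs G"
  using assms
proof (induction xs arbitrary: F G rule: barred_word_induct)
  case Nil
  then show ?case by simp
next
  case (bar xs)
  show ?case unfolding split_sum.simps by (rule bar.IH) (rule bar.prems, simp)
next
  case (letter a xs)
  have "split_sum xs (\<lambda>l r. F (Some a # l) (None # r)) = split_sum xs (\<lambda>l r. G (Some a # l) (None # r))"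
    by (rule letter.IH) (rule letter.prems, simp)
  moreover have "split_sum xs (\<lambda>l r. F l (Some a # r)) = split_sum xs (\<lambda>l r. G l (Some a # r))"
    by (rule letter.IH) (rule letter.prems, simp)
  ultimately show ?case by simp
qed

lemma split_sum_add: "split_sum xs (\<lambda>l r. F l r + G l r) = split_sum xs F + split_sum xs G"
  by (induction xs arbitrary: F G rule: barred_word_induct) (simp_all add: ac_simps)

lemma split_sum_zero [simp]: "split_sum xs (\<lambda>l r. 0) = 0"
  by (induction xs rule: barred_word_induct) simp_all

lemma split_sum_append:
  "split_sum (xs @ None # ys) F =
     split_sum xs (\<lambda>l r. split_sum ys (\<lambda>l' r'. F (l @ None # l') (r @ None # r')))"
  by (induction xs arbitrary: F rule: barred_word_induct) simp_all

lemma split_sum_snoc: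
  "split_sum (xs @ [Some a]) F =
     split_sum xs (\<lambda>l r. F (l @ [Some a]) (r @ [None])) + split_sum xs (\<lambda>l r. F l (r @ [Some a]))"
  by (induction xs arbitrary: F rule: barred_word_induct) (simp_all add: ac_simps)

text \<open>The combinatorial core of coassociativity.  Both sides assign each letter to one of three
  factors.  A letter of the first factor is a bar in the second and third one, a letter of the
  second factor is absent from the first and a bar in the third, and a letter of the third is absent
  from the others, in whichever order the two splittings are made.\<close>

lemma split_sum_assoc:
  "split_sum xs (\<lambda>l r. split_sum l (\<lambda>l1 l2. F l1 l2 r)) =
   split_sum xs (\<lambda>l r. split_sum r (\<lambda>r1 r2. F l r1 r2))"
  by (induction xs arbitrary: F rule: barred_word_induct) (simp_all add: split_sum_add ac_simps)

text \<open>If no letter goes to the left, then no new bar appears and the right part is the barred word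
  itself; if none goes to the right, nothing is erased from the left part.\<close>

lemma split_sum_left_empty: "split_sum xs (\<lambda>l r. if letters l = 0 then F r else 0) = F xs"
  by (induction xs arbitrary: F rule: barred_word_induct) simp_all

lemma split_sum_right_empty: "split_sum xs (\<lambda>l r. if letters r = 0 then F l else 0) = F xs"
  by (induction xs arbitrary: F rule: barred_word_induct) simp_all

lemma split_sum_hom:
  assumes "\<And>x y. h (x + y) = h x + h y"
  shows "h (split_sum xs F) = split_sum xs (\<lambda>l r. h (F l r))"
  by (induction xs arbitrary: F rule: barred_word_induct) (simp_all add: assms)

lemma split_sum_sum:
  "split_sum xs (\<lambda>l r. \<Sum>i\<in>I. F i l r) = (\<Sum>i\<in>I. split_sum xs (F i))"
  by (induction xs arbitrary: F rule: barred_word_induct) (simp_all add: sum.distrib)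

text \<open>For a single word the left/right choices are the subsets \<open>S\<close> of the positions.  The induction is
  from the right end, because appending a letter does not renumber the others.\<close>

lemma split_sum_subsets:
  "split_sum (map Some as) F =
     (\<Sum>S\<in>Pow {1..length as}. F (map (\<lambda>i. Some (as ! (i - 1))) (sorted_list_of_set S))
        (map (\<lambda>i. if i \<in> S then None else Some (as ! (i - 1))) [1..<Suc (length as)]))"
proof (induction as arbitrary: F rule: rev_induct)
  case Nil
  show ?case by simp
next
  case (snoc a as)
  let ?n = "length as"
  let ?L = "\<lambda>as S. map (\<lambda>i. Some (as ! (i - 1))) (sorted_list_of_set S)"
  let ?R = "\<lambda>as n S. map (\<lambda>i. if i \<in> S then None else Some (as ! (i - 1))) [1..<Suc n]"
  let ?as = "as @ [a]"
  have old: "?L ?as S = ?L as S" "?R ?as (Suc ?n) S = ?R as ?n S @ [Some a]"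
    "?L ?as (insert (Suc ?n) S) = ?L as S @ [Some a]"
    "?R ?as (Suc ?n) (insert (Suc ?n) S) = ?R as ?n S @ [None]"
    if S: "S \<in> Pow {1..?n}" for S
  proof -
    have fin: "finite S" using S by (auto intro: finite_subset)
    have nth: "?as ! (i - 1) = as ! (i - 1)" if "i \<in> {1..?n}" for i
      using that by (auto simp: nth_append)
    have n: "Suc ?n \<notin> S" using S by auto
    have ins: "sorted_list_of_set (insert (Suc ?n) S) = sorted_list_of_set S @ [Suc ?n]"
    proof (rule strict_sorted_equal)
      show "sorted_wrt (<) (sorted_list_of_set S @ [Suc ?n])"
        using S fin by (auto simp: sorted_wrt_append)
      show "set (sorted_list_of_set (insert (Suc ?n) S)) = set (sorted_list_of_set S @ [Suc ?n])"
        unfolding set_sorted_list_of_set[OF finite.insertI[OF fin]] using fin by simp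
    qed (rule strict_sorted_list_of_set)
    show 1: "?L ?as S = ?L as S"
    proof (rule map_cong[OF refl])
      fix i assume "i \<in> set (sorted_list_of_set S)"
      then have "i \<in> {1..?n}" using S fin by auto
      then show "Some (?as ! (i - 1)) = Some (as ! (i - 1))" by (simp only: nth)
    qed
    show "?L ?as (insert (Suc ?n) S) = ?L as S @ [Some a]"
      unfolding ins using 1 by simp
    have R: "?R ?as ?n T = ?R as ?n S" if "\<forall>i\<in>{1..?n}. i \<in> T \<longleftrightarrow> i \<in> S" for T
    proof (rule map_cong[OF refl])
      fix i assume "i \<in> set [1..<Suc ?n]"
      then have i: "i \<in> {1..?n}" by auto
      show "(if i \<in> T then None else Some (?as ! (i - 1))) = (if i \<in> S then None else Some (as ! (i - 1)))"
        unfolding nth[OF i] using that i by simp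
    qed
    have up: "[1..<Suc (Suc ?n)] = [1..<Suc ?n] @ [Suc ?n]" by simp
    show "?R ?as (Suc ?n) S = ?R as ?n S @ [Some a]"
      unfolding up map_append using R[of S] n by simp
    show "?R ?as (Suc ?n) (insert (Suc ?n) S) = ?R as ?n S @ [None]"
      unfolding up map_append using R[of "insert (Suc ?n) S"] n by simp
  qed
  have Pow: "Pow {1..Suc ?n} = Pow {1..?n} \<union> insert (Suc ?n) ` Pow {1..?n}"
    unfolding Pow_insert[symmetric] by (rule arg_cong[where f = Pow]) auto
  have inj: "inj_on (insert (Suc ?n)) (Pow {1..?n})"
  proof (rule inj_on_inverseI)
    fix S assume "S \<in> Pow {1..?n}"
    then have "Suc ?n \<notin> S" by auto
    then show "insert (Suc ?n) S - {Suc ?n} = S" by (rule Diff_insert_absorb)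
  qed
  have "(\<Sum>S\<in>Pow {1..Suc ?n}. F (?L ?as S) (?R ?as (Suc ?n) S)) =
      (\<Sum>S\<in>Pow {1..?n}. F (?L ?as S) (?R ?as (Suc ?n) S)) +
      (\<Sum>S\<in>insert (Suc ?n) ` Pow {1..?n}. F (?L ?as S) (?R ?as (Suc ?n) S))"
    unfolding Pow by (rule sum.union_disjoint) auto
  also have "\<dots> = (\<Sum>S\<in>Pow {1..?n}. F (?L as S) (?R as ?n S @ [Some a])) +
      (\<Sum>S\<in>Pow {1..?n}. F (?L as S @ [Some a]) (?R as ?n S @ [None]))"
    unfolding sum.reindex[OF inj] comp_def
    by (intro arg_cong2[where f = "(+)"] sum.cong refl) (simp_all only: old)
  also have "\<dots> = split_sum (map Some ?as) F"
    unfolding map_append list.map split_sum_snoc snoc by (rule add.commute)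
  finally show ?case by simp
qed

section \<open>Connected components as blocks\<close>

text \<open>Replace the positions in \<open>S\<close> by bars in the list of positions from \<open>m\<close> to \<open>n - 1\<close>: the runs left
  over are intervals, and there is a gap of at least one position between two of them.  The first
  run is special in the induction, since a new leftmost position is joined to it: it may be empty, and
  it starts at \<open>m\<close> and is followed by a gap at its end \<open>j\<close>.\<close>

lemma split_at_bars_positions:
  fixes S :: "nat set"
  assumes "m \<le> n"
  defines "B \<equiv> split_at_bars (map (\<lambda>i. if i \<in> S then None else Some i) [m..<n])"
  shows "\<exists>j. hd B = [m..<j] \<and> m \<le> j \<and> (\<forall>I\<in>set (tl B). \<forall>i\<in>set I. j < i)"
    and "\<forall>I\<in>set B. \<exists>i j. I = [i..<j]"
    and "\<Union> (set ` set B) = {m..<n} - S"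
    and "sorted_wrt (\<lambda>I J. \<forall>i\<in>set I. \<forall>j\<in>set J. Suc i < j) B"
  using assms(1) unfolding B_def
proof (induction "n - m" arbitrary: m)
  case 0
  { case 1 then show ?case using 0 by (intro exI[of _ m]) simp }
  { case 2 then show ?case using 0 by (auto intro!: exI[of _ 0]) }
  { case 3 then show ?case using 0 by simp }
  { case 4 then show ?case using 0 by simp }
next
  case (Suc k)
  let ?B = "\<lambda>m. split_at_bars (map (\<lambda>i. if i \<in> S then None else Some i) [m..<n])"
  have mn: "m < n" using Suc.hyps(5) by simp
  have k: "k = n - Suc m" "Suc m \<le> n" using Suc.hyps(5) by simp_all
  note IH = Suc.hyps(1-4)[OF k]
  from IH(1) obtain j where j: "hd (?B (Suc m)) = [Suc m..<j]" "Suc m \<le> j"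
    "\<forall>I\<in>set (tl (?B (Suc m))). \<forall>i\<in>set I. j < i" by blast
  obtain I Is where B: "?B (Suc m) = I # Is" by (cases "?B (Suc m)") auto
  have step: "?B m = (if m \<in> S then [] # ?B (Suc m) else (m # I) # Is)"
    using mn B by (simp add: upt_conv_Cons)
  have I: "m # I = [m..<j]" "I = [Suc m..<j]" "m < j" using j(1,2) B by (simp_all add: upt_conv_Cons)
  have Is: "\<forall>J\<in>set Is. \<forall>i\<in>set J. j < i" using j(3) B by simp
  have range: "{m..<n} = insert m {Suc m..<n}" using mn by auto
  have un: "set I \<union> \<Union> (set ` set Is) = {Suc m..<n} - S" using IH(3) B by simp
  { case 1
    show ?case
    proof (cases "m \<in> S")
      case True
      have "m < i" if "J \<in> set (?B (Suc m))" "i \<in> set J" for i J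
      proof -
        have "i \<in> \<Union> (set ` set (?B (Suc m)))" using that by blast
        then show ?thesis unfolding IH(3) by simp
      qed
      then show ?thesis unfolding step using True by (intro exI[of _ m]) simp
    next
      case False
      then show ?thesis unfolding step using I Is by (intro exI[of _ j]) simp
    qed }
  { case 2
    have "\<exists>i j. [] = [i..<j]" by (rule exI[of _ 0], rule exI[of _ 0]) simp
    moreover have "\<exists>i j. m # I = [i..<j]" using I(1) by blast
    ultimately show ?case unfolding step using IH(2) B by simp }
  { case 3
    show ?case unfolding step using un B range by auto }
  { case 4
    have "\<forall>J\<in>set Is. \<forall>i\<in>set (m # I). \<forall>t\<in>set J. Suc i < t"
      unfolding I(1) using Is by force
    then show ?case unfolding step using IH(4) B by simp }
qed

lemma sorted_wrt_comparable:
  "sorted_wrt R xs \<Longrightarrow> x \<in> set xs \<Longrightarrow> y \<in> set xs \<Longrightarrow> x = y \<or> R x y \<or> R y x"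
  by (induction xs) auto

text \<open>Blocks are intervals contained in the complement of \<open>S\<close> and separated by elements of \<open>S\<close>, so
  they are maximal gapless lists.  Conversely, a gapless list that shares a position with a block
  forms a gapless list together with it, so a connected component equals the block that it meets.  Both
  lists are increasing, hence they agree as lists.\<close>

lemma components_are_blocks:
  "components {1..n} ({1..n} - S) =
     blocks (map (\<lambda>i. if i \<in> S then None else Some i) [1..<Suc n])" (is "?C = ?B")
proof -
  let ?U = "{1..n}" and ?sep = "\<lambda>I J. \<forall>i\<in>set I. \<forall>j\<in>set J. Suc i < j"
  let ?lt = "\<lambda>I J. \<forall>i\<in>set I. \<forall>j\<in>set J. i < (j::nat)"
  note P = split_at_bars_positions[of 1 "Suc n" S, OF le_add1[of 1 n, unfolded plus_1_eq_Suc]]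
  have range: "{1..<Suc n} = ?U" by auto
  have ivl: "\<exists>i j. I = [i..<j]" "I \<noteq> []" if "I \<in> set ?B" for I
    using that P(2) by (auto simp: blocks_def)
  have "\<Union> (set ` set (split_at_bars xs)) = \<Union> (set ` set (blocks xs))" for xs :: "nat option list"
    by (auto simp: blocks_def)
  then have un: "\<Union> (set ` set ?B) = ?U - S"
    using P(3) unfolding range by (simp only:)
  have sep: "sorted_wrt ?sep ?B"
    using P(4) unfolding blocks_def by (simp add: sorted_wrt_filter)
  note C = components_properties[of ?U "?U - S", OF finite_atLeastAtMost Diff_subset]
  have gap: "gapless_in ?U (?U - S) I" if I: "I \<in> set ?B" for I
  proof -
    obtain i j where ij: "I = [i..<j]" using ivl[OF I] by blast
    have "set I \<subseteq> ?U - S" using un I by blast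
    then show ?thesis unfolding gapless_in_iff using ivl[OF I] unfolding ij by auto
  qed
  have comp: "connected_component_in ?U (?U - S) I" if I: "I \<in> set ?B" for I
    unfolding connected_component_in_def
  proof (intro conjI allI impI gap[OF I])
    fix js assume js: "gapless_in ?U (?U - S) js \<and> set I \<subseteq> set js"
    have conv: "u \<in> set js" if "s \<in> set js" "t \<in> set js" "u \<in> ?U" "s < u" "u < t" for s t u
      using js that unfolding gapless_in_iff by blast
    have jsS: "set js \<subseteq> ?U - S" and sorted: "sorted_wrt (<) js" using js by (simp_all add: gapless_in_def)
    have "t \<in> set I" if t: "t \<in> set js" for t
    proof (rule ccontr)
      assume tI: "t \<notin> set I"
      obtain i j where ij: "I = [i..<j]" "i < j" using ivl[OF I] by fastforce
      have "t \<in> ?U - S" using t jsS by blast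
      then obtain J where J: "J \<in> set ?B" "t \<in> set J" using un by blast
      have "I \<noteq> J" using J(2) tI by blast
      then have IJ: "?sep I J \<or> ?sep J I" using sorted_wrt_comparable[OF sep I J(1)] by blast
      have iI: "i \<in> set I" "j - 1 \<in> set I" using ij by auto
      have "i \<in> set js" "j - 1 \<in> set js" using iI js by blast+
      \<comment> \<open>a position just outside the block on the side of \<open>t\<close>; it lies between the block and \<open>t\<close>\<close>
      obtain u v where u: "u \<in> set js" "u \<notin> set I" "v \<in> set I" "u = Suc v \<or> v = Suc u"
      proof (cases "i < t")
        case True
        have "?sep I J"
        proof (rule ccontr)
          assume "\<not> ?sep I J"
          then have "?sep J I" using IJ by blast
          then have "Suc t < i" using J(2) iI(1) by blast
          then show False using True by simp
        qed
        then have "Suc (j - 1) < t" using iI(2) J(2) by blast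
        then have "j < t" using ij(2) by simp
        then have "j \<in> set js"
          using conv[OF \<open>j - 1 \<in> set js\<close> t, of j] \<open>t \<in> ?U - S\<close> ij by auto
        moreover have "j = Suc (j - 1)" using ij(2) by simp
        ultimately show ?thesis using that[of j "j - 1"] iI(2) ij by simp
      next
        case False
        have "?sep J I"
        proof (rule ccontr)
          assume "\<not> ?sep J I"
          then have "?sep I J" using IJ by blast
          then have "Suc i < t" using J(2) iI(1) by blast
          then show False using False by simp
        qed
        then have "Suc t < i" using iI(1) J(2) by blast
        moreover have "i \<in> ?U" using jsS \<open>i \<in> set js\<close> by blast
        ultimately have "i - 1 \<in> set js"
          using conv[OF t \<open>i \<in> set js\<close>, of "i - 1"] by simp
        moreover have "i = Suc (i - 1)" using \<open>Suc t < i\<close> by simp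
        ultimately show ?thesis using that[of "i - 1" i] iI(1) ij by simp
      qed
      then obtain K where K: "K \<in> set ?B" "u \<in> set K" using jsS un by blast
      have "K \<noteq> I" using K(2) u(2) by blast
      then have "?sep I K \<or> ?sep K I"
        using sorted_wrt_comparable[OF sep I K(1)] by blast
      then have "Suc v < u \<or> Suc u < v" using u(3) K(2) by blast
      then show False using u(4) by linarith
    qed
    then have "set js = set I" using js by blast
    then show "js = I"
      using sorted gap[OF I] unfolding gapless_in_def by (metis strict_sorted_equal)
  qed
  have "K \<in> set ?B" if K: "connected_component_in ?U (?U - S) K" for K
  proof -
    have gK: "gapless_in ?U (?U - S) K" using K by (simp add: connected_component_in_def)
    then have c: "hd K \<in> set K" "set K \<subseteq> ?U - S" by (simp_all add: gapless_in_def)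
    then obtain J where J: "J \<in> set ?B" "hd K \<in> set J" using un by blast
    note gJ = gap[OF J(1)]
    let ?KJ = "sorted_list_of_set (set K \<union> set J)"
    have "u \<in> set K \<union> set J"
      if "s \<in> set K \<union> set J" "t \<in> set K \<union> set J" "u \<in> ?U" "s < u" "u < t" for s t u
    proof -
      have convK: "u \<in> set K" if "s \<in> set K" "t \<in> set K" "s < u" "u < t" for s t
        using gK \<open>u \<in> ?U\<close> that unfolding gapless_in_iff by blast
      have convJ: "u \<in> set J" if "s \<in> set J" "t \<in> set J" "s < u" "u < t" for s t
        using gJ \<open>u \<in> ?U\<close> that unfolding gapless_in_iff by blast
      consider "u = hd K" | "u < hd K" | "hd K < u" by linarith
      then show ?thesis
      proof cases
        case 1
        then show ?thesis using c(1) by blast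
      next
        case 2
        then show ?thesis using that(1,4) convK[OF _ c(1)] convJ[OF _ J(2)] by blast
      next
        case 3
        then show ?thesis using that(2,5) convK[OF c(1)] convJ[OF J(2)] by blast
      qed
    qed
    moreover have sets: "set ?KJ = set K \<union> set J" by (rule set_sorted_list_of_set) simp
    moreover have "set K \<union> set J \<subseteq> ?U - S" using gJ c(2) by (simp add: gapless_in_def)
    moreover have "?KJ \<noteq> []" using sets c(1) by (metis UnI1 empty_iff list.set(1))
    ultimately have "gapless_in ?U (?U - S) ?KJ"
      unfolding gapless_in_iff sets by (intro conjI ballI impI strict_sorted_list_of_set) blast+
    moreover have "set K \<subseteq> set ?KJ" "set J \<subseteq> set ?KJ" unfolding sets by blast+
    ultimately have "?KJ = K" "?KJ = J"
      using K comp[OF J(1)] unfolding connected_component_in_def by blast+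
    then show ?thesis using J(1) by simp
  qed
  then have set: "set ?C = set ?B" unfolding C(1) using comp by blast
  have hd: "hd I \<in> set I" if "I \<in> set ?B" for I using ivl(2)[OF that] by simp
  have heads: "sorted_wrt (<) (map hd Is)" if "sorted_wrt ?lt Is" "set Is = set ?B" for Is
    unfolding sorted_wrt_map by (rule sorted_wrt_mono_rel[OF _ that(1)]) (use hd[unfolded that(2)[symmetric]] in blast)
  have "sorted_wrt ?lt ?B"
    by (rule sorted_wrt_mono_rel[OF _ sep]) (blast intro: Suc_lessD)
  \<comment> \<open>components and blocks are determined by their first positions, which increase\<close>
  then have eq: "map hd ?C = map hd ?B"
    by (intro strict_sorted_equal heads C(2) set refl) (simp_all only: set_map set)
  moreover have "I = J" if "I \<in> set ?B" "J \<in> set ?B" "hd I = hd J" for I J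
  proof (rule ccontr)
    assume "I \<noteq> J"
    then have "?sep I J \<or> ?sep J I"
      using sorted_wrt_comparable[OF sep that(1,2)] by blast
    then have "Suc (hd I) < hd J \<or> Suc (hd J) < hd I" using hd[OF that(1)] hd[OF that(2)] by blast
    then show False using that(3) by simp
  qed
  ultimately have "inj_on hd (set ?C \<union> set ?B)" unfolding set Un_absorb by (intro inj_onI)
  then show ?thesis by (rule map_inj_on[OF eq])
qed

section \<open>Linear maps on spans and tensor products\<close>

text \<open>Tensors are functions on forms, but they are used as vectors here; unfolding the scalar
  multiplication pointwise would destroy the vector space structure of terms.\<close>

declare fscale_apply [simp del]

lemma span_image_induct:
  assumes "x \<in> fscale.span (e ` I)" "\<And>i. i \<in> I \<Longrightarrow> P (e i)" "P 0"
    "\<And>x y. P x \<Longrightarrow> P y \<Longrightarrow> P (x + y)" "\<And>c x. P x \<Longrightarrow> P (fscale c x)"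
  shows "P x"
proof -
  have "fscale.span (e ` I) \<subseteq> Collect P"
    by (rule fscale.span_minimal) (use assms(2-) in \<open>auto intro!: fscale.subspaceI\<close>)
  then show ?thesis using assms(1) by blast
qed

lemma linear_on_scale:
  assumes "linear_on V W f" "vector_space_on W"
  shows "linear_on V W (\<lambda>x. scl W c (f x))"
proof -
  interpret W: vector_space "scl W" using assms(2) by (simp add: vector_space_on_def)
  have W: "W.subspace (vecs W)" using assms(2) by (simp add: vector_space_on_def)
  show ?thesis
    using assms(1) unfolding linear_on_def
    by (auto simp: W.scale_right_distrib W.scale_left_commute intro: W.subspace_scale[OF W])
qed

lemma linear_on_add:
  assumes "linear_on V W f" "linear_on V W h" "vector_space_on W"
  shows "linear_on V W (\<lambda>x. f x + h x)"
  using linear_on_sum[OF assms(3), of "UNIV :: bool set" V "\<lambda>b. if b then f else h"] assms(1,2)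
  by (simp add: UNIV_bool add.commute)

lemma linear_on_zero: "vector_space_on W \<Longrightarrow> linear_on V W (\<lambda>x. 0)"
  using linear_on_sum[of W "{}" V "\<lambda>i x. 0"] by simp

lemma linear_on_span_image:
  assumes "linear_on V W f" "x \<in> fscale.span X" "X \<subseteq> vecs V" "vector_space_on V"
    and "scl V = fscale" "scl W = fscale" "\<And>x. x \<in> X \<Longrightarrow> f x \<in> fscale.span Y"
  shows "f x \<in> fscale.span Y"
proof -
  have V: "fscale.subspace (vecs V)" using assms(4,5) by (simp add: vector_space_on_def)
  have "f (fscale 0 0) = fscale 0 (f 0)"
    using assms(1,5,6) fscale.subspace_0[OF V] unfolding linear_on_def by metis
  then have f0: "f 0 = 0" by simp
  have "x \<in> vecs V \<and> f x \<in> fscale.span Y"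
    using assms(2)
  proof (induction rule: fscale.span_induct_alt)
    case base
    show ?case unfolding f0 by (intro conjI fscale.subspace_0[OF V] fscale.span_zero)
  next
    case (step c x y)
    have x: "x \<in> vecs V" "fscale c x \<in> vecs V" "f x \<in> fscale.span Y"
      using step(1) assms(3,7) fscale.subspace_scale[OF V] by blast+
    have "f (fscale c x + y) = fscale c (f x) + f y"
      using assms(1,5,6) x step(2) by (simp add: linear_on_def)
    moreover have "fscale c x + y \<in> vecs V" using x(2) step(2) by (blast intro: fscale.subspace_add[OF V])
    moreover have "fscale c (f x) + f y \<in> fscale.span Y"
      using x(3) step(2) by (blast intro: fscale.span_add fscale.span_scale)
    ultimately show ?case by (simp only:)
  qed
  then show ?thesis by blast
qed

lemma span_in_space:
  "x \<in> fscale.span X \<Longrightarrow> X \<subseteq> vecs V \<Longrightarrow> vector_space_on V \<Longrightarrow> scl V = fscale \<Longrightarrow> x \<in> vecs V"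
  using fscale.span_minimal[of X "vecs V"] by (auto simp: vector_space_on_def)

lemma linear_on_cong:
  assumes "linear_on V W f" "vector_space_on V" "\<And>v. v \<in> vecs V \<Longrightarrow> h v = f v"
  shows "linear_on V W h"
proof -
  interpret V: vector_space "scl V" using assms(2) by (simp add: vector_space_on_def)
  have "V.subspace (vecs V)" using assms(2) by (simp add: vector_space_on_def)
  then show ?thesis
    using assms(1,3) by (simp add: linear_on_def V.subspace_add V.subspace_scale)
qed

lemma linear_on_id: "linear_on V V id"
  by (simp add: linear_on_def)

lemma tensor_map_properties:
  assumes "linear_on A V f" "linear_on B W h"
  shows "linear_on (tensor_space A B) (tensor_space V W) (tensor_map V W f h)"
    and "tensor_map V W f h (tensor A B x y) = tensor V W (f x) (h y)"
proof -
  have 1: "linear_on B (tensor_space V W) (\<lambda>y. tensor V W (f x) (h y))" if "x \<in> vecs A" for x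
    using linear_on_comp[OF assms(2) tensor_linear(1)[OF linear_on_in[OF assms(1) that]]] .
  have 2: "linear_on A (tensor_space V W) (\<lambda>x. tensor V W (f x) (h y))" if "y \<in> vecs B" for y
    using linear_on_comp[OF assms(1) tensor_linear(2)[OF linear_on_in[OF assms(2) that]]] .
  note t = tensor_lift[where h = "\<lambda>x y. tensor V W (f x) (h y)", OF 1[unfolded tensor_space_eq] 2[unfolded tensor_space_eq]]
  show "linear_on (tensor_space A B) (tensor_space V W) (tensor_map V W f h)"
    unfolding tensor_map_def using t(1) unfolding tensor_space_eq .
  show "tensor_map V W f h (tensor A B x y) = tensor V W (f x) (h y)"
    unfolding tensor_map_def by (rule t(2))
qed

text \<open>The definition of the associativity map nests two linear extensions.  The inner one is linear in
  its tensor argument by construction; linearity in the remaining vector \<open>z\<close> is inherited from pure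
  tensors, as the tensors for which it holds form a subspace.\<close>

lemma tensor_assoc_properties:
  assumes W: "vector_space_on W"
  shows "linear_on (tensor_space (tensor_space U V) W) (tensor_space U (tensor_space V W)) (tensor_assoc U V W)"
    and "x \<in> vecs U \<Longrightarrow> y \<in> vecs V \<Longrightarrow> z \<in> vecs W \<Longrightarrow>
      tensor_assoc U V W (tensor (tensor_space U V) W (tensor U V x y) z) =
      tensor U (tensor_space V W) x (tensor V W y z)"
proof -
  let ?UV = "tensor_space U V" and ?VW = "tensor_space V W"
  let ?T = "tensor_space U ?VW"
  define k where "k z = (\<lambda>x y. tensor U ?VW x (tensor V W y z))" for z
  define h where "h t z = lift (\<lambda>(x, y). k z x y) t" for t z
  have k1: "linear_on V ?T (\<lambda>y. k z x y)" if "x \<in> vecs U" "z \<in> vecs W" for x z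
    unfolding k_def by (rule linear_on_comp[OF tensor_linear(2)[OF that(2)] tensor_linear(1)[OF that(1)]])
  have k2: "linear_on U ?T (\<lambda>x. k z x y)" if "y \<in> vecs V" "z \<in> vecs W" for y z
    unfolding k_def by (rule tensor_linear(2)[OF linear_on_in[OF tensor_linear(1)[OF that(1)] that(2)]])
  have k3: "linear_on W ?T (\<lambda>z. k z x y)" if "x \<in> vecs U" "y \<in> vecs V" for x y
    unfolding k_def by (rule linear_on_comp[OF tensor_linear(1)[OF that(2)] tensor_linear(1)[OF that(1)]])
  have h1: "linear_on ?UV ?T (\<lambda>t. h t z)" "h (tensor U V x y) z = k z x y" if "z \<in> vecs W" for z x y
    using tensor_lift[where h = "k z", OF k1[OF _ that, unfolded tensor_space_eq[of U ?VW]] k2[OF _ that, unfolded tensor_space_eq[of U ?VW]]]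
    unfolding h_def tensor_space_eq[of U ?VW] by blast+
  have h2: "linear_on W ?T (h t)" if t: "t \<in> vecs ?UV" for t
  proof -
    have T: "vector_space_on ?T" by (rule vector_space_on_tensor_space)
    have "t \<in> fscale.span ((\<lambda>(x, y). tensor U V x y) ` (vecs U \<times> vecs V))"
      using t unfolding tensor_space_eq tensor_def by (simp add: case_prod_beta')
    then show ?thesis
    proof (rule span_image_induct[where P = "\<lambda>t. linear_on W ?T (h t)"])
      fix i assume "i \<in> vecs U \<times> vecs V"
      then show "linear_on W ?T (h (case i of (x, y) \<Rightarrow> tensor U V x y))"
        by (cases i) (auto intro!: linear_on_cong[OF k3 W] h1(2))
    next
      have "h 0 = (\<lambda>z. 0)" by (simp add: h_def lift_zero fun_eq_iff)
      then show "linear_on W ?T (h 0)" using linear_on_zero[OF T] by simp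
    next
      fix x y assume "linear_on W ?T (h x)" "linear_on W ?T (h y)"
      moreover have "h (x + y) = (\<lambda>z. h x z + h y z)" by (simp add: h_def lift_add fun_eq_iff)
      ultimately show "linear_on W ?T (h (x + y))" using linear_on_add[OF _ _ T] by simp
    next
      fix c x assume "linear_on W ?T (h x)"
      moreover have "h (fscale c x) = (\<lambda>z. scl ?T c (h x z))"
        by (intro ext) (simp add: h_def lift_fscale tensor_space_def)
      ultimately show "linear_on W ?T (h (fscale c x))" using linear_on_scale[OF _ T] by simp
    qed
  qed
  have ta: "tensor_assoc U V W = lift (\<lambda>(t, z). h t z)"
    unfolding tensor_assoc_def h_def k_def ..
  note t = tensor_lift[where h = h, OF h2[unfolded tensor_space_eq[of U ?VW]] h1(1)[unfolded tensor_space_eq[of U ?VW]]]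
  show "linear_on (tensor_space ?UV W) ?T (tensor_assoc U V W)"
    unfolding ta using t(1) unfolding tensor_space_eq[of U ?VW] .
  show "tensor_assoc U V W (tensor ?UV W (tensor U V x y) z) = tensor U ?VW x (tensor V W y z)"
    if "x \<in> vecs U" "y \<in> vecs V" "z \<in> vecs W"
  proof -
    have "lift (\<lambda>(t, z). h t z) (tensor ?UV W (tensor U V x y) z) = h (tensor U V x y) z" by (rule t(2))
    then show ?thesis unfolding ta h1(2)[OF that(3)] by (simp add: k_def)
  qed
qed

lemma tensor_swap_tensor: "tensor_swap V W (tensor V W x y) = tensor W V y x"
proof -
  note l = tensor_linear(2)[where V = W and W = V, unfolded tensor_space_eq]
    tensor_linear(1)[where V = W and W = V, unfolded tensor_space_eq]
  have "lift (\<lambda>(x, y). tensor W V y x) (tensor V W x y) = (\<lambda>x y. tensor W V y x) x y"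
    by (rule tensor_lift(2)[where h = "\<lambda>x y. tensor W V y x", OF l])
  then show ?thesis unfolding tensor_swap_def .
qed

text \<open>Unlike \<open>split_sum_hom\<close>, this covers maps that are additive only on the given space.\<close>

lemma split_sum_linear_on:
  assumes h: "linear_on V W h" and V: "vector_space_on V" and F: "\<And>l r. F l r \<in> vecs V"
  shows "split_sum xs F \<in> vecs V" "h (split_sum xs F) = split_sum xs (\<lambda>l r. h (F l r))"
proof -
  interpret V: vector_space "scl V" using V by (simp add: vector_space_on_def)
  have sub: "V.subspace (vecs V)" using V by (simp add: vector_space_on_def)
  have "split_sum xs F \<in> vecs V \<and> h (split_sum xs F) = split_sum xs (\<lambda>l r. h (F l r))"
    using F
  proof (induction xs arbitrary: F rule: barred_word_induct)
    case (letter a xs)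
    let ?L = "split_sum xs (\<lambda>l r. F (Some a # l) (None # r))" and ?R = "split_sum xs (\<lambda>l r. F l (Some a # r))"
    note IH = letter.IH[of "\<lambda>l r. F (Some a # l) (None # r)", OF letter.prems]
      letter.IH[of "\<lambda>l r. F l (Some a # r)", OF letter.prems]
    then have "?L + ?R \<in> vecs V" by (blast intro: V.subspace_add[OF sub])
    moreover have "h (?L + ?R) = h ?L + h ?R" using h IH by (simp add: linear_on_def)
    ultimately show ?case using IH by simp
  qed simp_all
  then show "split_sum xs F \<in> vecs V" "h (split_sum xs F) = split_sum xs (\<lambda>l r. h (F l r))" by blast+
qed

lemma concat_mult_unit_left:
  assumes V: "vector_space_on V" and x: "x \<in> vecs (full_tensor V)"
  shows "concat_mult V (tensor (full_tensor V) (full_tensor V) (tens V []) x) = x"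
proof -
  let ?H = "full_tensor V"
  have e: "tens V [] \<in> vecs ?H" by (rule tens_in_full) simp
  show ?thesis
  proof (rule linear_on_fspan_unique[where g = "\<lambda>x. x" and x = x])
    show "linear_on (fspan {tens V xs |xs. xs \<in> lists (vecs V)}) ?H
        (\<lambda>x. concat_mult V (tensor ?H ?H (tens V []) x))"
      using linear_on_comp[OF tensor_linear(1)[OF e] concat_mult_properties(1)[OF V]]
      by (simp only: full_tensor_def)
    show "linear_on (fspan {tens V xs |xs. xs \<in> lists (vecs V)}) ?H (\<lambda>x. x)"
      by (simp add: linear_on_def full_tensor_def)
    show "x \<in> vecs (fspan {tens V xs |xs. xs \<in> lists (vecs V)})"
      using x by (simp only: full_tensor_def)
    fix y assume "y \<in> {tens V xs |xs. xs \<in> lists (vecs V)}"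
    then obtain xs where "y = tens V xs" "xs \<in> lists (vecs V)" by blast
    then show "concat_mult V (tensor ?H ?H (tens V []) y) = y"
      using concat_mult_properties(2)[OF V, of "[]" xs] by simp
  qed (rule vector_space_on_full_tensor)
qed

lemma tensor_in: "x \<in> vecs V \<Longrightarrow> y \<in> vecs W \<Longrightarrow> tensor V W x y \<in> vecs (tensor_space V W)"
  by (rule linear_on_in[OF tensor_linear(1)])

lemma split_sum_in_span:
  assumes "\<And>l r. letters l + letters r = letters xs \<Longrightarrow> F l r \<in> fscale.span Y"
  shows "split_sum xs F \<in> fscale.span Y"
  using assms
proof (induction xs arbitrary: F rule: barred_word_induct)
  case Nil
  then show ?case by simp
next
  case (bar xs)
  show ?case unfolding split_sum.simps by (rule bar.IH) (rule bar.prems, simp)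
next
  case (letter a xs)
  have "split_sum xs (\<lambda>l r. F (Some a # l) (None # r)) \<in> fscale.span Y"
    by (rule letter.IH) (rule letter.prems, simp)
  moreover have "split_sum xs (\<lambda>l r. F l (Some a # r)) \<in> fscale.span Y"
    by (rule letter.IH) (rule letter.prems, simp)
  ultimately show ?case unfolding split_sum.simps by (rule fscale.span_add)
qed

text \<open>The antipode series telescopes: with \<open>a k\<close> the \<open>k\<close>th convolution power of a map \<open>f\<close>, the
  summand \<open>a (Suc k) + a k\<close> is that power convolved with \<open>f\<close> plus the convolution unit.\<close>

lemma alternating_telescope:
  "(\<Sum>k\<le>n. fscale ((-1) ^ k) (a (Suc k) + a k)) = a 0 + fscale ((-1) ^ n) (a (Suc n))"
proof (induction n)
  case (Suc n)
  have step: "fscale ((-1) ^ Suc n) (a (Suc (Suc n)) + a (Suc n)) =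
      fscale ((-1) ^ Suc n) (a (Suc (Suc n))) - fscale ((-1) ^ n) (a (Suc n))"
    by (rule ext) (simp add: fscale_apply algebra_simps)
  show ?case unfolding sum.atMost_Suc Suc step by (rule ext) simp
qed (rule ext, simp add: fscale_apply add.commute)

text \<open>The usual elimination: applying \<open>\<phi>\<close> and subtracting the last eigenvalue times the relation leaves
  a relation between fewer eigenvectors.\<close>

lemma eigenspaces_independent:
  fixes \<phi> :: "('x \<Rightarrow> 'k::field) \<Rightarrow> 'x \<Rightarrow> 'k" and c :: "nat \<Rightarrow> 'k"
  assumes add: "\<And>x y. \<phi> (x + y) = \<phi> x + \<phi> y"
    and eigen: "\<And>n x. x \<in> G n \<Longrightarrow> \<phi> x = fscale (c n) x"
    and scale: "\<And>n a x. x \<in> G n \<Longrightarrow> fscale a x \<in> G n"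
    and inj: "inj c"
    and "\<forall>n\<le>N. f n \<in> G n" "(\<Sum>n\<le>N. f n) = 0"
  shows "\<forall>n\<le>N. f n = 0"
  using assms(5,6)
proof (induction N arbitrary: f)
  case (Suc N)
  have "\<phi> 0 + \<phi> 0 = \<phi> 0" using add[of 0 0] by simp
  then have "\<phi> 0 = 0" by simp
  have "(\<Sum>n\<le>Suc N. fscale (c n) (f n)) = (\<Sum>n\<le>Suc N. \<phi> (f n))"
    using Suc.prems(1) by (intro sum.cong refl, intro eigen[symmetric]) simp
  also have "\<dots> = \<phi> (\<Sum>n\<le>Suc N. f n)"
    using sum_comp_morphism[of \<phi> f, OF \<open>\<phi> 0 = 0\<close> add] by (simp only: comp_def)
  also have "\<dots> = 0" unfolding Suc.prems(2) by (rule \<open>\<phi> 0 = 0\<close>)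
  finally have "(\<Sum>n\<le>Suc N. fscale (c n) (f n)) = 0" .
  moreover have "fscale (c (Suc N)) (\<Sum>n\<le>Suc N. f n) = 0"
    unfolding Suc.prems(2) by (rule fscale.scale_zero_right)
  ultimately have "(\<Sum>n\<le>Suc N. fscale (c n - c (Suc N)) (f n)) = 0"
    by (simp only: fscale.scale_left_diff_distrib sum_subtractf fscale.scale_sum_right diff_self)
  then have "(\<Sum>n\<le>N. fscale (c n - c (Suc N)) (f n)) = 0"
    by (simp only: sum.atMost_Suc diff_self fscale.scale_zero_left add_0_right)
  moreover have "\<forall>n\<le>N. fscale (c n - c (Suc N)) (f n) \<in> G n" using Suc.prems(1) scale by simp
  ultimately have "\<forall>n\<le>N. fscale (c n - c (Suc N)) (f n) = 0" by (intro Suc.IH)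
  moreover have "c n \<noteq> c (Suc N)" if "n \<le> N" for n using that inj by (auto dest: injD)
  ultimately have small: "\<forall>n\<le>N. f n = 0" by simp
  then have "(\<Sum>n\<le>N. f n) = 0" by (intro sum.neutral) simp
  then have "f (Suc N) = 0" using Suc.prems(2) by (simp only: sum.atMost_Suc add_0_left)
  then show ?case using small by (metis le_Suc_eq)
qed simp

section \<open>The algebra of barred words\<close>

context
  fixes scale :: "'k::field \<Rightarrow> 'a::ring_1 \<Rightarrow> 'a"
begin

private abbreviation (input) H where "H \<equiv> TTA scale"
private abbreviation (input) HH where "HH \<equiv> tensor_space H H"
private abbreviation (input) juxtapose (infixl "\<cdot>" 70) where
  "x \<cdot> y \<equiv> bar_mult scale (tensor H H x y)"

definition element :: "'a option list \<Rightarrow> ('k, 'a) bars" where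
  "element xs = bar scale (map (word scale) (blocks xs))"

private abbreviation (input) pair where "pair l r \<equiv> tensor H H (element l) (element r)"
private abbreviation (input) times_HH where "times_HH \<equiv> tensor_square_mult H (bar_mult scale)"

lemma blocks_in: "map (word scale) (blocks xs) \<in> lists (vecs (TA scale))"
  using word_in[OF block_ne] by auto

lemma element_in: "element xs \<in> vecs H"
  unfolding element_def by (rule bar_in[OF blocks_in])

lemma element_Nil: "element [] = bar scale []"
  by (simp add: element_def)

lemma element_no_letters: "letters xs = 0 \<Longrightarrow> element xs = bar scale []"
proof -
  assume "letters xs = 0"
  then have "set xs \<subseteq> {None}" by (auto simp: letters_def filter_empty_conv)
  then have "blocks xs = []" by (induction xs) auto
  then show ?thesis by (simp add: element_def)
qed

lemma element_mult: "element xs \<cdot> element ys = element (xs @ None # ys)"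
  unfolding element_def bar_mult_bar[OF blocks_in blocks_in] by (simp add: blocks_append)

lemma scl_H [simp]: "scl H = fscale"
  by (simp add: TTA_def full_tensor_def)

lemma scl_TA [simp]: "scl (TA scale) = fscale"
  by (simp add: TA_def nonunital_tensor_def)

lemma scl_HH [simp]: "scl (tensor_space V W) = fscale"
  by (simp add: tensor_space_def)

lemma product_linear:
  "x \<in> vecs H \<Longrightarrow> linear_on H H (\<lambda>y. x \<cdot> y)" "y \<in> vecs H \<Longrightarrow> linear_on H H (\<lambda>x. x \<cdot> y)"
  by (rule linear_on_comp[OF tensor_linear(1) bar_mult_linear], assumption)
    (rule linear_on_comp[OF tensor_linear(2) bar_mult_linear], assumption)

lemma product_in: "x \<in> vecs H \<Longrightarrow> y \<in> vecs H \<Longrightarrow> x \<cdot> y \<in> vecs H"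
  by (rule linear_on_in[OF product_linear(1)])

text \<open>A bilinear product of spans lies in the span of the products of generators; the sets \<open>P\<close>, \<open>Q\<close> and \<open>R\<close>
  of barred words record degrees in the applications.\<close>

lemma product_in_span:
  assumes "x \<in> fscale.span (element ` P)" "y \<in> fscale.span (element ` Q)"
    and "\<And>xs ys. xs \<in> P \<Longrightarrow> ys \<in> Q \<Longrightarrow> xs @ None # ys \<in> R"
  shows "x \<cdot> y \<in> fscale.span (element ` R)"
proof -
  have y: "y \<in> vecs H"
    by (rule span_in_space[OF assms(2)]) (auto simp: element_in vector_space_on_TTA)
  have 1: "element xs \<cdot> y \<in> fscale.span (element ` R)" if "xs \<in> P" for xs
  proof (rule linear_on_span_image[OF product_linear(1)[OF element_in], where X = "element ` Q"])
    fix z assume "z \<in> element ` Q"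
    then show "element xs \<cdot> z \<in> fscale.span (element ` R)"
      using assms(3)[OF that] by (auto simp: element_mult intro!: fscale.span_base)
  qed (use assms(2) element_in in \<open>auto simp: vector_space_on_TTA\<close>)
  show ?thesis
    by (rule linear_on_span_image[OF product_linear(2)[OF y], where X = "element ` P"])
      (use assms(1) element_in 1 in \<open>auto simp: vector_space_on_TTA\<close>)
qed

text \<open>Expanding each \<open>w\<close> into words expands the bar product into elements of barred words.  With \<open>D\<close> false
  the degrees \<open>ds\<close> are tracked, which describes the homogeneous parts; with \<open>D\<close> true they are
  ignored, which describes the whole space.\<close>

lemma bar_in_span:
  assumes "list_all2 (\<lambda>w d. w \<in> fscale.span (word scale ` {as. as \<noteq> [] \<and> (length as = d \<or> D)})) ws ds"
  shows "bar scale ws \<in> fscale.span (element ` {xs. letters xs = sum_list ds \<or> D})"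
  using assms
proof (induction ws arbitrary: ds)
  case Nil
  then show ?case unfolding element_Nil[symmetric] by (intro fscale.span_base) simp
next
  case (Cons w ws)
  then obtain d ds' where ds: "ds = d # ds'"
    and w: "w \<in> fscale.span (word scale ` {as. as \<noteq> [] \<and> (length as = d \<or> D)})"
    and ws: "list_all2 (\<lambda>w d. w \<in> fscale.span (word scale ` {as. as \<noteq> [] \<and> (length as = d \<or> D)})) ws ds'"
    by (auto simp: list_all2_Cons1)
  have TA: "v \<in> vecs (TA scale)" if "v \<in> fscale.span (word scale ` {as. as \<noteq> [] \<and> (length as = d \<or> D)})" for v d
    by (rule span_in_space[OF that])
      (auto simp: word_in vector_space_on_TA)
  have "list_all (\<lambda>w. w \<in> vecs (TA scale)) ws" using ws TA
    by (auto simp: list_all_length list_all2_conv_all_nth)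
  then have ws': "ws \<in> lists (vecs (TA scale))" by (auto simp: list_all_iff)
  have "bar scale [w] \<in> fscale.span (element ` {xs. letters xs = d \<or> D})"
  proof (rule linear_on_span_image[OF bar_linear[of "[]" scale "[]", simplified] w])
    fix v assume "v \<in> word scale ` {as. as \<noteq> [] \<and> (length as = d \<or> D)}"
    then obtain as where as: "v = word scale as" "as \<noteq> []" "length as = d \<or> D" by blast
    then have "bar scale [v] = element (map Some as)" by (simp add: element_def blocks_word)
    moreover have "letters (map Some as) = length as" by (simp add: letters_def)
    ultimately show "bar scale [v] \<in> fscale.span (element ` {xs. letters xs = d \<or> D})"
      using as(3) by (auto intro!: fscale.span_base)
  qed (auto simp: word_in vector_space_on_TA)
  then have "bar scale [w] \<cdot> bar scale ws \<in> fscale.span (element ` {xs. letters xs = sum_list ds \<or> D})"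
    by (rule product_in_span[OF _ Cons.IH[OF ws]]) (auto simp: ds)
  then show ?case
    using bar_mult_bar[of "[w]" scale ws] TA[OF w] ws' by simp
qed

lemma span_words: "vecs (TA scale) = fscale.span (word scale ` {as. as \<noteq> []})"
  and span_words_degree: "vecs (tensor_power (whole scale) d) = fscale.span (word scale ` {as. length as = d})"
  unfolding TA_def nonunital_tensor_def tensor_power_def word_def
  by (auto simp: setcompr_eq_image intro!: arg_cong[where f = fscale.span])

lemma TTA_eq_span_elements: "H = fspan (range element)"
proof -
  let ?X = "{bar scale ws |ws. ws \<in> lists (vecs (TA scale))}"
  have "?X \<subseteq> fscale.span (range element)"
  proof
    fix x assume "x \<in> ?X"
    then obtain ws where ws: "x = bar scale ws" "ws \<in> lists (vecs (TA scale))" by blast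
    have "bar scale ws \<in> fscale.span (element ` {xs. letters xs = sum_list (map (\<lambda>w. 0) ws) \<or> True})"
      by (rule bar_in_span) (use ws(2) in \<open>auto simp: span_words list_all2_conv_all_nth\<close>)
    then show "x \<in> fscale.span (range element)" using ws(1) by simp
  qed
  moreover have "range element \<subseteq> ?X" using blocks_in by (auto simp: element_def)
  ultimately have "fscale.span ?X = fscale.span (range element)"
    unfolding fscale.span_eq using fscale.span_superset[of ?X] by blast
  then show ?thesis
    by (simp add: TTA_def full_tensor_def fspan_def bar_def)
qed

lemma TTA_degree_eq: "TTA_degree scale n = fscale.span (element ` {xs. letters xs = n})"
proof -
  let ?X = "{bar scale ws |ws ds.
     list_all2 (\<lambda>w d. 0 < d \<and> w \<in> vecs (tensor_power (whole scale) d)) ws ds \<and> sum_list ds = n}"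
  have "?X \<subseteq> fscale.span (element ` {xs. letters xs = n})"
  proof
    fix x assume "x \<in> ?X"
    then obtain ws ds where x: "x = bar scale ws" "sum_list ds = n"
      and ws: "list_all2 (\<lambda>w d. 0 < d \<and> w \<in> vecs (tensor_power (whole scale) d)) ws ds" by blast
    have "w \<in> fscale.span (word scale ` {as. as \<noteq> [] \<and> (length as = d \<or> False)})"
      if "0 < d \<and> w \<in> vecs (tensor_power (whole scale) d)" for w d
    proof -
      have "{as :: 'a list. length as = d} = {as. as \<noteq> [] \<and> (length as = d \<or> False)}" using that by auto
      then show ?thesis using that by (simp add: span_words_degree)
    qed
    then have "bar scale ws \<in> fscale.span (element ` {xs. letters xs = sum_list ds \<or> False})"
      by (intro bar_in_span list_all2_mono[OF ws])
    then show "x \<in> fscale.span (element ` {xs. letters xs = n})" using x by simp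
  qed
  moreover have "element ` {xs. letters xs = n} \<subseteq> ?X"
  proof
    fix x assume "x \<in> element ` {xs. letters xs = n}"
    then obtain xs where xs: "x = element xs" "letters xs = n" by blast
    have "list_all2 (\<lambda>w d. 0 < d \<and> w \<in> vecs (tensor_power (whole scale) d))
        (map (word scale) (blocks xs)) (map length (blocks xs))"
      unfolding list_all2_map1 list_all2_map2 list_all2_same span_words_degree
      using block_ne by (auto intro!: fscale.span_base)
    then show "x \<in> ?X"
      unfolding xs(1) element_def using xs(2) sum_list_blocks[of xs] by blast
  qed
  ultimately have "fscale.span ?X = fscale.span (element ` {xs. letters xs = n})"
    unfolding fscale.span_eq using fscale.span_superset[of ?X] by blast
  then show ?thesis by (simp add: TTA_degree_def)
qed

text \<open>Every identity between linear maps in the Hopf algebra axioms is verified on barred words by this rule.\<close>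

lemma linear_eq_on_elements:
  assumes "linear_on H U f" "linear_on H U h" "vector_space_on U"
    and "\<And>xs. f (element xs) = h (element xs)" "x \<in> vecs H"
  shows "f x = h x"
  using assms(4)
  by (intro linear_on_fspan_unique[OF assms(1,2)[unfolded TTA_eq_span_elements] assms(3) _ assms(5)[unfolded TTA_eq_span_elements]]) blast

lemma unit_in: "bar scale [] \<in> vecs H"
  using element_in[of "[]"] by (simp add: element_Nil)

lemma unit_left: "x \<in> vecs H \<Longrightarrow> bar scale [] \<cdot> x = x"
  unfolding TTA_def bar_mult_def bar_def by (rule concat_mult_unit_left[OF vector_space_on_TA])

lemma unit_right: "x \<in> vecs H \<Longrightarrow> x \<cdot> bar scale [] = x"
  unfolding TTA_def bar_mult_def bar_def by (rule concat_mult_unit_right[OF vector_space_on_TA])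

section \<open>The bialgebra structure\<close>

lemma linear_on_coproduct: "linear_on H HH (coproduct scale)"
  by (rule coproduct_linear[OF lists.Nil])

lemma left_part_eq:
  "left_part scale as S = element (map (\<lambda>i. Some (as ! (i - 1))) (sorted_list_of_set S))" if "finite S"
proof -
  have "map (\<lambda>i. Some (as ! (i - 1))) (sorted_list_of_set S) = map Some (subword as (sorted_list_of_set S))"
    by (simp add: subword_def)
  then show ?thesis
    unfolding left_part_def element_def using that by (simp only: blocks_word) (simp add: subword_def)
qed

text \<open>Together with \<open>left_part_eq\<close> this identifies the two factors of the summand for \<open>S\<close> with the left and
  right part of the corresponding splitting.\<close>

lemma right_part_eq:
  "right_part scale as S =
     element (map (\<lambda>i. if i \<in> S then None else Some (as ! (i - 1))) [1..<Suc (length as)])"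
proof -
  have eq: "map (\<lambda>i. if i \<in> S then None else Some (as ! (i - 1))) [1..<Suc (length as)] =
      map (map_option (\<lambda>i. as ! (i - 1))) (map (\<lambda>i. if i \<in> S then None else Some i) [1..<Suc (length as)])"
    by simp
  then show ?thesis
    unfolding right_part_def element_def components_are_blocks eq blocks_map
    by (simp add: comp_def subword_def)
qed

lemma pair_in: "pair l r \<in> vecs HH"
  by (intro tensor_in element_in)

lemma times_pair: "times_HH (pair l r) (pair l' r') = pair (l @ None # l') (r @ None # r')"
  using tensor_square_mult_properties(3)[OF vector_space_on_TTA bar_mult_linear element_in element_in element_in element_in]
  by (simp add: element_mult)

text \<open>The multiplicativity of the coproduct, seen on barred words.\<close>

lemma times_split_sum:
  "times_HH (split_sum xs pair) (split_sum ys pair) = split_sum (xs @ None # ys) pair"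
proof -
  note V = vector_space_on_tensor_space
  have "times_HH (split_sum xs pair) (split_sum ys pair) =
      split_sum xs (\<lambda>l r. times_HH (pair l r) (split_sum ys pair))"
    by (rule split_sum_linear_on(2)[OF times_HH_linear(2) V pair_in])
      (rule split_sum_linear_on(1)[OF linear_on_id V pair_in])
  also have "\<dots> = split_sum xs (\<lambda>l r. split_sum ys (\<lambda>l' r'. times_HH (pair l r) (pair l' r')))"
    by (rule split_sum_cong) (rule split_sum_linear_on(2)[OF times_HH_linear(1)[OF pair_in] V pair_in])
  also have "\<dots> = split_sum (xs @ None # ys) pair"
    unfolding times_pair split_sum_append ..
  finally show ?thesis .
qed

text \<open>The coproduct of the empty bar word is a right unit for the product on the tensor square, by its
  defining formula, and \<open>\<one> \<otimes> \<one>\<close> is a left unit, so the two agree.\<close>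

lemma coproduct_unit: "coproduct scale (bar scale []) = tensor H H (bar scale []) (bar scale [])"
proof -
  let ?e = "bar scale []" and ?u = "coproduct scale (bar scale [])"
  note e = unit_in
  have u: "?u \<in> vecs HH" by (rule linear_on_in[OF linear_on_coproduct e])
  have left: "times_HH (tensor H H ?e ?e) t = t" if t: "t \<in> vecs HH" for t
  proof (rule linear_on_fspan_unique[where g = "\<lambda>t. t" and x = t])
    let ?X = "{tensor H H v w |v w. v \<in> vecs H \<and> w \<in> vecs H}"
    show "linear_on (fspan ?X) HH (\<lambda>t. times_HH (tensor H H ?e ?e) t)"
      using times_HH_linear(1)[OF tensor_in[OF e e]] by (simp only: tensor_space_def)
    show "linear_on (fspan ?X) HH (\<lambda>t. t)"
      by (simp add: linear_on_def tensor_space_def)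
    show "t \<in> vecs (fspan ?X)" using t by (simp only: tensor_space_def)
    fix s assume "s \<in> ?X"
    then obtain v w where s: "s = tensor H H v w" and v: "v \<in> vecs H" and w: "w \<in> vecs H" by blast
    show "times_HH (tensor H H ?e ?e) s = s"
      unfolding s tensor_square_mult_properties(3)[OF vector_space_on_TTA bar_mult_linear e e v w]
        unit_left[OF v] unit_left[OF w] ..
  qed (rule vector_space_on_tensor_space)
  have "times_HH (tensor H H ?e ?e) ?u = tensor H H ?e ?e"
    using times_HH_unit_right[OF tensor_in[OF e e]] coproduct_bar(1)[OF lists.Nil, of scale] by simp
  then show ?thesis using left[OF u] by simp
qed

lemma coproduct_single_word:
  assumes "as \<noteq> []"
  shows "coproduct scale (bar scale [word scale as]) = split_sum (map Some as) pair"
  unfolding coproduct_word[OF assms] split_sum_subsets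
  by (rule sum.cong[OF refl]) (simp only: Pow_iff left_part_eq[OF finite_subset[OF _ finite_atLeastAtMost]] right_part_eq)

text \<open>Each step splits off the word before the first bar, on which the formula is the definition of the
  coproduct; if there is no letter before the bar, the bar changes neither side.\<close>

theorem coproduct_element: "coproduct scale (element xs) = split_sum xs pair"
proof (induction "length xs" arbitrary: xs rule: less_induct)
  case less
  have single: "coproduct scale (element (map Some as)) = split_sum (map Some as) pair" for as
  proof (cases "as = []")
    case True
    then show ?thesis by (simp add: element_Nil coproduct_unit)
  next
    case False
    then show ?thesis using coproduct_single_word[OF False] by (simp add: element_def blocks_word)
  qed
  show ?case
  proof (cases xs rule: barred_word_cases)
    case (word as)
    then show ?thesis by (simp only: single)
  next
    case (bar as ys)
    note IH = less[OF bar(2)]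
    show ?thesis
    proof (cases "as = []")
      case True
      have "element (None # zs) = element zs" for zs by (simp add: element_def)
      then show ?thesis using IH bar True by simp
    next
      case False
      let ?w = "word scale as" and ?ws = "map (word scale) (blocks ys)"
      have w: "?w # ?ws \<in> lists (vecs (TA scale))" "[?w] \<in> lists (vecs (TA scale))"
        using blocks_in[of ys] word_in[OF False] by auto
      have "element xs = bar scale (?w # ?ws)"
        unfolding bar(1) element_def blocks_append by (simp add: blocks_word False)
      then have "coproduct scale (element xs) = times_HH (coproduct_on_words scale ?w) (coproduct scale (element ys))"
        unfolding element_def using coproduct_bar(1)[OF w(1)] coproduct_bar(1)[OF blocks_in[of ys]] by simp
      also have "coproduct_on_words scale ?w = split_sum (map Some as) pair"
        using trans[OF coproduct_word[OF False, symmetric] coproduct_single_word[OF False]]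
        unfolding coproduct_on_words_word .
      also have "times_HH (split_sum (map Some as) pair) (coproduct scale (element ys)) = split_sum xs pair"
        unfolding IH bar(1) by (rule times_split_sum)
      finally show ?thesis .
    qed
  qed
qed

lemma augmentation_element: "augmentation (element xs) = (if letters xs = 0 then 1 else 0)"
proof -
  have "(\<lambda>ws. if ws = [] then 1 else 0) \<in> multilinear_forms (TA scale)"
    by (auto simp: multilinear_forms_def linear_on_def)
  then have "augmentation (element xs) = (if blocks xs = [] then 1 else 0)"
    by (simp add: augmentation_def element_def bar_def tens_def evaluation_def)
  moreover have "blocks xs = [] \<longleftrightarrow> letters xs = 0"
    using sum_list_blocks[of xs, symmetric] block_ne[of "hd (blocks xs)" xs] by (cases "blocks xs") auto
  ultimately show ?thesis by simp
qed

lemma augmentation_linear: "linear_on H ground augmentation"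
  by (simp add: linear_on_def augmentation_def fscale_apply)

text \<open>On elements of barred words both sides are the three barred words joined by bars; one variable at a
  time is then extended linearly.\<close>

lemma product_assoc:
  assumes x: "x \<in> vecs H" and y: "y \<in> vecs H" and z: "z \<in> vecs H"
  shows "(x \<cdot> y) \<cdot> z = x \<cdot> (y \<cdot> z)"
proof -
  note L = product_linear and V = vector_space_on_TTA[of scale]
  have 1: "(element a \<cdot> element b) \<cdot> element c = element a \<cdot> (element b \<cdot> element c)" for a b c
    by (simp add: element_mult)
  have 2: "(element a \<cdot> element b) \<cdot> z = element a \<cdot> (element b \<cdot> z)" for a b
    by (rule linear_eq_on_elements[OF L(1) linear_on_comp[OF L(1) L(1)] V 1 z]) (intro product_in element_in)+
  have 3: "(element a \<cdot> y) \<cdot> z = element a \<cdot> (y \<cdot> z)" for a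
    by (rule linear_eq_on_elements[OF linear_on_comp[OF L(1) L(2)] linear_on_comp[OF L(2) L(1)] V 2 y])
      (intro product_in element_in z)+
  show ?thesis
    by (rule linear_eq_on_elements[OF linear_on_comp[OF L(2) L(2)] L(2) V 3 x]) (intro product_in element_in z y)+
qed

lemma coproduct_product:
  assumes x: "x \<in> vecs H" and y: "y \<in> vecs H"
  shows "coproduct scale (x \<cdot> y) = times_HH (coproduct scale x) (coproduct scale y)"
proof -
  note L = product_linear and V = vector_space_on_tensor_space[of H H]
    and D = linear_on_coproduct
  have 1: "coproduct scale (element a \<cdot> element b) = times_HH (coproduct scale (element a)) (coproduct scale (element b))" for a b
    by (simp only: element_mult coproduct_element times_split_sum)
  have 2: "coproduct scale (element a \<cdot> y) = times_HH (coproduct scale (element a)) (coproduct scale y)" for a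
    by (rule linear_eq_on_elements[OF linear_on_comp[OF L(1) D] linear_on_comp[OF D times_HH_linear(1)] V 1 y])
      (intro element_in linear_on_in[OF D])+
  show ?thesis
    by (rule linear_eq_on_elements[OF linear_on_comp[OF L(2) D] linear_on_comp[OF D times_HH_linear(2)] V 2 x])
      (intro y linear_on_in[OF D])+
qed

lemma augmentation_product:
  assumes x: "x \<in> vecs H" and y: "y \<in> vecs H"
  shows "augmentation (x \<cdot> y) = augmentation x * augmentation y"
proof -
  note L = product_linear and A = augmentation_linear
  have V: "vector_space_on (ground :: ('k, 'k) vspace)"
  proof -
    have v: "vector_space ((*) :: 'k \<Rightarrow> 'k \<Rightarrow> 'k)" by unfold_locales (simp_all add: algebra_simps)
    then show ?thesis
      by (simp add: vector_space_on_def module.subspace_UNIV module_iff_vector_space)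
  qed
  have M: "linear_on H ground (\<lambda>x. augmentation x * c)" "linear_on H ground (\<lambda>x. c * augmentation x)" for c
    by (simp_all add: linear_on_def augmentation_def fscale_apply algebra_simps)
  have 1: "augmentation (element a \<cdot> element b) = augmentation (element a) * augmentation (element b)" for a b
    by (simp add: element_mult augmentation_element)
  have 2: "augmentation (element a \<cdot> y) = augmentation (element a) * augmentation y" for a
    by (rule linear_eq_on_elements[OF linear_on_comp[OF L(1) A] M(2) V 1 y]) (rule element_in)
  show ?thesis
    by (rule linear_eq_on_elements[OF linear_on_comp[OF L(2) A] M(1) V 2 x]) (rule y)
qed

lemma augmentation_unit: "augmentation (bar scale []) = 1"
  using augmentation_element[of "[]"] by (simp add: element_Nil)

text \<open>Evaluated on a barred word, the two sides are the two iterated split sums of \<open>split_sum_assoc\<close>.\<close>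

lemma coproduct_coassoc:
  assumes x: "x \<in> vecs H"
  shows "tensor_assoc H H H (tensor_map HH H (coproduct scale) id (coproduct scale x)) =
         tensor_map H HH id (coproduct scale) (coproduct scale x)"
proof -
  note V = vector_space_on_tensor_space and D = linear_on_coproduct
  let ?T = "tensor_space H HH"
  let ?f = "\<lambda>t. tensor_assoc H H H (tensor_map HH H (coproduct scale) id t)"
  let ?g = "tensor_map H HH id (coproduct scale)"
  have f: "linear_on HH ?T ?f"
    by (rule linear_on_comp[OF tensor_map_properties(1)[OF D linear_on_id]
          tensor_assoc_properties(1)[OF vector_space_on_TTA]])
  have g: "linear_on HH ?T ?g" by (rule tensor_map_properties(1)[OF linear_on_id D])
  have fp: "?f (pair l r) = split_sum l (\<lambda>l1 l2. tensor H HH (element l1) (pair l2 r))" for l r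
  proof -
    have "?f (pair l r) = tensor_assoc H H H (tensor HH H (split_sum l pair) (element r))"
      unfolding tensor_map_properties(2)[OF D linear_on_id] by (simp only: coproduct_element id_apply)
    also have "\<dots> = split_sum l (\<lambda>l1 l2. tensor_assoc H H H (tensor HH H (pair l1 l2) (element r)))"
      by (rule split_sum_linear_on(2)[OF linear_on_comp[OF tensor_linear(2)
              tensor_assoc_properties(1)[OF vector_space_on_TTA]] V pair_in]) (rule element_in)
    finally show ?thesis
      unfolding tensor_assoc_properties(2)[OF vector_space_on_TTA element_in element_in element_in] .
  qed
  have gp: "?g (pair l r) = split_sum r (\<lambda>r1 r2. tensor H HH (element l) (pair r1 r2))" for l r
    unfolding tensor_map_properties(2)[OF linear_on_id D] coproduct_element id_apply
    by (rule split_sum_linear_on(2)[OF tensor_linear(1) V pair_in]) (rule element_in)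
  have "?f (coproduct scale (element xs)) = ?g (coproduct scale (element xs))" for xs
    unfolding coproduct_element split_sum_linear_on(2)[OF f V pair_in]
      split_sum_linear_on(2)[OF g V pair_in] fp gp by (rule split_sum_assoc)
  then show ?thesis
    by (rule linear_eq_on_elements[OF linear_on_comp[OF D f] linear_on_comp[OF D g] V _ x])
qed

lemma coproduct_counit_left:
  assumes x: "x \<in> vecs H"
  shows "tensor_map ground H augmentation id (coproduct scale x) = tensor ground H 1 x"
proof -
  note V = vector_space_on_tensor_space and D = linear_on_coproduct
  let ?f = "tensor_map ground H augmentation id"
  have f: "linear_on HH (tensor_space ground H) ?f"
    by (rule tensor_map_properties(1)[OF augmentation_linear linear_on_id])
  have z: "tensor ground H 0 y = 0" if "y \<in> vecs H" for y
    using tensor_linear(2)[OF that, where V = ground] unfolding linear_on_def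
    by (metis UNIV_I add_cancel_right_right vecs_ground add_0)
  have on_elements: "?f (coproduct scale (element xs)) = tensor ground H 1 (element xs)" for xs
  proof -
    have "?f (coproduct scale (element xs)) =
        split_sum xs (\<lambda>l r. if letters l = 0 then tensor ground H 1 (element r) else 0)"
      unfolding coproduct_element split_sum_linear_on(2)[OF f V pair_in]
        tensor_map_properties(2)[OF augmentation_linear linear_on_id]
      by (rule split_sum_cong) (simp add: augmentation_element z[OF element_in])
    then show ?thesis by (simp only: split_sum_left_empty)
  qed
  show ?thesis
    by (rule linear_eq_on_elements[OF linear_on_comp[OF D f] tensor_linear(1) V on_elements x]) simp
qed

lemma coproduct_counit_right:
  assumes x: "x \<in> vecs H"
  shows "tensor_map H ground id augmentation (coproduct scale x) = tensor H ground x 1"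
proof -
  note V = vector_space_on_tensor_space and D = linear_on_coproduct
  let ?f = "tensor_map H ground id augmentation"
  have f: "linear_on HH (tensor_space H ground) ?f"
    by (rule tensor_map_properties(1)[OF linear_on_id augmentation_linear])
  have z: "tensor H ground y 0 = 0" if "y \<in> vecs H" for y
    using tensor_linear(1)[OF that, where W = ground] unfolding linear_on_def
    by (metis UNIV_I add_cancel_right_right vecs_ground add_0)
  have on_elements: "?f (coproduct scale (element xs)) = tensor H ground (element xs) 1" for xs
  proof -
    have "?f (coproduct scale (element xs)) =
        split_sum xs (\<lambda>l r. if letters r = 0 then tensor H ground (element l) 1 else 0)"
      unfolding coproduct_element split_sum_linear_on(2)[OF f V pair_in]
        tensor_map_properties(2)[OF linear_on_id augmentation_linear]
      by (rule split_sum_cong) (simp add: augmentation_element z[OF element_in])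
    then show ?thesis by (simp only: split_sum_right_empty)
  qed
  show ?thesis
    by (rule linear_eq_on_elements[OF linear_on_comp[OF D f] tensor_linear(2) V on_elements x]) simp
qed

section \<open>The antipode\<close>

text \<open>The antipode is the inverse of the identity map under convolution of endomorphisms, for which
  \<open>unit_counit\<close> is the neutral element.\<close>

definition convolution ::
  "(('k, 'a) bars \<Rightarrow> ('k, 'a) bars) \<Rightarrow> (('k, 'a) bars \<Rightarrow> ('k, 'a) bars) \<Rightarrow> ('k, 'a) bars \<Rightarrow> ('k, 'a) bars" where
  "convolution f h x = bar_mult scale (tensor_map (TTA scale) (TTA scale) f h (coproduct scale x))"

definition unit_counit :: "('k, 'a) bars \<Rightarrow> ('k, 'a) bars" where
  "unit_counit x = fscale (augmentation x) (bar scale [])"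

definition reduced :: "('k, 'a) bars \<Rightarrow> ('k, 'a) bars" where
  "reduced x = x - unit_counit x"

primrec reduced_power :: "nat \<Rightarrow> ('k, 'a) bars \<Rightarrow> ('k, 'a) bars" where
  "reduced_power 0 = unit_counit"
| "reduced_power (Suc k) = convolution reduced (reduced_power k)"

text \<open>The geometric series of \<open>unit_counit + reduced\<close>, which is the identity map.  On each vector
  only finitely many terms are nonzero, so the sum may run over these.\<close>

definition antipode :: "('k, 'a) bars \<Rightarrow> ('k, 'a) bars" where
  "antipode x = (\<Sum>k\<in>{k. reduced_power k x \<noteq> 0}. fscale ((-1) ^ k) (reduced_power k x))"

lemma convolution_linear:
  "linear_on H H f \<Longrightarrow> linear_on H H h \<Longrightarrow> linear_on H H (convolution f h)"
  unfolding convolution_def[abs_def]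
  by (rule linear_on_comp[OF linear_on_coproduct linear_on_comp[OF tensor_map_properties(1) bar_mult_linear]])

lemma convolution_additive:
  "convolution f h (x + y) = convolution f h x + convolution f h y" "convolution f h (fscale c x) = fscale c (convolution f h x)"
  by (simp_all add: convolution_def coproduct_def tensor_map_def bar_mult_def concat_mult_def
      lift_add lift_fscale)

lemma convolution_element:
  assumes "linear_on H H f" "linear_on H H h"
  shows "convolution f h (element xs) = split_sum xs (\<lambda>l r. f (element l) \<cdot> h (element r))"
proof -
  have "convolution f h (element xs) = split_sum xs (\<lambda>l r. bar_mult scale (tensor_map H H f h (pair l r)))"
    unfolding convolution_def coproduct_element
    by (rule split_sum_hom[where h = "\<lambda>t. bar_mult scale (tensor_map H H f h t)"])
      (simp add: tensor_map_def bar_mult_def concat_mult_def lift_add)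
  then show ?thesis unfolding tensor_map_properties(2)[OF assms] .
qed

lemma unit_counit_additive:
  "unit_counit (x + y) = unit_counit x + unit_counit y"
  "unit_counit (fscale c x) = fscale c (unit_counit x)"
  by (simp_all add: unit_counit_def augmentation_def fscale_def algebra_simps fun_eq_iff)

lemma subspace_TTA: "fscale.subspace (vecs H)"
  using vector_space_on_TTA[of scale] by (simp add: vector_space_on_def)

lemma unit_counit_linear: "linear_on H H unit_counit"
  using fscale.subspace_scale[OF subspace_TTA unit_in]
  by (simp add: linear_on_def unit_counit_additive) (simp add: unit_counit_def)

lemma reduced_linear: "linear_on H H reduced"
  using unit_counit_linear fscale.subspace_diff[OF subspace_TTA]
  by (simp add: linear_on_def reduced_def fscale.scale_right_diff_distrib)

lemma reduced_power_linear: "linear_on H H (reduced_power k)"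
  by (induction k) (simp_all add: unit_counit_linear convolution_linear[OF reduced_linear])

lemma unit_counit_element: "unit_counit (element xs) = (if letters xs = 0 then bar scale [] else 0)"
  by (simp add: unit_counit_def augmentation_element)

text \<open>The projection along the constants onto positive degree.\<close>

lemma reduced_element: "reduced (element xs) = (if letters xs = 0 then 0 else element xs)"
  by (simp add: reduced_def unit_counit_element element_no_letters)

lemma product_zero:
  "x \<in> vecs H \<Longrightarrow> x \<cdot> 0 = 0" "x \<in> vecs H \<Longrightarrow> 0 \<cdot> x = 0"
proof -
  have f0: "f 0 = 0" if "linear_on H H f" for f
  proof -
    have "f (0 + 0) = f 0 + f 0"
      using that fscale.subspace_0[OF subspace_TTA] unfolding linear_on_def by blast
    then show ?thesis by simp
  qed
  show "x \<in> vecs H \<Longrightarrow> x \<cdot> 0 = 0" by (rule f0[OF product_linear(1)])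
  show "x \<in> vecs H \<Longrightarrow> 0 \<cdot> x = 0" by (rule f0[OF product_linear(2)])
qed

lemma convolution_unit_counit:
  assumes f: "linear_on H H f"
  shows "convolution f unit_counit (element xs) = f (element xs)" "convolution unit_counit f (element xs) = f (element xs)"
proof -
  have in_H: "f (element ys) \<in> vecs H" for ys by (rule linear_on_in[OF f element_in])
  have "convolution f unit_counit (element xs) = split_sum xs (\<lambda>l r. if letters r = 0 then f (element l) else 0)"
    unfolding convolution_element[OF f unit_counit_linear]
    by (rule split_sum_cong) (simp add: unit_counit_element unit_right product_zero in_H)
  then show "convolution f unit_counit (element xs) = f (element xs)" by (simp only: split_sum_right_empty)
  have "convolution unit_counit f (element xs) = split_sum xs (\<lambda>l r. if letters l = 0 then f (element r) else 0)"
    unfolding convolution_element[OF unit_counit_linear f]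
    by (rule split_sum_cong) (simp add: unit_counit_element unit_left product_zero in_H)
  then show "convolution unit_counit f (element xs) = f (element xs)" by (simp only: split_sum_left_empty)
qed

text \<open>Associativity of convolution combines the associativity of the product with the coassociativity of
  splitting.\<close>

lemma convolution_assoc:
  assumes f: "linear_on H H f" and g: "linear_on H H g" and h: "linear_on H H h"
  shows "convolution (convolution f g) h (element xs) = convolution f (convolution g h) (element xs)"
proof -
  note V = vector_space_on_TTA[of scale]
  have in_H: "f (element ys) \<in> vecs H" "g (element ys) \<in> vecs H" "h (element ys) \<in> vecs H" for ys
    using linear_on_in[OF _ element_in] f g h by blast+
  have "convolution f g (element l) \<cdot> h (element r) = split_sum l (\<lambda>l1 l2. (f (element l1) \<cdot> g (element l2)) \<cdot> h (element r))" for l r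
    unfolding convolution_element[OF f g]
    by (rule split_sum_linear_on(2)[OF product_linear(2) V]) (intro product_in in_H)+
  then have "convolution (convolution f g) h (element xs) =
      split_sum xs (\<lambda>l r. split_sum l (\<lambda>l1 l2. (f (element l1) \<cdot> g (element l2)) \<cdot> h (element r)))"
    unfolding convolution_element[OF convolution_linear[OF f g] h] by (simp only:)
  also have "\<dots> = split_sum xs (\<lambda>l r. split_sum r (\<lambda>r1 r2. (f (element l) \<cdot> g (element r1)) \<cdot> h (element r2)))"
    by (rule split_sum_assoc)
  also have "\<dots> = split_sum xs (\<lambda>l r. split_sum r (\<lambda>r1 r2. f (element l) \<cdot> (g (element r1) \<cdot> h (element r2))))"
    by (simp only: product_assoc in_H)
  also have "\<dots> = split_sum xs (\<lambda>l r. f (element l) \<cdot> convolution g h (element r))"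
    unfolding convolution_element[OF g h]
    by (rule split_sum_cong, rule split_sum_linear_on(2)[OF product_linear(1) V, symmetric])
      (intro product_in in_H)+
  also have "\<dots> = convolution f (convolution g h) (element xs)"
    by (rule convolution_element[OF f convolution_linear[OF g h], symmetric])
  finally show ?thesis .
qed

lemma reduced_power_commute: "convolution (reduced_power k) reduced (element xs) = reduced_power (Suc k) (element xs)"
proof (induction k arbitrary: xs)
  case 0
  show ?case
    using convolution_unit_counit[OF reduced_linear] by simp
next
  case (Suc k)
  have "convolution (reduced_power (Suc k)) reduced (element xs) = convolution (convolution reduced (reduced_power k)) reduced (element xs)" by simp
  also have "\<dots> = convolution reduced (convolution (reduced_power k) reduced) (element xs)"
    by (rule convolution_assoc[OF reduced_linear reduced_power_linear reduced_linear])
  also have "\<dots> = convolution reduced (reduced_power (Suc k)) (element xs)"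
    unfolding convolution_element[OF reduced_linear convolution_linear[OF reduced_power_linear reduced_linear]]
      convolution_element[OF reduced_linear reduced_power_linear] Suc ..
  finally show ?case by simp
qed

text \<open>The factor \<open>reduced\<close> kills every splitting that sends no letter to the left, so each further power
  uses up at least one letter.\<close>

lemma reduced_power_vanishes: "letters xs < k \<Longrightarrow> reduced_power k (element xs) = 0"
proof (induction k arbitrary: xs)
  case (Suc k)
  have "reduced_power (Suc k) (element xs) = split_sum xs (\<lambda>l r. reduced (element l) \<cdot> reduced_power k (element r))"
    using convolution_element[OF reduced_linear reduced_power_linear] by simp
  also have "\<dots> = split_sum xs (\<lambda>l r. 0)"
  proof (rule split_sum_cong)
    fix l r :: "'a option list" assume lr: "letters l + letters r = letters xs"
    note in_H = linear_on_in[OF reduced_linear element_in] linear_on_in[OF reduced_power_linear element_in]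
    show "reduced (element l) \<cdot> reduced_power k (element r) = 0"
    proof (cases "letters l = 0")
      case True
      then show ?thesis by (simp add: reduced_element product_zero in_H)
    next
      case False
      then have "letters r < k" using lr Suc.prems by simp
      then have "reduced_power k (element r) = 0" by (rule Suc.IH)
      then show ?thesis by (simp only: product_zero in_H)
    qed
  qed
  finally show ?case by simp
qed simp

lemma reduced_power_additive:
  "reduced_power k (x + y) = reduced_power k x + reduced_power k y" "reduced_power k (fscale c x) = fscale c (reduced_power k x)"
  by (cases k; simp add: unit_counit_additive convolution_additive)+

lemma reduced_power_zero: "reduced_power k 0 = 0"
  using reduced_power_additive(2)[of k 0 0] by simp

text \<open>A vector is a combination of finitely many elements, so the numbers of letters occurring are bounded.\<close>

lemma reduced_power_locally_nilpotent:
  assumes "x \<in> vecs H"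
  shows "\<exists>n. \<forall>k>n. reduced_power k x = 0"
proof (rule span_image_induct[where e = element and I = UNIV and P = "\<lambda>x. \<exists>n. \<forall>k>n. reduced_power k x = 0"])
  show "x \<in> fscale.span (range element)" using assms by (simp add: TTA_eq_span_elements)
  show "\<exists>n. \<forall>k>n. reduced_power k (element xs) = 0" for xs using reduced_power_vanishes by blast
  show "\<exists>n. \<forall>k>n. reduced_power k 0 = 0" by (simp add: reduced_power_zero)
  show "\<exists>n. \<forall>k>n. reduced_power k (fscale c x) = 0" if "\<exists>n. \<forall>k>n. reduced_power k x = 0" for c x
    using that by (simp add: reduced_power_additive) (metis fscale.scale_zero_right)
  fix x y assume "\<exists>n. \<forall>k>n. reduced_power k x = 0" "\<exists>n. \<forall>k>n. reduced_power k y = 0"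
  then obtain m n where "\<forall>k>m. reduced_power k x = 0" "\<forall>k>n. reduced_power k y = 0" by blast
  then have "\<forall>k>max m n. reduced_power k (x + y) = 0" by (simp add: reduced_power_additive)
  then show "\<exists>n. \<forall>k>n. reduced_power k (x + y) = 0" ..
qed

text \<open>The truncations allow computing with finite sums over a range common to several vectors.\<close>

lemma antipode_eq:
  assumes "\<forall>k>n. reduced_power k x = 0"
  shows "antipode x = (\<Sum>k\<le>n. fscale ((-1) ^ k) (reduced_power k x))"
proof -
  have "{k. reduced_power k x \<noteq> 0} \<subseteq> {..n}" using assms by (auto simp: not_less[symmetric])
  then show ?thesis
    unfolding antipode_def by (intro sum.mono_neutral_left) auto
qed

lemma antipode_is_linear: "linear_on H H antipode"
  unfolding linear_on_def
proof (intro conjI ballI allI)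
  fix x assume x: "x \<in> vecs H"
  then obtain m where m: "\<forall>k>m. reduced_power k x = 0" using reduced_power_locally_nilpotent by blast
  show "antipode x \<in> vecs H"
    unfolding antipode_eq[OF m]
    by (intro fscale.subspace_sum[OF subspace_TTA] fscale.subspace_scale[OF subspace_TTA]
        linear_on_in[OF reduced_power_linear x])
  {
    fix y assume "y \<in> vecs H"
    then obtain n where n: "\<forall>k>n. reduced_power k y = 0" using reduced_power_locally_nilpotent by blast
    have "\<forall>k>max m n. reduced_power k x = 0" "\<forall>k>max m n. reduced_power k y = 0" "\<forall>k>max m n. reduced_power k (x + y) = 0"
      using m n by (simp_all add: reduced_power_additive)
    note eqs = this[THEN antipode_eq]
    show "antipode (x + y) = antipode x + antipode y"
      unfolding eqs by (simp only: reduced_power_additive fscale.scale_right_distrib sum.distrib)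
  }
  fix c
  have "\<forall>k>m. reduced_power k (fscale c x) = 0"
    using m by (simp add: reduced_power_additive)
  note eqs = this[THEN antipode_eq] m[THEN antipode_eq]
  show "antipode (scl H c x) = scl H c (antipode x)"
    unfolding scl_H eqs by (simp only: reduced_power_additive fscale.scale_sum_right fscale.scale_left_commute)
qed

lemma antipode_element:
  "letters xs \<le> n \<Longrightarrow> antipode (element xs) = (\<Sum>k\<le>n. fscale ((-1) ^ k) (reduced_power k (element xs)))"
  by (rule antipode_eq) (simp add: reduced_power_vanishes)

lemma split_sum_scale: "split_sum xs (\<lambda>l r. fscale c (F l r)) = fscale c (split_sum xs F)"
  by (rule split_sum_hom[where h = "fscale c", symmetric]) (rule fscale.scale_right_distrib)

lemma product_sum:
  assumes "\<And>k. k \<in> K \<Longrightarrow> x k \<in> vecs H" "y \<in> vecs H"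
  shows "(\<Sum>k\<in>K. fscale (c k) (x k)) \<cdot> y = (\<Sum>k\<in>K. fscale (c k) (x k \<cdot> y))"
    and "y \<cdot> (\<Sum>k\<in>K. fscale (c k) (x k)) = (\<Sum>k\<in>K. fscale (c k) (y \<cdot> x k))"
proof -
  have gen: "f (\<Sum>k\<in>K. fscale (c k) (x k)) = (\<Sum>k\<in>K. fscale (c k) (f (x k)))" if f: "linear_on H H f" "f 0 = 0" for f
  proof (cases "finite K")
    case True
    have "(\<Sum>k\<in>L. fscale (c k) (x k)) \<in> vecs H \<and>
        f (\<Sum>k\<in>L. fscale (c k) (x k)) = (\<Sum>k\<in>L. fscale (c k) (f (x k)))" if "finite L" "L \<subseteq> K" for L
      using that
    proof (induction L)
      case empty
      show ?case unfolding sum.empty f(2) using fscale.subspace_0[OF subspace_TTA] by blast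
    next
      case (insert k L)
      then have k: "x k \<in> vecs H" "fscale (c k) (x k) \<in> vecs H"
        using assms(1) fscale.subspace_scale[OF subspace_TTA] by blast+
      then have "f (fscale (c k) (x k) + (\<Sum>k\<in>L. fscale (c k) (x k))) =
          fscale (c k) (f (x k)) + f (\<Sum>k\<in>L. fscale (c k) (x k))"
        using f(1) insert by (simp add: linear_on_def)
      then show ?case
        unfolding sum.insert[OF insert(1,2)] using insert k(2)
        by (simp add: fscale.subspace_add[OF subspace_TTA] del: plus_fun_apply)
    qed
    then show ?thesis using True by blast
  qed (simp add: f)
  show "(\<Sum>k\<in>K. fscale (c k) (x k)) \<cdot> y = (\<Sum>k\<in>K. fscale (c k) (x k \<cdot> y))"
    by (rule gen[OF product_linear(2)]) (rule assms(2) product_zero)+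
  show "y \<cdot> (\<Sum>k\<in>K. fscale (c k) (x k)) = (\<Sum>k\<in>K. fscale (c k) (y \<cdot> x k))"
    by (rule gen[OF product_linear(1)]) (rule assms(2) product_zero)+
qed

lemma reduced_plus: "element xs = reduced (element xs) + unit_counit (element xs)"
  by (simp add: reduced_def)

lemma product_add:
  assumes "x \<in> vecs H" "y \<in> vecs H" "z \<in> vecs H"
  shows "x \<cdot> (y + z) = x \<cdot> y + x \<cdot> z" "(y + z) \<cdot> x = y \<cdot> x + z \<cdot> x"
  using product_linear(1)[OF assms(1)] product_linear(2)[OF assms(1)] assms(2,3)
  unfolding linear_on_def by blast+

text \<open>The identity map is the sum of \<open>reduced\<close> and the neutral element of convolution.\<close>

lemma convolution_id:
  assumes f: "linear_on H H f"
  shows "convolution f id (element xs) = convolution f reduced (element xs) + f (element xs)" "convolution id f (element xs) = convolution reduced f (element xs) + f (element xs)"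
proof -
  note U = unit_counit_linear and L = reduced_linear
  note in_H = linear_on_in[OF f element_in] linear_on_in[OF U element_in] linear_on_in[OF L element_in]
  have "f (element l) \<cdot> element r = f (element l) \<cdot> reduced (element r) + f (element l) \<cdot> unit_counit (element r)" for l r
    unfolding product_add[OF in_H(1) in_H(3,2), symmetric] reduced_plus[symmetric] ..
  then have "convolution f id (element xs) = convolution f reduced (element xs) + convolution f unit_counit (element xs)"
    unfolding convolution_element[OF f linear_on_id] convolution_element[OF f U] convolution_element[OF f L]
    by (simp only: split_sum_add id_apply)
  then show "convolution f id (element xs) = convolution f reduced (element xs) + f (element xs)"
    unfolding convolution_unit_counit[OF f] .
  have "element l \<cdot> f (element r) = reduced (element l) \<cdot> f (element r) + unit_counit (element l) \<cdot> f (element r)" for l r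
    unfolding product_add[OF in_H(1) in_H(3,2), symmetric] reduced_plus[symmetric] ..
  then have "convolution id f (element xs) = convolution reduced f (element xs) + convolution unit_counit f (element xs)"
    unfolding convolution_element[OF linear_on_id f] convolution_element[OF U f] convolution_element[OF L f]
    by (simp only: split_sum_add id_apply)
  then show "convolution id f (element xs) = convolution reduced f (element xs) + f (element xs)"
    unfolding convolution_unit_counit[OF f] .
qed

text \<open>On a barred word with \<open>n\<close> letters all terms of the series beyond the \<open>n\<close>th vanish, on the word
  as well as on the parts of its splittings, and the rest telescopes to the neutral element.\<close>

lemma antipode_convolution:
  assumes x: "x \<in> vecs H"
  shows "convolution antipode id x = unit_counit x" "convolution id antipode x = unit_counit x"
proof -
  note A = antipode_is_linear and I = linear_on_id
  have in_H: "reduced_power k (element xs) \<in> vecs H" for k xs by (rule linear_on_in[OF reduced_power_linear element_in])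
  have telescope: "(\<Sum>k\<le>letters xs. fscale ((-1) ^ k) (reduced_power (Suc k) (element xs) + reduced_power k (element xs))) = unit_counit (element xs)" for xs
    unfolding alternating_telescope[where a = "\<lambda>k. reduced_power k (element xs)"]
    by (simp add: reduced_power_vanishes del: reduced_power.simps(2))
  have left: "convolution antipode id (element xs) = unit_counit (element xs)" for xs
  proof -
    let ?n = "letters xs"
    have "convolution antipode id (element xs) =
        split_sum xs (\<lambda>l r. \<Sum>k\<le>?n. fscale ((-1) ^ k) (reduced_power k (element l) \<cdot> id (element r)))"
      unfolding convolution_element[OF A I]
      by (rule split_sum_cong) (simp add: antipode_element[of _ ?n] product_sum in_H element_in)
    also have "\<dots> = (\<Sum>k\<le>?n. fscale ((-1) ^ k) (convolution (reduced_power k) id (element xs)))"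
      unfolding split_sum_sum split_sum_scale convolution_element[OF reduced_power_linear I] ..
    also have "\<dots> = (\<Sum>k\<le>?n. fscale ((-1) ^ k) (reduced_power (Suc k) (element xs) + reduced_power k (element xs)))"
      unfolding convolution_id[OF reduced_power_linear] reduced_power_commute ..
    finally show ?thesis unfolding telescope .
  qed
  have right: "convolution id antipode (element xs) = unit_counit (element xs)" for xs
  proof -
    let ?n = "letters xs"
    have "convolution id antipode (element xs) =
        split_sum xs (\<lambda>l r. \<Sum>k\<le>?n. fscale ((-1) ^ k) (id (element l) \<cdot> reduced_power k (element r)))"
      unfolding convolution_element[OF I A]
      by (rule split_sum_cong) (simp add: antipode_element[of _ ?n] product_sum in_H element_in)
    also have "\<dots> = (\<Sum>k\<le>?n. fscale ((-1) ^ k) (convolution id (reduced_power k) (element xs)))"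
      unfolding split_sum_sum split_sum_scale convolution_element[OF I reduced_power_linear] ..
    also have "\<dots> = (\<Sum>k\<le>?n. fscale ((-1) ^ k) (reduced_power (Suc k) (element xs) + reduced_power k (element xs)))"
      unfolding convolution_id[OF reduced_power_linear] reduced_power.simps(2) ..
    finally show ?thesis unfolding telescope .
  qed
  note V = vector_space_on_TTA[of scale]
  show "convolution antipode id x = unit_counit x"
    by (rule linear_eq_on_elements[OF convolution_linear[OF A I] unit_counit_linear V left x])
  show "convolution id antipode x = unit_counit x"
    by (rule linear_eq_on_elements[OF convolution_linear[OF I A] unit_counit_linear V right x])
qed

section \<open>The grading\<close>

lemma reduced_power_degree:
  assumes "x \<in> TTA_degree scale n"
  shows "reduced_power k x \<in> TTA_degree scale n"
proof -
  have powers: "reduced_power k (element xs) \<in> fscale.span (element ` {ys. letters ys = letters xs})" for xs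
  proof (induction k arbitrary: xs)
    case 0
    have "bar scale [] \<in> fscale.span (element ` {ys. letters ys = letters xs})" if "letters xs = 0"
      unfolding element_Nil[symmetric] using that by (intro fscale.span_base) auto
    then show ?case by (simp add: unit_counit_element fscale.span_zero)
  next
    case (Suc k)
    show ?case
      unfolding reduced_power.simps convolution_element[OF reduced_linear reduced_power_linear]
    proof (rule split_sum_in_span)
      fix l r :: "'a option list" assume lr: "letters l + letters r = letters xs"
      have "reduced (element l) \<in> fscale.span (element ` {ys. letters ys = letters l})"
        by (simp add: reduced_element fscale.span_zero) (blast intro: fscale.span_base)
      then show "reduced (element l) \<cdot> reduced_power k (element r) \<in> fscale.span (element ` {ys. letters ys = letters xs})"
        by (rule product_in_span[OF _ Suc]) (use lr in simp)
    qed
  qed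
  show ?thesis
    using assms unfolding TTA_degree_eq
    by (rule span_image_induct[where P = "\<lambda>x. reduced_power k x \<in> fscale.span (element ` {xs. letters xs = n})"])
      (use powers in \<open>auto simp: reduced_power_additive reduced_power_zero fscale.span_zero
        intro: fscale.span_add fscale.span_scale\<close>)
qed

lemma antipode_degree:
  assumes "x \<in> TTA_degree scale n"
  shows "antipode x \<in> TTA_degree scale n"
  unfolding antipode_def
  using reduced_power_degree[OF assms] unfolding TTA_degree_eq
  by (intro fscale.span_sum fscale.span_scale)

lemma degree_in_TTA: "x \<in> TTA_degree scale n \<Longrightarrow> x \<in> vecs H"
  unfolding TTA_degree_eq
  by (erule span_in_space) (auto simp: element_in vector_space_on_TTA)

lemma element_degree: "letters xs = n \<Longrightarrow> element xs \<in> TTA_degree scale n"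
  unfolding TTA_degree_eq by (intro fscale.span_base) simp

lemma coproduct_degree:
  assumes "x \<in> TTA_degree scale n"
  shows "coproduct scale x \<in> fscale.span {tensor H H y z | y z p q.
    p + q = n \<and> y \<in> TTA_degree scale p \<and> z \<in> TTA_degree scale q}" (is "_ \<in> fscale.span ?X")
  using assms unfolding TTA_degree_eq[of n]
proof (rule span_image_induct[where P = "\<lambda>x. coproduct scale x \<in> fscale.span ?X"])
  fix xs :: "'a option list" assume xs: "xs \<in> {xs. letters xs = n}"
  show "coproduct scale (element xs) \<in> fscale.span ?X"
    unfolding coproduct_element
    by (rule split_sum_in_span, rule fscale.span_base) (use xs element_degree in blast)
qed (simp_all add: coproduct_def lift_zero lift_add lift_fscale fscale.span_zero fscale.span_add fscale.span_scale)

lemma product_degree: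
  "x \<in> TTA_degree scale p \<Longrightarrow> y \<in> TTA_degree scale q \<Longrightarrow> x \<cdot> y \<in> TTA_degree scale (p + q)"
  unfolding TTA_degree_eq by (erule product_in_span) auto

lemma augmentation_degree:
  assumes "x \<in> TTA_degree scale n" "n \<noteq> 0"
  shows "augmentation x = 0"
  using assms(1) unfolding TTA_degree_eq
  by (rule span_image_induct[where P = "\<lambda>x. augmentation x = 0"])
    (use assms(2) in \<open>auto simp: augmentation_element\<close>, simp_all add: augmentation_def fscale_apply)

lemma degree_zero: "TTA_degree scale 0 = {scl H c (bar scale []) | c. True}"
proof -
  have "element ` {xs. letters xs = 0} = {bar scale []}"
    using element_no_letters letters_simps(1) by (auto intro!: image_eqI[of _ _ "[]"])
  then show ?thesis
    unfolding TTA_degree_eq by (auto simp: fscale.span_singleton)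
qed

text \<open>Multiplication by \<open>c\<^sup>n\<close> in degree \<open>n\<close>, obtained from the universal properties of the two tensor
  constructions and therefore known to be well defined before the degrees are known to be independent.\<close>

definition rescale_word :: "'k \<Rightarrow> ('k, 'a) words \<Rightarrow> ('k, 'a) words" where
  "rescale_word c = lift (\<lambda>as. fscale (c ^ length as) (word scale as))"

definition rescale :: "'k \<Rightarrow> ('k, 'a) bars \<Rightarrow> ('k, 'a) bars" where
  "rescale c = lift (\<lambda>ws. bar scale (map (rescale_word c) ws))"

lemma rescale_word_properties:
  shows "linear_on (TA scale) (TA scale) (rescale_word c)"
    and "rescale_word c (word scale as) = fscale (c ^ length as) (word scale as)"
proof -
  let ?F = "full_tensor (whole scale)" and ?h = "\<lambda>as. fscale (c ^ length as) (word scale as)"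
  have s: "scl ?F = fscale" by (simp add: full_tensor_def)
  have lin: "linear_on (whole scale) ?F (\<lambda>v. ?h (xs @ v # ys))" for xs ys
    using linear_on_scale[OF tens_linear[of xs "whole scale" ys] vector_space_on_full_tensor]
    unfolding s word_def by simp
  have "word scale [] \<in> vecs ?F" unfolding word_def by (rule tens_in_full) simp
  then have h0: "?h [] \<in> vecs ?F" by simp
  note t = tens_lift[where h = ?h and V = "whole scale", folded full_tensor_eq,
      OF lin[unfolded full_tensor_eq] h0[unfolded full_tensor_eq]]
  show eq: "rescale_word c (word scale as) = ?h as" for as
    unfolding rescale_word_def by (subst (2) word_def) (rule t(2))
  have lin': "linear_on (TA scale) ?F (rescale_word c)"
    unfolding TA_def rescale_word_def full_tensor_eq by (rule linear_on_nonunital, rule t(1))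
  have "rescale_word c w \<in> vecs (TA scale)" if "w \<in> vecs (TA scale)" for w
    unfolding span_words
  proof (rule linear_on_span_image[OF lin'])
    show "w \<in> fscale.span (word scale ` {as. as \<noteq> []})" using that unfolding span_words .
    fix x assume "x \<in> word scale ` {as. as \<noteq> []}"
    then obtain as where x: "x = word scale as" "x \<in> word scale ` {as. as \<noteq> []}" by blast
    have "rescale_word c x = fscale (c ^ length as) x" unfolding x(1) by (rule eq)
    then show "rescale_word c x \<in> fscale.span (word scale ` {as. as \<noteq> []})"
      using fscale.span_scale[OF fscale.span_base[OF x(2)]] by simp
  qed (auto simp: word_in vector_space_on_TA s)
  then show "linear_on (TA scale) (TA scale) (rescale_word c)"
    using lin' by (simp add: linear_on_def s)
qed

text \<open>The words in front, \<open>us\<close>, are those from which the scalar has been moved out already.\<close>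

lemma bar_of_scaled_words:
  assumes "us \<in> lists (vecs (TA scale))" "\<forall>as\<in>set ass. as \<noteq> []"
  shows "bar scale (us @ map (\<lambda>as. fscale (c ^ length as) (word scale as)) ass) =
    fscale (c ^ sum_list (map length ass)) (bar scale (us @ map (word scale) ass))"
  using assms
proof (induction ass arbitrary: us)
  case (Cons as ass)
  let ?s = "\<lambda>as. fscale (c ^ length as) (word scale as)"
  have w: "word scale as \<in> vecs (TA scale)" using Cons.prems by (simp add: word_in)
  have tail: "map (word scale) ass \<in> lists (vecs (TA scale))" using Cons.prems by (auto simp: word_in)
  have s: "?s as \<in> vecs (TA scale)"
    unfolding span_words by (intro fscale.span_scale fscale.span_base) (use Cons.prems in auto)
  have "bar scale (us @ map ?s (as # ass)) = bar scale ((us @ [?s as]) @ map ?s ass)" by simp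
  also have "\<dots> = fscale (c ^ sum_list (map length ass)) (bar scale ((us @ [?s as]) @ map (word scale) ass))"
    by (rule Cons.IH) (use Cons.prems s in auto)
  also have "bar scale ((us @ [?s as]) @ map (word scale) ass) =
      fscale (c ^ length as) (bar scale (us @ word scale as # map (word scale) ass))"
    using bar_linear[OF Cons.prems(1) tail] w by (simp add: linear_on_def)
  finally show ?case by (simp add: power_add mult.commute)
qed simp

lemma rescale_element: "rescale c (element xs) = fscale (c ^ letters xs) (element xs)"
proof -
  let ?h = "\<lambda>ws. bar scale (map (rescale_word c) ws)"
  note R = rescale_word_properties
  have lists: "map (rescale_word c) ws \<in> lists (vecs (TA scale))" if "ws \<in> lists (vecs (TA scale))" for ws
    using that linear_on_in[OF R(1)] by (auto simp: in_lists_conv_set)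
  have lin: "linear_on (TA scale) H (\<lambda>w. ?h (us @ w # vs))"
    if "us \<in> lists (vecs (TA scale))" "vs \<in> lists (vecs (TA scale))" for us vs
    unfolding map_append list.map by (rule linear_on_comp[OF R(1) bar_linear]) (intro lists that)+
  have h0: "?h [] \<in> vecs H" using unit_in by simp
  note t = tens_lift(2)[where h = ?h and V = "TA scale", folded full_tensor_eq,
      OF lin[unfolded TTA_def full_tensor_eq] h0[unfolded TTA_def full_tensor_eq]]
  have "rescale c (element xs) = ?h (map (word scale) (blocks xs))"
    unfolding rescale_def element_def by (subst (2) bar_def) (rule t)
  also have "\<dots> = fscale (c ^ letters xs) (element xs)"
    using bar_of_scaled_words[of "[]" "blocks xs" c] block_ne[of _ xs]
    by (simp add: R(2) comp_def sum_list_blocks element_def)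
  finally show ?thesis .
qed

lemma rescale_degree:
  assumes "x \<in> TTA_degree scale n"
  shows "rescale c x = fscale (c ^ n) x"
  using assms unfolding TTA_degree_eq
  by (rule span_image_induct[where P = "\<lambda>x. rescale c x = fscale (c ^ n) x"])
    (simp_all add: rescale_element, simp_all add: rescale_def lift_zero lift_add lift_fscale
      fscale.scale_right_distrib mult.commute del: plus_fun_apply zero_fun_apply)

lemma degree_span: "vecs H = fscale.span (\<Union>n. TTA_degree scale n)"
proof
  have "range element \<subseteq> (\<Union>n. TTA_degree scale n)" using element_degree by blast
  then show "vecs H \<subseteq> fscale.span (\<Union>n. TTA_degree scale n)"
    unfolding TTA_eq_span_elements vecs_fspan by (rule fscale.span_mono)
  show "fscale.span (\<Union>n. TTA_degree scale n) \<subseteq> vecs H"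
    using degree_in_TTA by (intro fscale.span_minimal subspace_TTA) blast
qed

section \<open>Failure of commutativity and cocommutativity\<close>

text \<open>Linear forms that detect word lengths: for words \<open>w\<close> in letters with value 1 under \<open>f\<close>, \<open>length_form f n w\<close>
  is 1 if \<open>w\<close> has length \<open>n\<close> and 0 otherwise.  Their products \<open>shape_form f ns\<close> detect the list of
  word lengths.\<close>

definition length_form :: "('a \<Rightarrow> 'k) \<Rightarrow> nat \<Rightarrow> ('k, 'a) words \<Rightarrow> 'k" where
  "length_form f n w = w (\<lambda>as. if length as = n then prod_list (map f as) else 0)"

fun shape_form :: "('a \<Rightarrow> 'k) \<Rightarrow> nat list \<Rightarrow> ('k, 'a) words list \<Rightarrow> 'k" where
  "shape_form f [] [] = 1"
| "shape_form f (n # ns) (w # ws) = length_form f n w * shape_form f ns ws"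
| "shape_form f _ _ = 0"

lemma shape_form_linear: "linear_on (TA scale) ground (\<lambda>w. shape_form f ns (us @ w # vs))"
proof (induction us arbitrary: ns)
  case Nil
  show ?case by (cases ns) (simp_all add: linear_on_def length_form_def fscale_apply algebra_simps)
next
  case (Cons u us)
  show ?case
  proof (cases ns)
    case Nil
    then show ?thesis by (simp add: linear_on_def)
  next
    case (Cons n ms)
    then show ?thesis using Cons.IH[of ms] by (simp add: linear_on_def algebra_simps)
  qed
qed

lemma element_shape_form:
  assumes f: "linear_on (whole scale) ground f" "f 1 = 1" and xs: "set xs \<subseteq> {None, Some 1}"
  shows "element xs (shape_form f ns) = (if map length (blocks xs) = ns then 1 else 0)"
proof -
  have len: "length_form f n (word scale as) = (if length as = n then prod_list (map f as) else 0)" for n as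
  proof -
    have "linear_on (whole scale) ground (\<lambda>v. if length (us @ v # vs) = n then prod_list (map f (us @ v # vs)) else 0)" for us vs
      using f(1) by (simp add: linear_on_def algebra_simps)
    then have "(\<lambda>as. if length as = n then prod_list (map f as) else 0) \<in> multilinear_forms (whole scale)"
      by (simp add: multilinear_forms_def)
    then show ?thesis by (simp add: length_form_def word_def tens_def evaluation_def)
  qed
  have "\<Union> (set ` set (split_at_bars ys)) \<subseteq> {a. Some a \<in> set ys}" for ys :: "'a option list"
  proof (induction ys rule: barred_word_induct)
    case (letter a ys)
    then show ?case by (cases "split_at_bars ys") auto
  qed auto
  then have ones: "\<forall>as\<in>set (blocks xs). set as \<subseteq> {1}" using xs unfolding blocks_def by fastforce
  have one: "prod_list (map f as) = 1" if "set as \<subseteq> {1}" for as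
    using that f(2) by (induction as) auto
  have "shape_form f ns (map (word scale) ass) = (if map length ass = ns then 1 else 0)"
    if "\<forall>as\<in>set ass. set as \<subseteq> {1}" for ass
    using that
  proof (induction ass arbitrary: ns)
    case Nil
    show ?case by (cases ns) simp_all
  next
    case (Cons as ass)
    then show ?case by (cases ns) (simp_all add: len one)
  qed
  note shape = this[OF ones]
  have "shape_form f ns \<in> multilinear_forms (TA scale)"
    using shape_form_linear by (simp add: multilinear_forms_def)
  then show ?thesis
    using shape by (simp add: element_def bar_def tens_def evaluation_def)
qed

text \<open>$1|11$ and $11|1$ have different shapes.\<close>

lemma not_commutative:
  assumes f: "linear_on (whole scale) ground f" "f 1 = 1"
  shows "\<not> commutative_product H (bar_mult scale)"
proof
  assume "commutative_product H (bar_mult scale)"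
  then have "element [Some 1] \<cdot> element [Some 1, Some 1] = element [Some 1, Some 1] \<cdot> element [Some 1]"
    unfolding commutative_product_def using element_in by blast
  then have "element [Some 1, None, Some 1, Some 1] (shape_form f [1, 2]) =
      element [Some 1, Some 1, None, Some 1] (shape_form f [1, 2])"
    by (simp add: element_mult)
  then show False
    by (simp add: element_shape_form[OF f] blocks_def)
qed

text \<open>A product of two linear forms is a bilinear form, so it can be evaluated on pure tensors.\<close>

lemma tensor_eval:
  assumes "s \<in> vecs H" "t \<in> vecs H"
  shows "tensor H H s t (\<lambda>(x, y). x p * y q) = s p * t q"
proof -
  have "(\<lambda>(x, y). x p * y q) \<in> bilinear_forms H H"
    by (simp add: bilinear_forms_def linear_on_def fscale_apply algebra_simps)
  then show ?thesis by (simp add: tensor_def evaluation_def)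
qed

text \<open>In the coproduct of $111$, only the middle letter as \<open>S\<close> produces the shapes $1$ and $1,1$, namely in this
  order; three letters are the least number for which a complement has two components.\<close>

lemma not_cocommutative:
  assumes f: "linear_on (whole scale) ground f" "f 1 = 1"
  shows "\<not> cocommutative_coproduct H (coproduct scale)"
proof
  assume "cocommutative_coproduct H (coproduct scale)"
  let ?x = "[Some 1, Some 1, Some 1] :: 'a option list"
  let ?b = "\<lambda>(x, y). x (shape_form f [1, 1]) * y (shape_form f [1])"
  have ev: "split_sum xs F p = split_sum xs (\<lambda>l r. F l r p)" for xs :: "'a option list" and F :: "_ \<Rightarrow> _ \<Rightarrow> ('k, 'a) bars2" and p
    by (rule split_sum_hom[where h = "\<lambda>t. t p"]) simp
  have "tensor_swap H H (coproduct scale (element ?x)) = coproduct scale (element ?x)"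
    using \<open>cocommutative_coproduct H (coproduct scale)\<close> element_in
    unfolding cocommutative_coproduct_def by blast
  moreover have "tensor_swap H H (split_sum ?x pair) = split_sum ?x (\<lambda>l r. tensor_swap H H (pair l r))"
    by (rule split_sum_hom[where h = "tensor_swap H H"]) (simp only: tensor_swap_def lift_add)
  ultimately have "split_sum ?x (\<lambda>l r. pair r l) = split_sum ?x pair"
    by (simp only: coproduct_element tensor_swap_tensor)
  then have "split_sum ?x (\<lambda>l r. pair r l) ?b = split_sum ?x pair ?b" by (rule fun_cong)
  then have "split_sum ?x (\<lambda>l r. pair r l ?b) = split_sum ?x (\<lambda>l r. pair l r ?b)"
    unfolding ev .
  then show False
    by (simp add: tensor_eval[OF element_in element_in] element_shape_form[OF f] blocks_def)
qed

end

section \<open>The Hopf algebra\<close>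

text \<open>The degree $n$ part consists of eigenvectors of \<open>rescale scale 2\<close> for the eigenvalue $2^n$, and the powers
  of 2 are distinct in characteristic zero.\<close>

lemma degree_decomposition:
  fixes scale :: "'k::field_char_0 \<Rightarrow> 'a::ring_1 \<Rightarrow> 'a"
  shows "direct_sum_decomposition (TTA scale) (TTA_degree scale)"
  unfolding direct_sum_decomposition_def scl_H
proof (intro conjI allI impI)
  show "fscale.subspace (TTA_degree scale n)" for n
    unfolding TTA_degree_eq by (rule fscale.subspace_span)
  show "vecs (TTA scale) = fscale.span (\<Union>n. TTA_degree scale n)" by (rule degree_span)
next
  fix N f n
  assume "(\<forall>n\<le>N. f n \<in> TTA_degree scale n) \<and> (\<Sum>n\<le>N. f n) = 0" and "n \<le> N"
  moreover have "inj (\<lambda>n. (2 :: 'k) ^ n)"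
  proof (rule injI)
    fix m n :: nat assume "(2 :: 'k) ^ m = 2 ^ n"
    then have "of_nat (2 ^ m) = (of_nat (2 ^ n) :: 'k)" by simp
    then show "m = n" unfolding of_nat_eq_iff by simp
  qed
  ultimately have "\<forall>n\<le>N. f n = 0"
  proof (intro eigenspaces_independent[where \<phi> = "rescale scale 2" and G = "TTA_degree scale"
        and c = "\<lambda>n. 2 ^ n"])
    show "fscale a x \<in> TTA_degree scale n" if "x \<in> TTA_degree scale n" for a x n
      using that unfolding TTA_degree_eq by (rule fscale.span_scale)
    show "rescale scale 2 (x + y) = rescale scale 2 x + rescale scale 2 y" for x y
      unfolding rescale_def by (rule lift_add)
    show "rescale scale 2 x = fscale (2 ^ n) x" if "x \<in> TTA_degree scale n" for x n
      using that by (rule rescale_degree)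
  qed blast+
  then show "f n = 0" using \<open>n \<le> N\<close> by blast
qed

text \<open>A coordinate functional of a basis that contains 1, which is nonzero in \<open>ring_1\<close>.\<close>

lemma (in associative_unital_algebra) exists_unital_functional:
  "\<exists>f. linear_on (whole scale) ground f \<and> f 1 = 1"
proof -
  have ind: "independent {1 :: 'a}" by simp
  define B where "B = extend_basis {1 :: 'a}"
  have B: "independent B" "span B = UNIV" "1 \<in> B"
    using independent_extend_basis[OF ind] span_extend_basis[OF ind] extend_basis_superset[OF ind]
    by (auto simp: B_def)
  interpret rep: Vector_Spaces.linear scale "(*)" "\<lambda>x. representation B x 1"
    by (rule linear_representation[OF B(1,2)])
  have "representation B 1 1 = 1" using representation_basis[OF B(1,3)] by simp
  moreover have "linear_on (whole scale) ground (\<lambda>x. representation B x 1)"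
    by (simp add: linear_on_def whole_def rep.add rep.scale)
  ultimately show ?thesis by blast
qed

theorem theorem4:
  fixes scale :: "'k::field_char_0 \<Rightarrow> 'a::ring_1 \<Rightarrow> 'a"
  assumes "associative_unital_algebra scale"
  shows "(\<exists>antipode. connected_graded_hopf_algebra (TTA scale) (bar_mult scale) (bar scale [])
             (coproduct scale) augmentation antipode (TTA_degree scale)) \<and>
         \<not> commutative_product (TTA scale) (bar_mult scale) \<and>
         \<not> cocommutative_coproduct (TTA scale) (coproduct scale)"
proof (intro conjI exI)
  obtain f where f: "linear_on (whole scale) ground f" "f 1 = 1"
    using associative_unital_algebra.exists_unital_functional[OF assms] by blast
  show "\<not> commutative_product (TTA scale) (bar_mult scale)" by (rule not_commutative[OF f])
  show "\<not> cocommutative_coproduct (TTA scale) (coproduct scale)" by (rule not_cocommutative[OF f])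
  show "connected_graded_hopf_algebra (TTA scale) (bar_mult scale) (bar scale [])
             (coproduct scale) augmentation (antipode scale) (TTA_degree scale)"
  proof
    show "vector_space_on (TTA scale)" by (rule vector_space_on_TTA)
    show "linear_on (tensor_space (TTA scale) (TTA scale)) (TTA scale) (bar_mult scale)"
      by (rule bar_mult_linear)
    show "bar scale [] \<in> TTA_degree scale 0"
      using element_degree[of "[]" 0 scale] by (simp add: element_Nil)
    show "augmentation x = 0" if "x \<in> TTA_degree scale n" "n \<noteq> 0" for x n
      using that by (rule augmentation_degree)
  qed (simp_all only: unit_in product_assoc unit_left unit_right linear_on_coproduct
      augmentation_linear coproduct_coassoc coproduct_counit_left coproduct_counit_right
      coproduct_product coproduct_unit augmentation_product augmentation_unit antipode_is_linear
      antipode_convolution[unfolded convolution_def unit_counit_def] scl_H degree_decomposition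
      product_degree coproduct_degree augmentation_degree antipode_degree
      degree_zero element_degree vecs_fspan)
qed

end
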